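(* Let $n$ be a positive integer, let $p\in(0,1)$, and let $\mu$ be a discrete measure on the unit sphere $S^{n-1}\subset\mathbb{R}^n$. Then $\mu$ is the $L_p$ surface area measure of a polytope (i.e. there exists a polytope $P$ in $\mathbb{R}^n$ containing the origin in its interior with $S_p(P,\cdot)=\mu$) if and only if the support of $\mu$ is not concentrated on a closed hemisphere of $S^{n-1}$.
   Context: A polytope in $\mathbb{R}^n$ is the convex hull of a finite set of points, provided it has positive $n$-dimensional volume. A discrete measure on $S^{n-1}$ is a finite Borel measure of the form $\mu=\sum_{k=1}^{N}\alpha_k\delta_{u_k}$ with finitely many unit vectors $u_1,\dots,u_N$ and $\alpha_1,\dots,\alpha_N>0$, where $\delta_u$ is the unit point mass at $u$; its support is $\{u_1,\dots,u_N\}$. A closed hemisphere is a set $\{x\in S^{n-1}: x\cdot v\ge 0\}$ with $v\in S^{n-1}$; a set of unit vectors is not concentrated on a closed hemisphere if it is not contained in any such set. For a convex body $K$ (compact convex set with non-empty interior) in $\mathbb{R}^n$ containing the origin in its interior, the $L_p$ surface area measure $S_p(K,\cdot)$ is the Borel measure on $S^{n-1}$ given for Borel $\omega\subset S^{n-1}$ by $$S_p(K,\omega)=\int_{x\in\nu_K^{-1}(\omega)}(x\cdot\nu_K(x))^{1-p}\,d\mathcal{H}^{n-1}(x),$$ where $\nu_K:\partial'K\to S^{n-1}$ is the Gauss map, defined on the set $\partial'K$ of points of $\partial K$ with a unique outer unit normal, and $\mathcal{H}^{n-1}$ is $(n-1)$-dimensional Hausdorff measure. In particular, if $P$ is a polytope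 containing the origin in its interior with $N$ facets having outer unit normals $u_1,\dots,u_N$, and the facet with normal $u_k$ has $(n-1)$-dimensional area $a_k$ and distance $h_k$ from the origin, then $$S_p(P,\cdot)=\sum_{k=1}^{N}h_k^{1-p}a_k\,\delta_{u_k}(\cdot).$$ *)

theory Defs
  imports "HOL-Analysis.Analysis"
begin

(* Hausdorff measure of integer dimension d, normalised so that on R^d it is
   Lebesgue measure. Empty sets of a cover must contribute 0 also for d = 0,
   where a nonempty set contributes 1 (since 0 ^ 0 = 1), so that the
   0-dimensional measure is the counting measure. *)

definition hausdorff_gauge :: "nat \<Rightarrow> 'a::metric_space set \<Rightarrow> ennreal" where
  "hausdorff_gauge d A =
     (if A = {} then 0 else ennreal (unit_ball_vol (real d) * (diameter A / 2) ^ d))"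

definition hausdorff_delta :: "nat \<Rightarrow> real \<Rightarrow> 'a::metric_space set \<Rightarrow> ennreal" where
  "hausdorff_delta d \<delta> A =
     (INF C \<in> {C :: nat \<Rightarrow> 'a set. A \<subseteq> (\<Union>i. C i) \<and> (\<forall>i. bounded (C i) \<and> diameter (C i) \<le> \<delta>)}.
        (\<Sum>i. hausdorff_gauge d (C i)))"

definition hausdorff_outer_measure :: "nat \<Rightarrow> 'a::metric_space set \<Rightarrow> ennreal" where
  "hausdorff_outer_measure d A = (SUP \<delta> \<in> {0<..}. hausdorff_delta d \<delta> A)"

definition hausdorff_measure :: "nat \<Rightarrow> 'a::metric_space measure" where
  "hausdorff_measure d = measure_of UNIV (sets borel) (hausdorff_outer_measure d)"

definition sphere_borel :: "'a::euclidean_space measure" where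
  "sphere_borel = restrict_space borel (sphere 0 1)"

definition outer_unit_normals :: "'a::euclidean_space set \<Rightarrow> 'a \<Rightarrow> 'a set" where
  "outer_unit_normals K x = {u \<in> sphere 0 1. \<forall>y\<in>K. y \<bullet> u \<le> x \<bullet> u}"

definition regular_frontier :: "'a::euclidean_space set \<Rightarrow> 'a set" where
  "regular_frontier K = {x \<in> frontier K. \<exists>!u. u \<in> outer_unit_normals K x}"

definition gauss_map :: "'a::euclidean_space set \<Rightarrow> 'a \<Rightarrow> 'a" where
  "gauss_map K x = (THE u. u \<in> outer_unit_normals K x)"

(* Intended for convex bodies K with the origin in the interior; then
   x \<bullet> gauss_map K x > 0 on regular_frontier K, so powr is the usual power. *)
definition Lp_surface_area_measure :: "real \<Rightarrow> 'a::euclidean_space set \<Rightarrow> 'a measure" where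
  "Lp_surface_area_measure p K =
     measure_of (sphere 0 1) (sets sphere_borel)
       (\<lambda>\<omega>. \<integral>\<^sup>+ x \<in> {x \<in> regular_frontier K. gauss_map K x \<in> \<omega>}.
               ennreal ((x \<bullet> gauss_map K x) powr (1 - p)) \<partial>hausdorff_measure (DIM('a) - 1))"

(* The measure with masses \<alpha> u at the points u \<in> U; for U a finite set of unit
   vectors and \<alpha> > 0 on U, these are the discrete measures, with support U. *)
definition discrete_measure :: "'a::euclidean_space set \<Rightarrow> ('a \<Rightarrow> real) \<Rightarrow> 'a measure" where
  "discrete_measure U \<alpha> =
     measure_of (sphere 0 1) (sets sphere_borel)
       (\<lambda>\<omega>. \<Sum>u\<in>U. ennreal (\<alpha> u) * indicator \<omega> u)"

definition full_polytope :: "'a::euclidean_space set \<Rightarrow> bool" where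
  "full_polytope P \<longleftrightarrow> polytope P \<and> 0 < measure lebesgue P"

definition closed_hemisphere :: "'a::euclidean_space \<Rightarrow> 'a set" where
  "closed_hemisphere v = {x \<in> sphere 0 1. 0 \<le> x \<bullet> v}"

definition concentrated_on_closed_hemisphere :: "'a::euclidean_space set \<Rightarrow> bool" where
  "concentrated_on_closed_hemisphere U \<longleftrightarrow> (\<exists>v \<in> sphere 0 1. U \<subseteq> closed_hemisphere v)"

end

theory Submission
  imports Defs
begin

text \<open>
  Write \<open>P(h) = {x. \<forall>u\<in>U. x \<bullet> u \<le> h u}\<close>. The derivative of the volume of \<open>P(h)\<close> in \<open>h u\<close> is the area of
  the facet with normal \<open>u\<close>, so the sought polytope is a critical point of \<open>\<Sum>u\<in>U. \<alpha> u * (h u) powr p\<close>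
  under a volume constraint. The volume is invariant under translations but this sum is concave
  along them, hence one minimises over \<open>h\<close>, subject to \<open>vol P(h) \<ge> 1\<close>, the maximum of
  \<open>\<Sum>u\<in>U. \<alpha> u * (h u - \<xi> \<bullet> u) powr p\<close> over \<open>\<xi> \<in> P(h)\<close>. After translating the maximum point to the origin
  the energy itself bounds all \<open>h u\<close>, which gives a minimiser. As \<open>p < 1\<close>, the maximum point is
  interior and unique, so the maximum is differentiable in \<open>h\<close>, and the Euler-Lagrange equation reads
  \<open>\<alpha> u * (h u) powr (p - 1) = const * area u\<close>, the constant being removed by scaling.

  Hausdorff measure on a hyperplane is compared with Lebesgue measure of cylinders via uniqueness of
  translation invariant measures; the constant of proportionality plays no role. Conversely,
  the facets visible from one direction project onto a set with non-empty relative interior, so they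
  cannot all have zero area, and the normals do not lie in a closed hemisphere.
\<close>

text \<open>Minimising the plain sum over all translates would push the origin to the boundary,
  where some \<open>h u\<close> vanishes. The inner maximum keeps it inside, because
  \<open>s powr p\<close> has infinite slope at 0 for 0 < p < 1. This is used for the origin of the
  limit body and for the perturbed maximum points, so that tangents are taken at positive slacks
  only. The volume constraint is an inequality since that direction passes to limits by upper
  semicontinuity; equality for the minimiser follows from homogeneity, the energy having degree
  \<open>p\<close> and the volume degree n. A vector of \<open>U\<close> may have an empty facet
  during the variation. It becomes a genuine facet normal only through the Euler-Lagrange equation,
  whose side \<open>\<alpha> u * h u powr (p - 1)\<close> is positive. Facet areas enter as volumes
  of unit prisms over the facets, which makes them limits of difference quotients of volumes. Their
  ratio to Hausdorff measure depends on \<open>u\<close> alone and is fixed before the polytope is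
  chosen, so it can be divided out of the weights in advance.\<close>

section \<open>Hausdorff measure is a Borel measure\<close>

text \<open>Caratheodory's criterion. The part of \<open>A\<close> off \<open>F\<close> is exhausted by the sets \<open>B k\<close> at distance at least
  \<open>1 / (k + 1)\<close> from \<open>F\<close>; alternate layers \<open>D k\<close> are separated, so their measures are summable.\<close>
lemma closed_in_lambda_system:
  fixes f :: "'a::metric_space set \<Rightarrow> ennreal"
  assumes oms: "outer_measure_space UNIV f"
    and separated: "\<And>A B \<epsilon>. 0 < \<epsilon> \<Longrightarrow> (\<And>x y. x \<in> A \<Longrightarrow> y \<in> B \<Longrightarrow> \<epsilon> \<le> dist x y) \<Longrightarrow> f A + f B \<le> f (A \<union> B)"
    and "closed F"
  shows "F \<in> lambda_system UNIV UNIV f"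
proof -
  have f0: "f {} = 0" and mono: "\<And>A B. A \<subseteq> B \<Longrightarrow> f A \<le> f B"
    using oms by (auto simp: outer_measure_space_def positive_def increasing_def)
  \<comment> \<open>Countable subadditivity is given for disjoint families only;
    \<open>disjointed\<close> extends it to all sequences.\<close>
  have csub: "f (\<Union>i. A i) \<le> (\<Sum>i. f (A i))" for A :: "nat \<Rightarrow> 'a set"
  proof -
    have "f (\<Union>i. disjointed A i) \<le> (\<Sum>i. f (disjointed A i))"
      using oms disjoint_family_disjointed[of A]
      unfolding outer_measure_space_def countably_subadditive_def by blast
    also have "\<dots> \<le> (\<Sum>i. f (A i))"
      by (intro suminf_le mono disjointed_subset summableI)
    finally show ?thesis by (simp add: UN_disjointed_eq)
  qed
  have sub: "f (A \<union> B) \<le> f A + f B" for A B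
  proof -
    let ?C = "\<lambda>i :: nat. if i = 0 then A else if i = 1 then B else {}"
    have "f (\<Union>i. ?C i) \<le> (\<Sum>i. f (?C i))" by (rule csub)
    also have "\<dots> = (\<Sum>i<2. f (?C i))"
      by (rule suminf_finite) (auto simp: f0)
    also have "(\<Union>i. ?C i) = A \<union> B" by (auto split: if_splits)
    finally show ?thesis by (simp add: numeral_2_eq_2)
  qed
  \<comment> \<open>The empty set is treated apart because \<open>infdist x {}\<close> is 0 by
    convention.\<close>
  have le: "f (F \<inter> A) + f (- F \<inter> A) \<le> f A" if ne: "F \<noteq> {}" and fin: "f A \<noteq> top" for A
  proof -
    define B where "B k = {x \<in> A. 1 / real (Suc k) \<le> infdist x F}" for k
    define D where "D k = B (k + 2) - B (k + 1)" for k
    have Bmono: "B i \<subseteq> B j" if "i \<le> j" for i j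
    proof -
      have "1 / real (Suc j) \<le> 1 / real (Suc i)" using that by (simp add: frac_le)
      then show ?thesis by (auto simp: B_def)
    qed
    have FB: "f (F \<inter> A) + f (B k) \<le> f A" for k
    proof -
      have "f (F \<inter> A) + f (B k) \<le> f (F \<inter> A \<union> B k)"
      proof (rule separated[of "1 / real (Suc k)"])
        fix x y assume "x \<in> F \<inter> A" "y \<in> B k"
        then show "1 / real (Suc k) \<le> dist x y"
          using infdist_le[of x F y] by (auto simp: B_def dist_commute)
      qed auto
      also have "\<dots> \<le> f A" by (rule mono) (auto simp: B_def)
      finally show ?thesis .
    qed
    have cover: "- F \<inter> A \<subseteq> B (Suc k) \<union> (\<Union>j. D (j + k))" for k
    proof
      fix x assume x: "x \<in> - F \<inter> A"
      then have "0 < infdist x F"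
        using in_closed_iff_infdist_zero[OF \<open>closed F\<close> ne] infdist_nonneg[of x F] by (auto simp: less_le)
      then obtain m where m: "inverse (real (Suc m)) < infdist x F"
        using reals_Archimedean by blast
      then have ex: "x \<in> B m" using x by (auto simp: B_def inverse_eq_divide)
      define l where "l = (LEAST m. x \<in> B m)"
      have l: "x \<in> B l" unfolding l_def by (rule LeastI[of "\<lambda>m. x \<in> B m", OF ex])
      show "x \<in> B (Suc k) \<union> (\<Union>j. D (j + k))"
      proof (cases "l \<le> Suc k")
        case True then show ?thesis using l Bmono by blast
      next
        case False
        then obtain j where j: "l = Suc (Suc (j + k))"
          by (metis add.commute add_Suc_right less_imp_Suc_add not_le)
        have "x \<notin> B (Suc (j + k))" using not_less_Least[of "Suc (j + k)" "\<lambda>m. x \<in> B m"] j l_def by auto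
        then show ?thesis using l j by (auto simp: D_def)
      qed
    qed
    \<comment> \<open>\<open>c = 0\<close> and \<open>c = 1\<close> give the even and the odd
      layers. Points of \<open>B k\<close> have distance at least 1/(k+1) from \<open>F\<close>,
      those of \<open>D k\<close> less than 1/(k+2); this gap feeds the separation
      hypothesis.\<close>
    have alt: "(\<Sum>j<n. f (D (2 * j + c))) \<le> f (B (2 * n + c))" for n c
    proof (induction n)
      case (Suc n)
      let ?k = "2 * n + c"
      have "f (B ?k) + f (D ?k) \<le> f (B ?k \<union> D ?k)"
      proof (rule separated[of "1 / real (Suc ?k) - 1 / real (Suc (Suc ?k))"])
        show "0 < 1 / real (Suc ?k) - 1 / real (Suc (Suc ?k))"
          by (simp add: frac_less2 del: of_nat_Suc)
        fix x y assume "x \<in> B ?k" "y \<in> D ?k"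
        then have "1 / real (Suc ?k) \<le> infdist x F" "infdist y F < 1 / real (Suc (Suc ?k))"
          by (auto simp: B_def D_def)
        then show "1 / real (Suc ?k) - 1 / real (Suc (Suc ?k)) \<le> dist x y"
          using infdist_triangle[of x F y] by linarith
      qed
      also have "\<dots> \<le> f (B (2 * Suc n + c))"
        using Bmono[of ?k "2 * Suc n + c"] by (intro mono) (auto simp: D_def)
      finally show ?case using Suc.IH by (simp add: order_trans[OF add_right_mono])
    qed (simp add: f0)
    have fB: "f (B k) \<le> f A" for k by (rule mono) (auto simp: B_def)
    have part: "(\<Sum>j<2 * n. f (D j)) \<le> 2 * f A" for n
    proof -
      have "(\<Sum>j<2 * n. f (D j)) = (\<Sum>j<n. f (D (2 * j + 0))) + (\<Sum>j<n. f (D (2 * j + 1)))"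
        by (induction n) (auto simp: algebra_simps)
      also have "\<dots> \<le> f A + f A"
        using alt[of 0 n] alt[of 1 n] fB by (intro add_mono) (meson order_trans)+
      finally show ?thesis by (simp add: mult_2)
    qed
    have "(\<Sum>j. f (D j)) \<le> 2 * f A"
    proof (rule suminf_le_const[OF summableI])
      fix n show "(\<Sum>j<n. f (D j)) \<le> 2 * f A"
        using part[of n] by (rule order_trans[rotated]) (auto intro!: sum_mono2)
    qed
    then have finD: "(\<Sum>j. f (D j)) \<noteq> top" using fin
      by (metis ennreal_mult_less_top ennreal_numeral_less_top le_less_trans less_top)
    define d where "d j = enn2real (f (D j))" for j
    have fD: "f (D j) = ennreal (d j)" for j
    proof -
      have "f (D j) \<le> f A" by (rule mono) (auto simp: D_def B_def)
      then have "f (D j) < top" using fin by (simp add: le_less_trans less_top)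
      then show ?thesis by (simp add: d_def)
    qed
    have sd: "summable d"
    proof (rule summable_suminf_not_top)
      show "(\<Sum>j. ennreal (d j)) \<noteq> top" using finD unfolding fD .
    qed (simp add: d_def)
    \<comment> \<open>What \<open>B (Suc k)\<close> misses is covered by a tail of the convergent
      series of the \<open>f (D j)\<close>, and the tails tend to 0.\<close>
    have bound: "f (F \<inter> A) + f (- F \<inter> A) \<le> f A + ennreal (\<Sum>j. d (j + k))" for k
    proof -
      have "f (- F \<inter> A) \<le> f (B (Suc k)) + f (\<Union>j. D (j + k))"
        using mono[OF cover] sub order_trans by blast
      also have "\<dots> \<le> f (B (Suc k)) + (\<Sum>j. f (D (j + k)))"
        by (intro add_left_mono csub)
      also have "(\<Sum>j. f (D (j + k))) = ennreal (\<Sum>j. d (j + k))"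
        unfolding fD using summable_ignore_initial_segment[OF sd, of k]
          by (intro suminf_ennreal2) (simp_all add: d_def)
      finally have "f (F \<inter> A) + f (- F \<inter> A) \<le> f (F \<inter> A) + (f (B (Suc k)) + ennreal (\<Sum>j. d (j + k)))"
        by (rule add_left_mono)
      also have "\<dots> \<le> f A + ennreal (\<Sum>j. d (j + k))"
        using FB[of "Suc k"] by (simp add: add.assoc[symmetric] add_right_mono)
      finally show ?thesis .
    qed
    have "(\<lambda>k. f A + ennreal (\<Sum>j. d (j + k))) \<longlonglongrightarrow> f A + ennreal 0"
      using suminf_exist_split2[OF sd] by (intro tendsto_intros tendsto_ennrealI) auto
    then show ?thesis
      using bound by (intro LIMSEQ_le_const[where X="\<lambda>k. f A + ennreal (\<Sum>j. d (j + k))"]) auto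
  qed
  have "f (F \<inter> A) + f (- F \<inter> A) = f A" for A
  proof (rule antisym)
    show "f (F \<inter> A) + f (- F \<inter> A) \<le> f A"
      using le[of A] by (cases "F = {}"; cases "f A = top") (auto simp: f0)
    have "F \<inter> A \<union> (- F \<inter> A) = A" by auto
    then show "f A \<le> f (F \<inter> A) + f (- F \<inter> A)" using sub[of "F \<inter> A" "- F \<inter> A"] by simp
  qed
  then show ?thesis by (auto simp: lambda_system_def Compl_eq_Diff_UNIV)
qed

section \<open>Covers: subadditivity, Lipschitz images and separated sets for the Hausdorff outer
  measure\<close>

lemma hausdorff_gauge_mono:
  assumes "A \<subseteq> B" "bounded B"
  shows "hausdorff_gauge d A \<le> hausdorff_gauge d B"
proof -
  have "diameter A \<le> diameter B" "0 \<le> diameter A"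
    using assms by (auto intro: diameter_subset diameter_ge_0 bounded_subset)
  then show ?thesis
    using assms by (auto simp: hausdorff_gauge_def intro!: ennreal_leI mult_left_mono power_mono divide_right_mono)
qed

lemma hausdorff_delta_le:
  assumes "A \<subseteq> (\<Union>i. C i)" "\<And>i. bounded (C i)" "\<And>i. diameter (C i) \<le> \<delta>"
  shows "hausdorff_delta d \<delta> A \<le> (\<Sum>i. hausdorff_gauge d (C i))"
  unfolding hausdorff_delta_def using assms by (intro INF_lower) auto

lemma hausdorff_delta_approx:
  assumes "hausdorff_delta d \<delta> A < e"
  obtains C :: "nat \<Rightarrow> 'a::metric_space set" where "A \<subseteq> (\<Union>i. C i)" "\<And>i. bounded (C i)"
    "\<And>i. diameter (C i) \<le> \<delta>" "(\<Sum>i. hausdorff_gauge d (C i)) < e"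
  using assms unfolding hausdorff_delta_def INF_less_iff by auto

lemma hausdorff_delta_subadditive:
  assumes "0 < \<delta>"
  shows "hausdorff_delta d \<delta> (\<Union>i. A i) \<le> (\<Sum>i. hausdorff_delta d \<delta> (A i :: 'a::metric_space set))"
proof (rule ennreal_le_epsilon)
  fix e :: real assume e: "0 < e" "(\<Sum>n. hausdorff_delta d \<delta> (A n)) < top"
  then have *: "\<And>n. hausdorff_delta d \<delta> (A n) < hausdorff_delta d \<delta> (A n) + e * (1/2)^Suc n"
    by (auto simp add: less_top dest!: ennreal_suminf_lessD)
  have "\<exists>C. A n \<subseteq> (\<Union>i. C i) \<and> (\<forall>i. bounded (C i) \<and> diameter (C i) \<le> \<delta>)
      \<and> (\<Sum>i. hausdorff_gauge d (C i)) \<le> hausdorff_delta d \<delta> (A n) + e * (1/2)^Suc n" for n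
    by (rule hausdorff_delta_approx[OF *[of n]]) (blast intro: less_imp_le)
  then obtain B where B: "\<And>n. A n \<subseteq> (\<Union>i. B n i)" "\<And>n i. bounded (B n i)" "\<And>n i. diameter (B n i) \<le> \<delta>"
    and Ble: "\<And>n. (\<Sum>i. hausdorff_gauge d (B n i)) \<le> hausdorff_delta d \<delta> (A n) + e * (1/2)^Suc n"
    by metis
  define C where "C = case_prod B o prod_decode"
  have "(\<Union>i. A i) \<subseteq> (\<Union>i. C i)"
    using B(1) by (auto simp add: C_def subset_eq) (metis prod.case prod_encode_inverse)
  then have "hausdorff_delta d \<delta> (\<Union>i. A i) \<le> (\<Sum>i. hausdorff_gauge d (C i))"
    using B by (intro hausdorff_delta_le) (auto simp: C_def split: prod.splits)
  also have "\<dots> = (\<Sum>n. \<Sum>i. hausdorff_gauge d (B n i))"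
    using suminf_ennreal_2dimen[where f = "\<lambda>p. hausdorff_gauge d (case_prod B p)"] by (simp add: C_def)
  also have "\<dots> \<le> (\<Sum>n. hausdorff_delta d \<delta> (A n) + e * (1/2) ^ Suc n)"
    by (intro suminf_le Ble summableI)
  also have "... = (\<Sum>n. hausdorff_delta d \<delta> (A n)) + (\<Sum>n. ennreal e * ennreal ((1/2) ^ Suc n))"
    using \<open>0 < e\<close> by (subst suminf_add[symmetric])
                     (auto simp del: ennreal_suminf_cmult simp add: ennreal_mult[symmetric])
  also have "\<dots> = (\<Sum>n. hausdorff_delta d \<delta> (A n)) + e"
    unfolding ennreal_suminf_cmult
    by (subst suminf_ennreal_eq[OF zero_le_power power_half_series]) auto
  finally show "hausdorff_delta d \<delta> (\<Union>i. A i) \<le> (\<Sum>n. hausdorff_delta d \<delta> (A n)) + e" .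
qed

lemma hausdorff_delta_le_outer: "0 < \<delta> \<Longrightarrow> hausdorff_delta d \<delta> A \<le> hausdorff_outer_measure d A"
  unfolding hausdorff_outer_measure_def by (rule SUP_upper) auto

lemma hausdorff_outer_measure_subadditive:
  "hausdorff_outer_measure d (\<Union>i. A i) \<le> (\<Sum>i. hausdorff_outer_measure d (A i :: 'a::metric_space set))"
  unfolding hausdorff_outer_measure_def[of d "\<Union>i. A i"]
proof (rule SUP_least)
  fix \<delta> :: real assume "\<delta> \<in> {0<..}"
  then have "hausdorff_delta d \<delta> (\<Union>i. A i) \<le> (\<Sum>i. hausdorff_delta d \<delta> (A i))"
    by (intro hausdorff_delta_subadditive) auto
  also have "\<dots> \<le> (\<Sum>i. hausdorff_outer_measure d (A i))"
    using \<open>\<delta> \<in> {0<..}\<close> by (intro suminf_le hausdorff_delta_le_outer summableI) auto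
  finally show "hausdorff_delta d \<delta> (\<Union>i. A i) \<le> (\<Sum>i. hausdorff_outer_measure d (A i))" .
qed

text \<open>Images of covering sets cover the image and do not grow. Used for isometries and, in the
  necessity proof, for the orthogonal projection along a direction.\<close>

lemma hausdorff_outer_measure_lipschitz_image:
  fixes f :: "'a::metric_space \<Rightarrow> 'b::metric_space"
  assumes lip: "\<And>x y. x \<in> A \<Longrightarrow> y \<in> A \<Longrightarrow> dist (f x) (f y) \<le> dist x y"
  shows "hausdorff_outer_measure d (f ` A) \<le> hausdorff_outer_measure d A"
proof -
  have "hausdorff_delta d \<delta> (f ` A) \<le> hausdorff_delta d \<delta> A" if "0 < \<delta>" for \<delta>
    unfolding hausdorff_delta_def[of d \<delta> A]
  proof (rule INF_greatest)
    fix C :: "nat \<Rightarrow> 'a set"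
    assume C: "C \<in> {C. A \<subseteq> (\<Union>i. C i) \<and> (\<forall>i. bounded (C i) \<and> diameter (C i) \<le> \<delta>)}"
    \<comment> \<open>The Lipschitz bound is only available on \<open>A\<close>, so each covering
      set is first cut down to it.\<close>
    define D where "D i = f ` (A \<inter> C i)" for i
    have dd: "dist x y \<le> diameter (C i)" if "x \<in> D i" "y \<in> D i" for x y i
    proof -
      from that obtain a b where ab: "a \<in> A \<inter> C i" "b \<in> A \<inter> C i" "x = f a" "y = f b" by (auto simp: D_def)
      then have "dist x y \<le> dist a b" using lip by auto
      also have "\<dots> \<le> diameter (C i)" using ab C by (intro diameter_bounded_bound) auto
      finally show ?thesis .
    qed
    have b: "bounded (D i)" for i
      using dd[of _ i] by (auto simp: bounded_two_points)
    have dia: "diameter (D i) \<le> diameter (C i)" for i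
    proof (cases "D i = {}")
      case True then show ?thesis using C by (auto intro: diameter_ge_0)
    next
      case False then show ?thesis by (auto simp: diameter_def[of "D i"] intro!: cSUP_least dd)
    qed
    have ga: "hausdorff_gauge d (D i) \<le> hausdorff_gauge d (C i)" for i
    proof (cases "D i = {}")
      case False
      then have "C i \<noteq> {}" by (auto simp: D_def)
      then show ?thesis using False dia[of i] diameter_ge_0[OF b[of i]]
        by (auto simp: hausdorff_gauge_def intro!: ennreal_leI mult_left_mono power_mono divide_right_mono)
    qed (simp add: hausdorff_gauge_def)
    have "hausdorff_delta d \<delta> (f ` A) \<le> (\<Sum>i. hausdorff_gauge d (D i))"
    proof (rule hausdorff_delta_le)
      show "f ` A \<subseteq> (\<Union>i. D i)" using C by (fastforce simp: D_def)
      show "diameter (D i) \<le> \<delta>" for i using dia[of i] C by (auto intro: order_trans)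
    qed (rule b)
    also have "\<dots> \<le> (\<Sum>i. hausdorff_gauge d (C i))" by (intro suminf_le ga summableI)
    finally show "hausdorff_delta d \<delta> (f ` A) \<le> (\<Sum>i. hausdorff_gauge d (C i))" .
  qed
  then show ?thesis unfolding hausdorff_outer_measure_def by (intro SUP_mono) auto
qed

lemma hausdorff_outer_measure_mono:
  fixes A B :: "'a::metric_space set"
  assumes "A \<subseteq> B" shows "hausdorff_outer_measure d A \<le> hausdorff_outer_measure d B"
proof -
  have "hausdorff_delta d \<delta> A \<le> hausdorff_delta d \<delta> B" for \<delta>
    unfolding hausdorff_delta_def using assms by (intro INF_superset_mono) auto
  then show ?thesis unfolding hausdorff_outer_measure_def by (intro SUP_mono) auto
qed

text \<open>The Lipschitz bound is applied to \<open>f\<close> and to \<open>inv f\<close>; the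
  latter is 1-Lipschitz on the range of \<open>f\<close>, hence the restriction to points of
  \<open>A\<close> in that bound.\<close>

lemma hausdorff_outer_measure_isometric_image:
  fixes f :: "'a::metric_space \<Rightarrow> 'b::metric_space"
  assumes iso: "\<And>x y. dist (f x) (f y) = dist x y"
  shows "hausdorff_outer_measure d (f ` A) = hausdorff_outer_measure d A"
proof (rule antisym)
  have inj: "inj f" by (rule injI) (metis iso dist_eq_0_iff)
  have "hausdorff_outer_measure d (inv f ` f ` A) \<le> hausdorff_outer_measure d (f ` A)"
    by (rule hausdorff_outer_measure_lipschitz_image) (auto simp: iso inj)
  then show "hausdorff_outer_measure d A \<le> hausdorff_outer_measure d (f ` A)"
    by (simp add: image_comp inj)
qed (rule hausdorff_outer_measure_lipschitz_image, simp add: iso)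

lemma hausdorff_outer_measure_empty: "hausdorff_outer_measure d ({} :: 'a::metric_space set) = 0"
proof -
  have "hausdorff_delta d \<delta> ({} :: 'a set) \<le> 0" if "0 < \<delta>" for \<delta>
    using hausdorff_delta_le[of "{}" "\<lambda>_. {} :: 'a set" \<delta> d] that by (simp add: hausdorff_gauge_def)
  then show ?thesis unfolding hausdorff_outer_measure_def by (simp add: SUP_eq_iff)
qed

lemma outer_measure_space_hausdorff: "outer_measure_space UNIV (hausdorff_outer_measure d)"
  by (auto simp: outer_measure_space_def positive_def increasing_def countably_subadditive_def
      hausdorff_outer_measure_empty hausdorff_outer_measure_subadditive
      intro: hausdorff_outer_measure_mono)

text \<open>Once \<delta> < \<epsilon>, no covering set meets both \<open>A\<close> and
  \<open>B\<close>, so every cover of the union splits into covers of the two parts. Since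
  \<open>hausdorff_delta\<close> increases as \<delta> decreases, small \<delta> suffice.\<close>

lemma hausdorff_outer_measure_separated:
  fixes A B :: "'a::metric_space set"
  assumes "0 < \<epsilon>" and sep: "\<And>x y. x \<in> A \<Longrightarrow> y \<in> B \<Longrightarrow> \<epsilon> \<le> dist x y"
  shows "hausdorff_outer_measure d A + hausdorff_outer_measure d B \<le> hausdorff_outer_measure d (A \<union> B)"
proof -
  have anti: "hausdorff_delta d \<delta> S \<le> hausdorff_delta d \<delta>' S" if "\<delta>' \<le> \<delta>" for \<delta> \<delta>' and S :: "'a set"
    unfolding hausdorff_delta_def using that by (intro INF_superset_mono) (auto intro: order_trans)
  have small: "hausdorff_delta d \<delta> A + hausdorff_delta d \<delta> B \<le> hausdorff_delta d \<delta> (A \<union> B)"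
    if \<delta>: "0 < \<delta>" "\<delta> < \<epsilon>" for \<delta>
    unfolding hausdorff_delta_def[of d \<delta> "A \<union> B"]
  proof (rule INF_greatest)
    fix C :: "nat \<Rightarrow> 'a set"
    assume C: "C \<in> {C. A \<union> B \<subseteq> (\<Union>i. C i) \<and> (\<forall>i. bounded (C i) \<and> diameter (C i) \<le> \<delta>)}"
    have half: "hausdorff_delta d \<delta> S \<le> (\<Sum>i. hausdorff_gauge d (C i \<inter> S))" if "S \<subseteq> A \<union> B" for S
    proof (rule hausdorff_delta_le)
      show "S \<subseteq> (\<Union>i. C i \<inter> S)" using C that by auto
      fix i
      have "diameter (C i \<inter> S) \<le> diameter (C i)" "diameter (C i) \<le> \<delta>"
        using C by (auto intro!: diameter_subset)
      then show "diameter (C i \<inter> S) \<le> \<delta>" by linarith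
    qed (use C in \<open>auto intro: bounded_subset\<close>)
    have "hausdorff_gauge d (C i \<inter> A) + hausdorff_gauge d (C i \<inter> B) \<le> hausdorff_gauge d (C i)" for i
    proof -
      have "C i \<inter> A = {} \<or> C i \<inter> B = {}"
      proof (rule ccontr)
        assume "\<not> ?thesis"
        then obtain x y where xy: "x \<in> C i \<inter> A" "y \<in> C i \<inter> B" by blast
        then have "dist x y \<le> \<delta>" using diameter_bounded_bound[of "C i" x y] C by (auto intro: order_trans)
        with sep[of x y] xy \<delta> show False by auto
      qed
      moreover have "hausdorff_gauge d (C i \<inter> S) \<le> hausdorff_gauge d (C i)" for S
        using C by (intro hausdorff_gauge_mono) auto
      moreover have "hausdorff_gauge d ({} :: 'a set) = 0" by (simp add: hausdorff_gauge_def)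
      ultimately show ?thesis by auto
    qed
    then have "(\<Sum>i. hausdorff_gauge d (C i \<inter> A) + hausdorff_gauge d (C i \<inter> B)) \<le> (\<Sum>i. hausdorff_gauge d (C i))"
      by (intro suminf_le summableI)
    then have "(\<Sum>i. hausdorff_gauge d (C i \<inter> A)) + (\<Sum>i. hausdorff_gauge d (C i \<inter> B)) \<le> (\<Sum>i. hausdorff_gauge d (C i))"
      by (simp add: suminf_add[symmetric])
    then show "hausdorff_delta d \<delta> A + hausdorff_delta d \<delta> B \<le> (\<Sum>i. hausdorff_gauge d (C i))"
      using add_mono[OF half[of A] half[of B]] by auto
  qed
  have "hausdorff_outer_measure d A + hausdorff_outer_measure d B
      = (SUP \<delta>\<in>{0<..}. hausdorff_delta d \<delta> A + hausdorff_delta d \<delta> B)"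
    unfolding hausdorff_outer_measure_def
  proof (rule SUP_add_directed_ennreal[symmetric])
    fix i j :: real assume "i \<in> {0<..}" "j \<in> {0<..}"
    then show "\<exists>k\<in>{0<..}. hausdorff_delta d i A + hausdorff_delta d j B
        \<le> hausdorff_delta d k A + hausdorff_delta d k B"
      by (intro bexI[of _ "min i j"] add_mono anti) auto
  qed
  also have "\<dots> \<le> hausdorff_outer_measure d (A \<union> B)"
  proof (rule SUP_least)
    fix \<delta> :: real assume "\<delta> \<in> {0<..}"
    define \<delta>' where "\<delta>' = min \<delta> (\<epsilon> / 2)"
    have \<delta>': "0 < \<delta>'" "\<delta>' < \<epsilon>" "\<delta>' \<le> \<delta>" using \<open>0 < \<epsilon>\<close> \<open>\<delta> \<in> {0<..}\<close> by (auto simp: \<delta>'_def)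
    have "hausdorff_delta d \<delta> A + hausdorff_delta d \<delta> B \<le> hausdorff_delta d \<delta>' A + hausdorff_delta d \<delta>' B"
      by (intro add_mono anti \<delta>')
    also have "\<dots> \<le> hausdorff_delta d \<delta>' (A \<union> B)" by (intro small \<delta>')
    also have "\<dots> \<le> hausdorff_outer_measure d (A \<union> B)" by (intro hausdorff_delta_le_outer \<delta>')
    finally show "hausdorff_delta d \<delta> A + hausdorff_delta d \<delta> B \<le> hausdorff_outer_measure d (A \<union> B)" .
  qed
  finally show ?thesis .
qed

lemma sets_hausdorff_measure [simp, measurable_cong]: "sets (hausdorff_measure d) = sets borel"
  unfolding hausdorff_measure_def by (simp add: sets_measure_of_conv sets.sigma_sets_eq[of borel, simplified])

lemma space_hausdorff_measure [simp]: "space (hausdorff_measure d) = UNIV"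
  unfolding hausdorff_measure_def by (simp add: space_measure_of_conv)

text \<open>\<open>measure_of\<close> falls back to the zero measure unless the given function is a
  measure, so this is where Caratheodory's criterion enters: the measurable sets form a
  sigma-algebra containing the closed sets, hence the Borel sets.\<close>

lemma emeasure_hausdorff_measure:
  fixes A :: "'a::metric_space set"
  assumes "A \<in> sets borel"
  shows "emeasure (hausdorff_measure d) A = hausdorff_outer_measure d A"
proof -
  let ?L = "lambda_system UNIV UNIV (hausdorff_outer_measure d :: 'a set \<Rightarrow> ennreal)"
  interpret sigma_algebra UNIV "UNIV :: 'a set set" using sigma_algebra_Pow[of UNIV] by simp
  have ms: "measure_space UNIV ?L (hausdorff_outer_measure d)"
    by (rule caratheodory_lemma[OF outer_measure_space_hausdorff])
  have "Collect closed \<subseteq> ?L"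
    by (auto intro: closed_in_lambda_system[OF outer_measure_space_hausdorff]
        hausdorff_outer_measure_separated)
  then have "sigma_sets UNIV (Collect closed) \<subseteq> ?L"
    using ms by (intro sigma_algebra.sigma_sets_subset) (auto simp: measure_space_def)
  then have "sets borel \<subseteq> ?L" by (simp add: borel_eq_closed)
  then have "measure_space UNIV (sets borel) (hausdorff_outer_measure d :: 'a set \<Rightarrow> ennreal)"
    using sets.sigma_algebra_axioms[of "borel :: 'a measure"] by (intro measure_down[OF ms]) auto
  then show ?thesis
    using assms unfolding hausdorff_measure_def
    by (intro emeasure_measure_of_sigma) (auto simp: measure_space_def)
qed

section \<open>Hausdorff measure on hyperplanes\<close>

lemma emeasure_lborel_translate:
  fixes A :: "'a::euclidean_space set"
  assumes "A \<in> sets borel"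
  shows "emeasure lborel {x. x + w \<in> A} = emeasure lborel A"
proof -
  have "emeasure (distr lborel borel ((+) w)) A = emeasure lborel ((+) w -` A \<inter> space lborel)"
    using assms by (intro emeasure_distr) auto
  also have "(+) w -` A \<inter> space lborel = {x. x + w \<in> A}" by (auto simp: add.commute)
  finally show ?thesis by (simp add: lborel_distr_plus)
qed

text \<open>Uniqueness of Haar measure: evaluate \<open>\<integral>\<integral> 1\<^sub>A(x) 1\<^sub>B(x - y) dM(x) dN(y)\<close> in both orders.\<close>
lemma translation_invariant_measures_proportional:
  fixes M N :: "'a::euclidean_space measure"
  assumes sf: "sigma_finite_measure M" "sigma_finite_measure N"
    and sets [measurable_cong, simp]: "sets M = sets borel" "sets N = sets borel"
    and W: "subspace W" "AE x in M. x \<in> W" "AE x in N. x \<in> W"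
    and invM: "\<And>w C. w \<in> W \<Longrightarrow> C \<in> sets borel \<Longrightarrow> emeasure M {x. x + w \<in> C} = emeasure M C"
    and invN: "\<And>w C. w \<in> W \<Longrightarrow> C \<in> sets borel \<Longrightarrow> emeasure N {x. x + w \<in> C} = emeasure N C"
    and A: "A \<in> sets borel" and B: "B \<in> sets borel" and sym: "\<And>x. - x \<in> B \<longleftrightarrow> x \<in> B"
  shows "emeasure M A * emeasure N B = emeasure M B * emeasure N A"
proof -
  interpret M: sigma_finite_measure M by fact
  interpret N: sigma_finite_measure N by fact
  interpret P: pair_sigma_finite M N ..
  have spM [simp]: "space M = UNIV" and spN [simp]: "space N = UNIV"
    using sets_eq_imp_space_eq[OF sets(1)] sets_eq_imp_space_eq[OF sets(2)] by auto
  note [measurable] = A B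
  \<comment> \<open>Symmetry of \<open>B\<close> turns \<open>x - y\<close> into
    \<open>y - x\<close>, so the integral over \<open>y\<close> becomes the \<open>N\<close>-measure
    of a translate of \<open>B\<close>, independent of \<open>x\<close>.\<close>
  have diffB: "y - x \<in> B \<longleftrightarrow> x - y \<in> B" for x y using sym[of "x - y"] by simp
  have "emeasure M A * emeasure N B = (\<integral>\<^sup>+x. indicator A x * emeasure N B \<partial>M)"
    by (simp add: nn_integral_multc)
  also have "\<dots> = (\<integral>\<^sup>+x. indicator A x * (\<integral>\<^sup>+y. indicator B (x - y) \<partial>N) \<partial>M)"
  proof (rule nn_integral_cong_AE, use W(2) in eventually_elim)
    fix x assume "x \<in> W"
    have "(\<integral>\<^sup>+y. indicator B (x - y) \<partial>N) = (\<integral>\<^sup>+y. indicator {y. y + (- x) \<in> B} y \<partial>N)"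
      by (intro nn_integral_cong) (auto simp: indicator_def diffB)
    also have "\<dots> = emeasure N {y. y + (- x) \<in> B}"
      by (rule nn_integral_indicator) measurable
    also have "\<dots> = emeasure N B" using \<open>x \<in> W\<close> W(1) B by (intro invN) (auto intro: subspace_neg)
    finally show "indicator A x * emeasure N B = indicator A x * (\<integral>\<^sup>+y. indicator B (x - y) \<partial>N)" by simp
  qed
  also have "\<dots> = (\<integral>\<^sup>+x. (\<integral>\<^sup>+y. indicator A x * indicator B (x - y) \<partial>N) \<partial>M)"
    by (subst nn_integral_cmult) auto
  also have "\<dots> = (\<integral>\<^sup>+y. (\<integral>\<^sup>+x. indicator A x * indicator B (x - y) \<partial>M) \<partial>N)"
    by (rule P.Fubini'[symmetric]) measurable
  also have "\<dots> = (\<integral>\<^sup>+y. (\<integral>\<^sup>+x. indicator A (x + y) * indicator B x \<partial>M) \<partial>N)"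
  proof (rule nn_integral_cong_AE, use W(3) in eventually_elim)
    fix y assume y: "y \<in> W"
    have d: "distr M borel (\<lambda>x. x + y) = M"
    proof (rule measure_eqI)
      fix C assume "C \<in> sets (distr M borel (\<lambda>x. x + y))"
      then show "emeasure (distr M borel (\<lambda>x. x + y)) C = emeasure M C"
        using invM[OF y, of C] by (subst emeasure_distr) (auto simp: vimage_def)
    qed simp
    have "(\<integral>\<^sup>+x. indicator A x * indicator B (x - y) \<partial>M)
        = (\<integral>\<^sup>+x. indicator A x * indicator B (x - y) \<partial>distr M borel (\<lambda>x. x + y))" by (simp add: d)
    also have "\<dots> = (\<integral>\<^sup>+x. indicator A (x + y) * indicator B x \<partial>M)"
      by (subst nn_integral_distr) auto
    finally show "(\<integral>\<^sup>+x. indicator A x * indicator B (x - y) \<partial>M)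
        = (\<integral>\<^sup>+x. indicator A (x + y) * indicator B x \<partial>M)" .
  qed
  also have "\<dots> = (\<integral>\<^sup>+x. (\<integral>\<^sup>+y. indicator A (x + y) * indicator B x \<partial>N) \<partial>M)"
    by (rule P.Fubini') measurable
  also have "\<dots> = (\<integral>\<^sup>+x. indicator B x * emeasure N A \<partial>M)"
  proof (rule nn_integral_cong_AE, use W(2) in eventually_elim)
    fix x assume "x \<in> W"
    have "(\<integral>\<^sup>+y. indicator A (x + y) * indicator B x \<partial>N) = (\<integral>\<^sup>+y. indicator A (x + y) \<partial>N) * indicator B x"
      by (rule nn_integral_multc) measurable
    also have "(\<integral>\<^sup>+y. indicator A (x + y) \<partial>N) = (\<integral>\<^sup>+y. indicator {y. y + x \<in> A} y \<partial>N)"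
      by (intro nn_integral_cong) (auto simp: indicator_def add.commute)
    also have "\<dots> = emeasure N {y. y + x \<in> A}"
      by (rule nn_integral_indicator) measurable
    also have "\<dots> = emeasure N A" using \<open>x \<in> W\<close> A by (rule invN)
    finally show "(\<integral>\<^sup>+y. indicator A (x + y) * indicator B x \<partial>N) = indicator B x * emeasure N A"
      by (simp add: mult.commute)
  qed
  also have "\<dots> = emeasure M B * emeasure N A"
    by (simp add: nn_integral_multc)
  finally show ?thesis .
qed

section \<open>Projection along a unit vector and prisms of height 1\<close>

definition proj_perp :: "'a::euclidean_space \<Rightarrow> 'a \<Rightarrow> 'a" where
  "proj_perp u x = x - (x \<bullet> u) *\<^sub>R u"

lemma proj_perp_add: "proj_perp u (x + y) = proj_perp u x + proj_perp u y"
  by (simp add: proj_perp_def algebra_simps inner_left_distrib)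

lemma proj_perp_diff: "proj_perp u (x - y) = proj_perp u x - proj_perp u y"
  by (simp add: proj_perp_def algebra_simps inner_diff_left)

lemma proj_perp_orthogonal [simp]: "norm u = 1 \<Longrightarrow> proj_perp u x \<bullet> u = 0"
  by (simp add: proj_perp_def inner_diff_left dot_square_norm)

lemma proj_perp_id: "x \<bullet> u = 0 \<Longrightarrow> proj_perp u x = x"
  by (simp add: proj_perp_def)

lemma norm_proj_perp_le:
  assumes "norm u = 1" shows "norm (proj_perp u x) \<le> norm x"
proof (rule power2_le_imp_le)
  have "(norm (proj_perp u x))\<^sup>2 = (norm x)\<^sup>2 - (x \<bullet> u)\<^sup>2"
    using assms unfolding power2_norm_eq_inner
    by (simp add: proj_perp_def norm_eq_1 inner_diff inner_commute power2_eq_square)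
  then show "(norm (proj_perp u x))\<^sup>2 \<le> (norm x)\<^sup>2" by simp
qed simp

lemma dist_proj_perp_le: "norm u = 1 \<Longrightarrow> dist (proj_perp u x) (proj_perp u y) \<le> dist x y"
  by (simp add: dist_norm norm_proj_perp_le flip: proj_perp_diff)

lemma continuous_on_proj_perp [continuous_intros]:
  "continuous_on S f \<Longrightarrow> continuous_on S (\<lambda>x. proj_perp u (f x))"
  unfolding proj_perp_def by (intro continuous_intros)

lemma borel_measurable_proj_perp [measurable]: "proj_perp u \<in> borel_measurable borel"
  by (intro borel_measurable_continuous_onI continuous_intros)

text \<open>For a unit vector \<open>u\<close> and \<open>A\<close> in the hyperplane orthogonal to
  it, this is the unit prism over \<open>A\<close>; its volume serves as the area of
  \<open>A\<close>, without coordinates on the hyperplane.\<close>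

definition cylinder :: "'a::euclidean_space \<Rightarrow> 'a set \<Rightarrow> 'a set" where
  "cylinder u A = {x. 0 \<le> x \<bullet> u \<and> x \<bullet> u \<le> 1 \<and> proj_perp u x \<in> A}"

lemma borel_cylinder [measurable]: "A \<in> sets borel \<Longrightarrow> cylinder u A \<in> sets borel"
proof -
  assume "A \<in> sets borel"
  then have "proj_perp u -` A \<in> sets borel"
    using measurable_sets_borel[OF borel_measurable_proj_perp] by blast
  moreover have "cylinder u A = {x. 0 \<le> x \<bullet> u \<and> x \<bullet> u \<le> 1} \<inter> proj_perp u -` A"
    by (auto simp: cylinder_def)
  ultimately show ?thesis by simp
qed

lemma emeasure_cylinder_finite:
  fixes u :: "'a::euclidean_space"
  assumes "norm u = 1" and "bounded A"
  shows "emeasure lborel (cylinder u A) < \<infinity>"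
proof -
  obtain R where R: "\<And>x. x \<in> A \<Longrightarrow> norm x \<le> R" using assms(2) by (auto simp: bounded_iff)
  have "norm x \<le> R + 1" if "x \<in> cylinder u A" for x
  proof -
    have "norm (proj_perp u x + (x \<bullet> u) *\<^sub>R u) \<le> R + 1"
      using that assms(1) by (intro norm_triangle_mono R) (auto simp: cylinder_def)
    then show ?thesis by (simp add: proj_perp_def)
  qed
  then have "cylinder u A \<subseteq> cball 0 (R + 1)" by auto
  then have "bounded (cylinder u A)" by (rule bounded_subset[OF bounded_cball])
  then show ?thesis by (rule emeasure_bounded_finite)
qed

lemma emeasure_cylinder_ball_pos:
  fixes u :: "'a::euclidean_space"
  assumes u: "norm u = 1" and r: "0 < r"
  shows "0 < emeasure lborel (cylinder u (cball 0 r \<inter> {x. x \<bullet> u = 0}))"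
proof -
  \<comment> \<open>The centre is the midpoint of the prism's axis: radius at most 1/2 keeps the
    ball between the two bases, radius at most \<open>r\<close> keeps its projection in the
    base.\<close>
  have "ball ((1/2) *\<^sub>R u) (min r (1/2)) \<subseteq> cylinder u (cball 0 r \<inter> {x. x \<bullet> u = 0})"
  proof
    fix x assume "x \<in> ball ((1/2) *\<^sub>R u) (min r (1/2))"
    then have x: "norm (x - (1/2) *\<^sub>R u) < 1/2" "norm (x - (1/2) *\<^sub>R u) < r" by (simp_all add: dist_norm norm_minus_commute)
    have "\<bar>(x - (1/2) *\<^sub>R u) \<bullet> u\<bar> \<le> norm (x - (1/2) *\<^sub>R u) * norm u" by (rule Cauchy_Schwarz_ineq2)
    then have "\<bar>x \<bullet> u - 1/2\<bar> < 1/2" using u x(1) by (simp add: inner_diff_left dot_square_norm)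
    then have "0 \<le> x \<bullet> u" "x \<bullet> u \<le> 1" by linarith+
    moreover have "proj_perp u x = proj_perp u (x - (1/2) *\<^sub>R u)"
      using u by (simp add: proj_perp_def inner_diff_left dot_square_norm algebra_simps)
    then have "norm (proj_perp u x) \<le> r" using norm_proj_perp_le[OF u, of "x - (1/2) *\<^sub>R u"] x by simp
    ultimately show "x \<in> cylinder u (cball 0 r \<inter> {x. x \<bullet> u = 0})"
      using u by (simp add: cylinder_def)
  qed
  then have "emeasure lborel (ball ((1/2) *\<^sub>R u) (min r (1/2))) \<le> emeasure lborel (cylinder u (cball 0 r \<inter> {x. x \<bullet> u = 0}))"
    by (intro emeasure_mono) (auto intro!: borel_cylinder sets.Int borel_closed closed_hyperplane[of u, unfolded inner_commute[of u]])
  moreover have "0 < emeasure lborel (ball ((1/2) *\<^sub>R u) (min r (1/2)))"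
    using r content_ball_pos[of "min r (1/2)" "(1/2) *\<^sub>R u"]
    by (metis enn2real_0 less_irrefl measure_def min_less_iff_conj not_gr_zero zero_less_divide_1_iff zero_less_numeral)
  ultimately show ?thesis by order
qed

section \<open>Balls in a hyperplane have positive and finite Hausdorff measure\<close>

lemma hausdorff_delta_finite_cover:
  fixes C :: "'i \<Rightarrow> 'a::metric_space set"
  assumes "finite I" "A \<subseteq> (\<Union>i\<in>I. C i)" and C: "\<And>i. i \<in> I \<Longrightarrow> bounded (C i)" "\<And>i. i \<in> I \<Longrightarrow> diameter (C i) \<le> \<delta>"
    and "0 \<le> \<delta>"
  shows "hausdorff_delta d \<delta> A \<le> (\<Sum>i\<in>I. hausdorff_gauge d (C i))"
proof -
  obtain h where h: "bij_betw h {0..<card I} I" using ex_bij_betw_nat_finite[OF \<open>finite I\<close>] by blast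
  \<comment> \<open>Padding with empty sets is free because their gauge is 0 even in dimension
    0.\<close>
  define D where "D n = (if n < card I then C (h n) else {})" for n
  have hI: "n < card I \<Longrightarrow> h n \<in> I" for n using h by (auto simp: bij_betw_def)
  have "hausdorff_delta d \<delta> A \<le> (\<Sum>n. hausdorff_gauge d (D n))"
  proof (rule hausdorff_delta_le)
    have "(\<Union>i\<in>I. C i) \<subseteq> (\<Union>n. D n)"
      using h by (auto simp: bij_betw_def D_def image_iff) (metis atLeastLessThan_iff imageE)
    then show "A \<subseteq> (\<Union>n. D n)" using assms(2) by auto
  qed (use C hI \<open>0 \<le> \<delta>\<close> in \<open>auto simp: D_def\<close>)
  also have "\<dots> = (\<Sum>n\<in>{0..<card I}. hausdorff_gauge d (D n))"
    by (rule suminf_finite) (auto simp: D_def hausdorff_gauge_def)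
  also have "\<dots> = (\<Sum>n\<in>{0..<card I}. hausdorff_gauge d (C (h n)))"
    by (rule sum.cong) (auto simp: D_def)
  also have "\<dots> = (\<Sum>i\<in>I. hausdorff_gauge d (C i))"
    by (rule sum.reindex_bij_betw[OF h])
  finally show ?thesis .
qed

lemma hausdorff_outer_measure_coordinate_cube_finite:
  fixes e :: "'a::euclidean_space"
  assumes e: "e \<in> Basis" and r: "0 < r"
  shows "hausdorff_outer_measure (DIM('a) - 1) {x. x \<bullet> e = 0 \<and> (\<forall>b\<in>Basis. \<bar>x \<bullet> b\<bar> \<le> r)} < \<infinity>"
proof -
  let ?d = "DIM('a) - 1" and ?D = "real DIM('a)"
  let ?S = "{x. x \<bullet> e = 0 \<and> (\<forall>b\<in>Basis. \<bar>x \<bullet> b\<bar> \<le> r)}"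
  \<comment> \<open>With n = \<open>DIM('a)\<close>, the cube is cut into m^(n-1) cells of diameter
    at most n * 2r / m (bounding the norm by the l1 norm). In the sum of the gauges the powers of
    \<open>m\<close> cancel, leaving \<open>K\<close> for every \<delta>.\<close>
  define K where "K = unit_ball_vol (real ?d) * (?D * r) ^ ?d"
  have "hausdorff_delta ?d \<delta> ?S \<le> ennreal K" if \<delta>: "0 < \<delta>" for \<delta>
  proof -
    obtain m :: nat where m: "?D * (2 * r) / \<delta> < real m" using reals_Archimedean2 by blast
    have "0 < ?D * (2 * r) / \<delta>" using r \<delta> by simp
    with m have m0: "0 < real m" by linarith
    define I where "I = (Basis - {e}) \<rightarrow>\<^sub>E {..<m}"
    define C where "C f = {x. x \<bullet> e = 0 \<and> (\<forall>b\<in>Basis - {e}. - r + 2 * r * real (f b) / m \<le> x \<bullet> b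
        \<and> x \<bullet> b \<le> - r + 2 * r * (real (f b) + 1) / m)}" for f :: "'a \<Rightarrow> nat"
    have finI: "finite I" and cardI: "card I = m ^ ?d"
      using e by (auto simp: I_def finite_PiE card_PiE)
    have dC: "dist x y \<le> ?D * (2 * r / m)" if "x \<in> C f" "y \<in> C f" for x y f
    proof -
      have "dist x y \<le> (\<Sum>b\<in>Basis. \<bar>(x - y) \<bullet> b\<bar>)" unfolding dist_norm by (rule norm_le_l1)
      also have "\<dots> \<le> (\<Sum>b\<in>(Basis :: 'a set). 2 * r / m)"
      proof (rule sum_mono)
        fix b :: 'a assume b: "b \<in> Basis"
        show "\<bar>(x - y) \<bullet> b\<bar> \<le> 2 * r / m"
        proof (cases "b = e")
          case True then show ?thesis using that r m0 by (auto simp: C_def inner_diff_left)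
        next
          case False
          then have "- r + 2 * r * real (f b) / m \<le> x \<bullet> b" "x \<bullet> b \<le> - r + 2 * r * (real (f b) + 1) / m"
            "- r + 2 * r * real (f b) / m \<le> y \<bullet> b" "y \<bullet> b \<le> - r + 2 * r * (real (f b) + 1) / m"
            using that b by (auto simp: C_def)
          moreover have "2 * r * (real (f b) + 1) / m = 2 * r * real (f b) / m + 2 * r / m"
            by (simp add: add_divide_distrib algebra_simps)
          ultimately show ?thesis by (simp add: inner_diff_left)
        qed
      qed
      finally show ?thesis by simp
    qed
    have bC: "bounded (C f)" for f unfolding bounded_two_points using dC by blast
    have diC: "diameter (C f) \<le> ?D * (2 * r / m)" for f
      using dC r m0 by (intro diameter_le) (auto simp: dist_norm)
    have "?S \<subseteq> (\<Union>f\<in>I. C f)"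
    proof
      fix x assume x: "x \<in> ?S"
      \<comment> \<open>On the face \<open>x \<bullet> b = r\<close> the floor would give the index
        \<open>m\<close>, out of range, so these points go to the last cell
        \<open>m - 1\<close>.\<close>
      define f where "f = (\<lambda>b\<in>Basis - {e}. if x \<bullet> b = r then m - 1 else nat \<lfloor>(x \<bullet> b + r) * m / (2 * r)\<rfloor>)"
      have fb: "f b < m \<and> - r + 2 * r * real (f b) / m \<le> x \<bullet> b \<and> x \<bullet> b \<le> - r + 2 * r * (real (f b) + 1) / m"
        if b: "b \<in> Basis - {e}" for b
      proof (cases "x \<bullet> b = r")
        case True
        then have "f b = m - 1" using b by (simp add: f_def)
        then have "real (f b) = m - 1" "f b < m" using m0 by (auto simp: of_nat_diff)
        then show ?thesis using True m0 r by (simp add: field_simps)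
      next
        case False
        define t where "t = (x \<bullet> b + r) * m / (2 * r)"
        have xb: "- r \<le> x \<bullet> b" "x \<bullet> b < r" using x b False by (auto simp: abs_le_iff less_le)
        have t0: "0 \<le> t" using xb r m0 by (simp add: t_def)
        have tm: "t < m" using xb r m0 by (simp add: t_def field_simps)
        have ft: "f b = nat \<lfloor>t\<rfloor>" using b False by (simp add: f_def t_def)
        then have "real (f b) = of_int \<lfloor>t\<rfloor>" using t0 by simp
        then have f1: "real (f b) \<le> t" "t \<le> real (f b) + 1" by linarith+
        have xt: "x \<bullet> b = - r + 2 * r * t / m" using r m0 by (simp add: t_def)
        have "2 * r * real (f b) / m \<le> 2 * r * t / m" "2 * r * t / m \<le> 2 * r * (real (f b) + 1) / m"
          using f1 r m0 by (auto intro!: divide_right_mono mult_left_mono)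
        moreover have "f b < m" using f1 tm by linarith
        ultimately show ?thesis using xt by simp
      qed
      have "f \<in> I" using fb by (auto simp: I_def f_def)
      moreover have "x \<in> C f" using x fb by (auto simp: C_def)
      ultimately show "x \<in> (\<Union>f\<in>I. C f)" by blast
    qed
    then have "hausdorff_delta ?d \<delta> ?S \<le> (\<Sum>f\<in>I. hausdorff_gauge ?d (C f))"
    proof (rule hausdorff_delta_finite_cover[OF finI])
      show "diameter (C f) \<le> \<delta>" for f
      proof -
        have "?D * (2 * r / m) \<le> \<delta>" using m m0 \<delta> by (simp add: field_simps)
        then show ?thesis using diC[of f] by linarith
      qed
    qed (use bC \<delta> in auto)
    also have "\<dots> \<le> (\<Sum>f\<in>I. ennreal (unit_ball_vol (real ?d) * (?D * r / m) ^ ?d))"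
    proof (rule sum_mono)
      fix f
      have "diameter (C f) / 2 \<le> ?D * r / m" using diC[of f] by (simp add: field_simps)
      then show "hausdorff_gauge ?d (C f) \<le> ennreal (unit_ball_vol (real ?d) * (?D * r / m) ^ ?d)"
        using diameter_ge_0[OF bC[of f]]
        by (auto simp: hausdorff_gauge_def intro!: ennreal_leI mult_left_mono power_mono)
    qed
    also have "\<dots> = ennreal (real m ^ ?d * (unit_ball_vol (real ?d) * (?D * r / m) ^ ?d))"
      using r by (simp add: cardI ennreal_mult flip: ennreal_power ennreal_of_nat_eq_real_of_nat)
    also have "real m ^ ?d * (unit_ball_vol (real ?d) * (?D * r / m) ^ ?d) = K"
      using m0 by (simp add: K_def power_divide)
    finally show ?thesis .
  qed
  then have "hausdorff_outer_measure ?d ?S \<le> ennreal K"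
    unfolding hausdorff_outer_measure_def by (intro SUP_least) auto
  also have "\<dots> < \<infinity>" by simp
  finally show ?thesis .
qed

text \<open>A cover of the ball by sets of diameter \<open>d\<^sub>i\<close> yields a cover of the cylinder over it by boxes of volume
  \<open>(2 d\<^sub>i) ^ (n - 1)\<close>.\<close>
lemma hausdorff_outer_measure_coordinate_ball_pos:
  fixes e :: "'a::euclidean_space"
  assumes e: "e \<in> Basis"
  shows "0 < hausdorff_outer_measure (DIM('a) - 1) (cball 0 1 \<inter> {x. x \<bullet> e = 0})"
proof (rule ccontr)
  let ?d = "DIM('a) - 1" and ?S = "cball 0 1 \<inter> {x. x \<bullet> e = 0}"
  assume "\<not> 0 < hausdorff_outer_measure ?d ?S"
  then have "hausdorff_delta ?d 1 ?S = 0"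
    using hausdorff_delta_le_outer[of 1 ?d ?S] by simp
  define T where "T = emeasure lborel (cylinder e ?S)"
  define t where "t = enn2real T"
  have "T < \<infinity>" unfolding T_def by (rule emeasure_cylinder_finite) (auto simp: e)
  then have Tt: "T = ennreal t" by (simp add: t_def)
  have "0 < T" unfolding T_def by (rule emeasure_cylinder_ball_pos) (simp_all add: e)
  then have t0: "0 < t" using Tt by simp
  \<comment> \<open>Factor from gauge to box volume:
    \<open>(2 * diameter) ^ d = 4 ^ d * (diameter / 2) ^ d\<close>, divided by the normalising ball
    volume.\<close>
  define K where "K = 4 ^ ?d / unit_ball_vol (real ?d)"
  have ub: "0 < unit_ball_vol (real ?d)" by simp
  then have K0: "0 < K" by (simp add: K_def)
  have "hausdorff_delta ?d 1 ?S < ennreal (t / K)" using \<open>hausdorff_delta ?d 1 ?S = 0\<close> t0 K0 by simp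
  then obtain C :: "nat \<Rightarrow> 'a set" where C: "?S \<subseteq> (\<Union>i. C i)" "\<And>i. bounded (C i)"
    and Cs: "(\<Sum>i. hausdorff_gauge ?d (C i)) < ennreal (t / K)"
    by (rule hausdorff_delta_approx) blast
  define p where "p i = (SOME x. x \<in> C i)" for i
  \<comment> \<open>Centred at a point of \<open>C i\<close> with half-width
    \<open>diameter (C i)\<close>, the box contains every point of the cylinder that projects into
    \<open>C i\<close>; in direction \<open>e\<close> it has the height 1 of the cylinder.\<close>
  define Q where "Q i = (if C i = {} then {} else
     cbox (\<Sum>b\<in>Basis. (if b = e then 0 else p i \<bullet> b - diameter (C i)) *\<^sub>R b)
          (\<Sum>b\<in>Basis. (if b = e then 1 else p i \<bullet> b + diameter (C i)) *\<^sub>R b))" for i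
  have "cylinder e ?S \<subseteq> (\<Union>i. Q i)"
  proof
    fix x assume x: "x \<in> cylinder e ?S"
    then obtain i where i: "proj_perp e x \<in> C i" using C(1) by (auto simp: cylinder_def)
    then have ne: "C i \<noteq> {}" by auto
    have pi: "p i \<in> C i" unfolding p_def by (rule someI[of "\<lambda>x. x \<in> C i", OF i])
    have "p i \<bullet> b - diameter (C i) \<le> x \<bullet> b \<and> x \<bullet> b \<le> p i \<bullet> b + diameter (C i)" if b: "b \<in> Basis" "b \<noteq> e" for b
    proof -
      have "proj_perp e x \<bullet> b = x \<bullet> b"
        using b e by (simp add: proj_perp_def inner_diff_left inner_Basis)
      then have "\<bar>(x \<bullet> b - p i \<bullet> b)\<bar> = \<bar>(proj_perp e x - p i) \<bullet> b\<bar>" by (simp add: inner_diff_left)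
      also have "\<dots> \<le> dist (proj_perp e x) (p i)" using b unfolding dist_norm by (intro Basis_le_norm)
      also have "\<dots> \<le> diameter (C i)" using C(2) i pi by (rule diameter_bounded_bound)
      finally show ?thesis by linarith
    qed
    then have "x \<in> Q i" using x ne by (auto simp: Q_def mem_box cylinder_def)
    then show "x \<in> (\<Union>i. Q i)" by blast
  qed
  moreover have Qs: "Q i \<in> sets lborel" for i by (simp add: Q_def)
  ultimately have "T \<le> (\<Sum>i. emeasure lborel (Q i))"
    unfolding T_def by (intro order_trans[OF emeasure_mono emeasure_subadditive_countably]) auto
  also have "\<dots> \<le> (\<Sum>i. ennreal K * hausdorff_gauge ?d (C i))"
  proof (intro suminf_le summableI)
    fix i
    show "emeasure lborel (Q i) \<le> ennreal K * hausdorff_gauge ?d (C i)"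
    proof (cases "C i = {}")
      case False
      have d0: "0 \<le> diameter (C i)" using C(2) by (rule diameter_ge_0)
      have "emeasure lborel (Q i) = ennreal (\<Prod>b\<in>Basis. if b = e then 1 else 2 * diameter (C i))"
        using False d0 by (auto simp: Q_def emeasure_lborel_cbox_eq inner_diff_left
            intro!: arg_cong[where f=ennreal] prod.cong split: if_splits)
      also have "(\<Prod>b\<in>Basis. if b = e then 1 else 2 * diameter (C i)) = (2 * diameter (C i)) ^ ?d"
        using e by (simp add: prod.remove[of _ e] card_Diff_singleton)
      also have "(2 * diameter (C i)) ^ ?d = K * (unit_ball_vol (real ?d) * (diameter (C i) / 2) ^ ?d)"
      proof -
        have "2 * diameter (C i) = 4 * (diameter (C i) / 2)" by simp
        then have "(2 * diameter (C i)) ^ ?d = 4 ^ ?d * (diameter (C i) / 2) ^ ?d"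
          by (metis power_mult_distrib)
        moreover have "K * unit_ball_vol (real ?d) = 4 ^ ?d"
          by (metis K_def ub less_irrefl nonzero_eq_divide_eq)
        ultimately show ?thesis by (metis mult.assoc)
      qed
      also have "ennreal \<dots> = ennreal K * hausdorff_gauge ?d (C i)"
        using False K0 d0 by (simp add: hausdorff_gauge_def ennreal_mult)
      finally show ?thesis by simp
    qed (simp add: Q_def)
  qed
  also have "\<dots> = ennreal K * (\<Sum>i. hausdorff_gauge ?d (C i))" by simp
  also have "\<dots> < ennreal K * ennreal (t / K)"
    using Cs K0 by (intro ennreal_mult_strict_left_mono) auto
  also have "\<dots> = ennreal t" using K0 t0 by (simp flip: ennreal_mult)
  finally show False using Tt by simp
qed
text \<open>Rotating \<open>u\<close> to a coordinate vector reduces this to the coordinate cube;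
  isometries preserve the outer measure.\<close>

lemma hausdorff_outer_measure_hyperplane_ball_finite:
  fixes u :: "real ^ 'n"
  assumes u: "norm u = 1"
  shows "hausdorff_outer_measure (CARD('n) - 1) (cball 0 r \<inter> {x. x \<bullet> u = 0}) < \<infinity>"
proof -
  obtain e :: "real ^ 'n" where e: "e \<in> Basis" using nonempty_Basis by blast
  obtain f where f: "orthogonal_transformation f" "f u = e"
    using orthogonal_transformation_exists[of u e] u e by auto
  have iso: "dist (f x) (f y) = dist x y" for x y
    using f(1) by (simp add: dist_norm orthogonal_transformation_norm orthogonal_transformation_linear flip: linear_diff)
  have "f ` (cball 0 r \<inter> {x. x \<bullet> u = 0}) \<subseteq> {x. x \<bullet> e = 0 \<and> (\<forall>b\<in>Basis. \<bar>x \<bullet> b\<bar> \<le> max r 1)}"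
  proof safe
    fix x assume x: "x \<in> cball 0 r" "x \<bullet> u = 0"
    show "f x \<bullet> e = 0" using f x by (metis orthogonal_transformation_def)
    fix b :: "real ^ 'n" assume "b \<in> Basis"
    then have "\<bar>f x \<bullet> b\<bar> \<le> norm (f x)" by (rule Basis_le_norm)
    then show "\<bar>f x \<bullet> b\<bar> \<le> max r 1" using x f(1) by (simp add: orthogonal_transformation_norm)
  qed
  then have "hausdorff_outer_measure (CARD('n) - 1) (f ` (cball 0 r \<inter> {x. x \<bullet> u = 0}))
      \<le> hausdorff_outer_measure (CARD('n) - 1) {x. x \<bullet> e = 0 \<and> (\<forall>b\<in>Basis. \<bar>x \<bullet> b\<bar> \<le> max r 1)}"
    by (rule hausdorff_outer_measure_mono)
  also have "\<dots> < \<infinity>"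
    using hausdorff_outer_measure_coordinate_cube_finite[OF e, of "max r 1"] by simp
  finally show ?thesis by (simp add: hausdorff_outer_measure_isometric_image[OF iso])
qed

lemma hausdorff_outer_measure_hyperplane_ball_pos:
  fixes u :: "real ^ 'n"
  assumes u: "norm u = 1"
  shows "0 < hausdorff_outer_measure (CARD('n) - 1) (cball 0 1 \<inter> {x. x \<bullet> u = 0})"
proof -
  obtain e :: "real ^ 'n" where e: "e \<in> Basis" using nonempty_Basis by blast
  obtain f where f: "orthogonal_transformation f" "f e = u"
    using orthogonal_transformation_exists[of e u] u e by auto
  have iso: "dist (f x) (f y) = dist x y" for x y
    using f(1) by (simp add: dist_norm orthogonal_transformation_norm orthogonal_transformation_linear flip: linear_diff)
  have "f ` (cball 0 1 \<inter> {x. x \<bullet> e = 0}) \<subseteq> cball 0 1 \<inter> {x. x \<bullet> u = 0}"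
    using f by (auto simp: orthogonal_transformation_norm) (metis orthogonal_transformation_def)
  from hausdorff_outer_measure_mono[OF this, of "CARD('n) - 1"]
  show ?thesis using hausdorff_outer_measure_coordinate_ball_pos[OF e]
    by (simp add: hausdorff_outer_measure_isometric_image[OF iso])
qed

lemma sigma_finite_measureI_balls:
  fixes M :: "'a::euclidean_space measure"
  assumes [simp]: "sets M = sets borel" and fin: "\<And>k :: nat. emeasure M (cball 0 (real k)) \<noteq> \<infinity>"
  shows "sigma_finite_measure M"
proof
  have "(\<Union>k. cball (0 :: 'a) (real k)) = UNIV" using real_arch_simple by auto
  then show "\<exists>A. countable A \<and> A \<subseteq> sets M \<and> \<Union>A = space M \<and> (\<forall>a\<in>A. emeasure M a \<noteq> \<infinity>)"
    using fin sets_eq_imp_space_eq[OF assms(1)] by (intro exI[of _ "range (\<lambda>k. cball 0 (real k))"]) auto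
qed

lemma borel_hyperplane [measurable]: "{x :: 'a::euclidean_space. x \<bullet> u = a} \<in> sets borel"
  using borel_closed[OF closed_hyperplane[of u a]] by (simp add: inner_commute)

text \<open>Hausdorff measure and prism volume are both concentrated on the hyperplane, invariant
  under its translations, and finite and positive on the unit ball, so uniqueness makes them
  proportional.\<close>

lemma hausdorff_measure_hyperplane:
  fixes u :: "real ^ 'n"
  assumes u: "norm u = 1"
  obtains c :: real where "0 < c"
    "\<And>A. A \<in> sets borel \<Longrightarrow> A \<subseteq> {x. x \<bullet> u = 0} \<Longrightarrow>
       emeasure (hausdorff_measure (CARD('n) - 1)) A = ennreal c * emeasure lborel (cylinder u A)"
proof -
  let ?H = "hausdorff_measure (CARD('n) - 1) :: (real ^ 'n) measure"
  let ?W = "{x. x \<bullet> u = 0}" and ?slab = "{x. 0 \<le> x \<bullet> u \<and> x \<bullet> u \<le> 1}"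
  \<comment> \<open>Restricting to the hyperplane makes Hausdorff measure sigma-finite; writing
    prism volume as a push-forward under the projection makes it a measure.\<close>
  define M where "M = density ?H (indicator ?W)"
  define N where "N = distr (density lborel (indicator ?slab)) borel (proj_perp u)"
  have [simp, measurable_cong]: "sets M = sets borel" "sets N = sets borel" by (auto simp: M_def N_def)
  have W [simp]: "?W \<in> sets borel" and slab: "?slab \<in> sets borel" by measurable
  have eM: "emeasure M A = hausdorff_outer_measure (CARD('n) - 1) (A \<inter> ?W)" if "A \<in> sets borel" for A
  proof -
    have "emeasure M A = (\<integral>\<^sup>+x. indicator ?W x * indicator A x \<partial>?H)"
      using that unfolding M_def by (intro emeasure_density) (auto intro: borel_measurable_indicator)
    also have "\<dots> = (\<integral>\<^sup>+x. indicator (A \<inter> ?W) x \<partial>?H)"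
      by (simp only: indicator_inter_arith[symmetric] Int_commute)
    also have "\<dots> = emeasure ?H (A \<inter> ?W)" using that by (intro nn_integral_indicator) auto
    finally show ?thesis using that by (simp add: emeasure_hausdorff_measure)
  qed
  have eN: "emeasure N A = emeasure lborel (cylinder u A)" if A: "A \<in> sets borel" for A
  proof -
    have pA: "proj_perp u -` A \<in> sets borel"
      using measurable_sets_borel[OF borel_measurable_proj_perp A] .
    have "emeasure N A = emeasure (density lborel (indicator ?slab)) (proj_perp u -` A)"
      using A unfolding N_def by (subst emeasure_distr) auto
    also have "\<dots> = (\<integral>\<^sup>+x. indicator ?slab x * indicator (proj_perp u -` A) x \<partial>lborel)"
      using pA slab by (intro emeasure_density) (auto intro: borel_measurable_indicator)
    also have "\<dots> = (\<integral>\<^sup>+x. indicator (?slab \<inter> proj_perp u -` A) x \<partial>lborel)"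
      by (simp only: indicator_inter_arith[symmetric])
    also have "?slab \<inter> proj_perp u -` A = cylinder u A" by (auto simp: cylinder_def)
    also have "(\<integral>\<^sup>+x. indicator (cylinder u A) x \<partial>lborel) = emeasure lborel (cylinder u A)"
      using A by (intro nn_integral_indicator) auto
    finally show ?thesis .
  qed
  define B where "B = (cball 0 1 :: (real ^ 'n) set)"
  have ratio: "emeasure M A * emeasure N B = emeasure M B * emeasure N A" if A: "A \<in> sets borel" for A
  proof (rule translation_invariant_measures_proportional[where W = ?W])
    show "sigma_finite_measure M"
    proof (rule sigma_finite_measureI_balls)
      show "emeasure M (cball 0 (real k)) \<noteq> \<infinity>" for k
        using hausdorff_outer_measure_hyperplane_ball_finite[OF u, of "real k"] by (subst eM) auto
    qed simp
    show "sigma_finite_measure N"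
    proof (rule sigma_finite_measureI_balls)
      show "emeasure N (cball 0 (real k)) \<noteq> \<infinity>" for k
        using emeasure_cylinder_finite[OF u bounded_cball, of 0 "real k"] by (subst eN) auto
    qed simp
    show "subspace ?W" by (auto simp: subspace_def inner_left_distrib)
    have cW: "- ?W \<in> sets borel" by simp
    show "AE x in M. x \<in> ?W"
      using eM[OF cW] by (intro AE_I[where N = "- ?W"]) (auto simp: hausdorff_outer_measure_empty)
    have "cylinder u (- ?W) = {}" using u by (auto simp: cylinder_def)
    then show "AE x in N. x \<in> ?W"
      using eN[OF cW] by (intro AE_I[where N = "- ?W"]) auto
    fix w C assume w: "w \<in> ?W" and C: "C \<in> sets (borel :: (real ^ 'n) measure)"
    have shift: "{x. x + w \<in> C} \<in> sets borel" using C by measurable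
    have "{x. x + w \<in> C} \<inter> ?W = (\<lambda>x. x - w) ` (C \<inter> ?W)"
      using w by (auto simp: image_iff inner_diff_left inner_left_distrib
          intro!: bexI[of _ "_ + w"] exI[of _ "_ + w"])
    then show "emeasure M {x. x + w \<in> C} = emeasure M C"
      using C shift by (simp add: eM hausdorff_outer_measure_isometric_image dist_norm)
    have "cylinder u {x. x + w \<in> C} = {x. x + w \<in> cylinder u C}"
      using w by (auto simp: cylinder_def inner_left_distrib proj_perp_add proj_perp_id)
    then show "emeasure N {x. x + w \<in> C} = emeasure N C"
      using C shift by (simp add: eN emeasure_lborel_translate borel_cylinder)
  qed (use A in \<open>auto simp: B_def\<close>)
  have MB: "0 < emeasure M B" "emeasure M B < \<infinity>"
    using hausdorff_outer_measure_hyperplane_ball_pos[OF u] hausdorff_outer_measure_hyperplane_ball_finite[OF u]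
    by (auto simp: eM B_def)
  have "cylinder u (cball 0 1 \<inter> ?W) \<subseteq> cylinder u B" by (auto simp: cylinder_def B_def)
  then have "emeasure lborel (cylinder u (cball 0 1 \<inter> ?W)) \<le> emeasure N B"
    by (auto simp: eN B_def intro!: emeasure_mono)
  then have NB: "0 < emeasure N B" "emeasure N B < \<infinity>"
    using emeasure_cylinder_ball_pos[OF u, of 1] emeasure_cylinder_finite[OF u, of B]
    by (auto simp: eN B_def intro: less_le_trans)
  define a b where "a = enn2real (emeasure M B)" and "b = enn2real (emeasure N B)"
  have ab: "emeasure M B = ennreal a" "emeasure N B = ennreal b" "0 < a" "0 < b"
    using MB NB unfolding a_def b_def by (simp_all add: enn2real_positive_iff less_top)
  show ?thesis
  proof (rule that[of "a / b"])
    fix A assume A: "A \<in> sets (borel :: (real ^ 'n) measure)" "A \<subseteq> ?W"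
    have "emeasure ?H A = emeasure M A"
      using A by (simp add: eM emeasure_hausdorff_measure Int_absorb2)
    also have "\<dots> = (emeasure M A * ennreal b) / ennreal b"
      using ab by (simp add: ennreal_mult_divide_eq)
    also have "emeasure M A * ennreal b = ennreal a * emeasure N A"
      using ratio[OF A(1)] ab by simp
    also have "ennreal a * emeasure N A / ennreal b = ennreal (a / b) * emeasure N A"
      using ab by (simp add: ennreal_divide_times ennreal_times_divide flip: divide_ennreal)
    finally show "emeasure ?H A = ennreal (a / b) * emeasure lborel (cylinder u A)"
      using A by (simp add: eN)
  qed (use ab in simp)
qed
text \<open>A translation along \<open>u\<close> moves the affine hyperplane to the linear one, so
  the same \<open>c\<close> serves all offsets \<open>a\<close>.\<close>

lemma hausdorff_measure_affine_hyperplane: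
  fixes u :: "real ^ 'n"
  assumes u: "norm u = 1"
  obtains c :: real where "0 < c"
    "\<And>A a. A \<in> sets borel \<Longrightarrow> A \<subseteq> {x. x \<bullet> u = a} \<Longrightarrow>
       emeasure (hausdorff_measure (CARD('n) - 1)) A
         = ennreal c * emeasure lborel (cylinder u {y. y + a *\<^sub>R u \<in> A})"
proof -
  let ?H = "hausdorff_measure (CARD('n) - 1) :: (real ^ 'n) measure"
  obtain c where c: "0 < c" "\<And>A. A \<in> sets borel \<Longrightarrow> A \<subseteq> {x. x \<bullet> u = 0} \<Longrightarrow>
       emeasure ?H A = ennreal c * emeasure lborel (cylinder u A)"
    using hausdorff_measure_hyperplane[OF u] by blast
  show ?thesis
  proof (rule that[OF c(1)])
    fix F :: "(real ^ 'n) set" and a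
    assume F: "F \<in> sets borel" "F \<subseteq> {x. x \<bullet> u = a}"
    let ?A = "{y. y + a *\<^sub>R u \<in> F}"
    have A: "?A \<in> sets borel" using F(1) by measurable
    have sub: "?A \<subseteq> {x. x \<bullet> u = 0}"
      using u F(2) by (auto simp: inner_left_distrib dot_square_norm)
    have img: "(\<lambda>y. y + a *\<^sub>R u) ` ?A = F"
      by (auto simp: image_iff intro!: exI[of _ "_ - a *\<^sub>R u"])
    have "emeasure ?H F = hausdorff_outer_measure (CARD('n) - 1) ((\<lambda>y. y + a *\<^sub>R u) ` ?A)"
      using F by (simp add: img emeasure_hausdorff_measure)
    also have "\<dots> = hausdorff_outer_measure (CARD('n) - 1) ?A"
      by (rule hausdorff_outer_measure_isometric_image) (simp add: dist_norm)
    also have "\<dots> = ennreal c * emeasure lborel (cylinder u ?A)"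
      using c(2)[OF A sub] A by (simp add: emeasure_hausdorff_measure)
    finally show "emeasure ?H F = ennreal c * emeasure lborel (cylinder u ?A)" .
  qed
qed

section \<open>Facets, surface area measure and volume of halfspace intersections\<close>

text \<open>The Wulff shape (Aleksandrov body) of \<open>h\<close>. The value \<open>h u\<close> may
  exceed the support function, so \<open>u\<close> need not be the normal of a facet.\<close>

definition wulff :: "'a::euclidean_space set \<Rightarrow> ('a \<Rightarrow> real) \<Rightarrow> 'a set" where
  "wulff U h = {x. \<forall>u\<in>U. x \<bullet> u \<le> h u}"

text \<open>The other constraints are strict so that, for \<open>u\<close> in a finite set
  \<open>U\<close> of unit vectors, these are exactly the boundary points whose only outer unit
  normal is \<open>u\<close>.\<close>

definition open_facet :: "'a::euclidean_space set \<Rightarrow> ('a \<Rightarrow> real) \<Rightarrow> 'a \<Rightarrow> 'a set" where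
  "open_facet U h u = {x. x \<bullet> u = h u \<and> (\<forall>v\<in>U - {u}. x \<bullet> v < h v)}"

text \<open>Unit prism over the closed facet, moved to the hyperplane through the origin; for a unit
  vector \<open>u\<close> its volume is the facet area up to a factor depending on \<open>u\<close>
  alone.\<close>

definition facet_cylinder :: "'a::euclidean_space set \<Rightarrow> ('a \<Rightarrow> real) \<Rightarrow> 'a \<Rightarrow> 'a set" where
  "facet_cylinder U h u =
     {y. 0 \<le> y \<bullet> u \<and> y \<bullet> u \<le> 1 \<and> proj_perp u y + h u *\<^sub>R u \<in> wulff U h}"

lemma wulff_Inter: "wulff U h = (\<Inter>u\<in>U. {x. u \<bullet> x \<le> h u})"
  by (auto simp: wulff_def inner_commute)

lemma closed_wulff: "closed (wulff U h)"
  unfolding wulff_Inter by (intro closed_INT ballI closed_halfspace_le)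

lemma convex_wulff: "convex (wulff U h)"
  unfolding wulff_Inter by (intro convex_INT convex_halfspace_le)

lemma borel_wulff [measurable]: "wulff U h \<in> sets borel"
  using closed_wulff by (rule borel_closed)

lemma polyhedron_wulff: "finite U \<Longrightarrow> polyhedron (wulff U h)"
  unfolding wulff_Inter by (intro polyhedron_Inter) (auto simp: polyhedron_halfspace_le)

lemma interior_wulff:
  assumes "finite U" "0 \<notin> U"
  shows "interior (wulff U h) = {x. \<forall>u\<in>U. x \<bullet> u < h u}"
proof
  have "open (\<Inter>u\<in>U. {x. u \<bullet> x < h u})"
    using \<open>finite U\<close> by (intro open_INT ballI open_halfspace_lt)
  moreover have "(\<Inter>u\<in>U. {x. u \<bullet> x < h u}) \<subseteq> wulff U h"
    by (auto simp: wulff_Inter intro: less_imp_le)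
  moreover have "{x. \<forall>u\<in>U. x \<bullet> u < h u} = (\<Inter>u\<in>U. {x. u \<bullet> x < h u})"
    by (auto simp: inner_commute)
  ultimately show "{x. \<forall>u\<in>U. x \<bullet> u < h u} \<subseteq> interior (wulff U h)"
    by (simp only: interior_maximal)
  show "interior (wulff U h) \<subseteq> {x. \<forall>u\<in>U. x \<bullet> u < h u}"
  proof (rule subsetI, rule CollectI, rule ballI)
    fix x u assume x: "x \<in> interior (wulff U h)" "u \<in> U"
    then have "interior (wulff U h) \<subseteq> interior {x. u \<bullet> x \<le> h u}"
      by (intro interior_mono) (auto simp: wulff_Inter)
    moreover have "interior {x. u \<bullet> x \<le> h u} = {x. u \<bullet> x < h u}"
      using x assms by (intro interior_halfspace_le) auto
    ultimately show "x \<bullet> u < h u" using x by (auto simp: inner_commute[of x u])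
  qed
qed

section \<open>Outer normals and the regular part of the boundary\<close>

lemma small_step:
  fixes a b :: "'i \<Rightarrow> real"
  assumes "finite V" "\<And>v. v \<in> V \<Longrightarrow> 0 < a v"
  obtains t where "0 < t" "t < 1" "\<And>v. v \<in> V \<Longrightarrow> t * b v < a v"
proof -
  have "\<forall>\<^sub>F t in at_right (0 :: real). t * b v < a v" if "v \<in> V" for v
  proof (rule order_tendstoD(2))
    show "((\<lambda>t. t * b v) \<longlongrightarrow> 0 * b v) (at_right 0)" by (intro tendsto_intros)
  qed (use assms(2) that in simp)
  then have "\<forall>\<^sub>F t in at_right (0 :: real). \<forall>v\<in>V. t * b v < a v"
    using \<open>finite V\<close> by (simp add: eventually_ball_finite)
  moreover have "\<forall>\<^sub>F t in at_right (0 :: real). t \<in> {0<..<1}"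
    by (rule eventually_at_right_real) simp
  ultimately have "\<forall>\<^sub>F t in at_right (0 :: real). (\<forall>v\<in>V. t * b v < a v) \<and> t \<in> {0<..<1}"
    by (rule eventually_conj)
  from eventually_happens[OF this] show ?thesis using that by (auto simp: trivial_limit_at_right_real)
qed

lemma inner_less_1:
  assumes "norm u = 1" "norm v = 1" "u \<noteq> v"
  shows "u \<bullet> v < 1"
  using assms norm_cauchy_schwarz[of u v] norm_cauchy_schwarz_eq[of u v] by force

text \<open>Against a second normal \<open>z\<close>, move from \<open>x\<close> by a small multiple
  of \<open>z - u\<close>. As \<open>z \<bullet> u < 1\<close>, this respects the constraint of
  \<open>u\<close>, the slack ones survive a small step, and the product with \<open>z\<close>
  increases, a contradiction.\<close>

lemma outer_unit_normals_open_facet: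
  assumes U: "finite U" "U \<subseteq> sphere 0 1" and u: "u \<in> U" and x: "x \<in> open_facet U h u"
  shows "outer_unit_normals (wulff U h) x = {u}"
proof (rule antisym)
  show "{u} \<subseteq> outer_unit_normals (wulff U h) x"
    using assms by (auto simp: outer_unit_normals_def open_facet_def wulff_def)
  show "outer_unit_normals (wulff U h) x \<subseteq> {u}"
  proof
    fix z assume z: "z \<in> outer_unit_normals (wulff U h) x"
    then have nz: "norm z = 1" by (simp add: outer_unit_normals_def)
    have nu: "norm u = 1" using U u by auto
    show "z \<in> {u}"
    proof (rule ccontr)
      assume "z \<notin> {u}"
      then have zu: "z \<bullet> u < 1" using inner_less_1[OF nz nu] by simp
      have "finite (U - {u})" "\<And>v. v \<in> U - {u} \<Longrightarrow> 0 < h v - x \<bullet> v"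
        using U x by (auto simp: open_facet_def)
      then obtain t where t: "0 < t" "\<And>v. v \<in> U - {u} \<Longrightarrow> t * ((z - u) \<bullet> v) < h v - x \<bullet> v"
        using small_step[of "U - {u}" "\<lambda>v. h v - x \<bullet> v" "\<lambda>v. (z - u) \<bullet> v"] by metis
      let ?y = "x + t *\<^sub>R (z - u)"
      have "?y \<bullet> u \<le> h u"
        using x t(1) zu nu by (simp add: open_facet_def inner_left_distrib inner_diff_left dot_square_norm mult_nonneg_nonpos)
      moreover have "?y \<bullet> v \<le> h v" if "v \<in> U - {u}" for v
        using t(2)[OF that] by (simp add: inner_left_distrib)
      ultimately have "?y \<in> wulff U h" by (auto simp: wulff_def)
      then have "?y \<bullet> z \<le> x \<bullet> z" using z by (simp add: outer_unit_normals_def)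
      then have "t * (1 - u \<bullet> z) \<le> 0" using nz by (simp add: inner_left_distrib inner_diff_left dot_square_norm)
      then show False using t(1) zu by (simp add: mult_le_0_iff inner_commute)
    qed
  qed
qed

text \<open>Each tight constraint supplies an outer normal, so a unique normal means exactly one
  tight constraint.\<close>

lemma regular_frontier_wulff:
  assumes U: "finite U" "U \<subseteq> sphere 0 1"
  shows "regular_frontier (wulff U h) = (\<Union>u\<in>U. open_facet U h u)"
proof (rule antisym)
  have U0: "0 \<notin> U" using U by auto
  show "(\<Union>u\<in>U. open_facet U h u) \<subseteq> regular_frontier (wulff U h)"
  proof
    fix x assume "x \<in> (\<Union>u\<in>U. open_facet U h u)"
    then obtain u where u: "u \<in> U" "x \<in> open_facet U h u" by blast
    then have "x \<bullet> v \<le> h v" if "v \<in> U" for v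
      using that by (cases "v = u") (auto simp: open_facet_def intro: less_imp_le)
    then have "x \<in> wulff U h" by (simp add: wulff_def)
    moreover have "x \<notin> interior (wulff U h)"
      using u by (auto simp: interior_wulff[OF U(1) U0] open_facet_def intro!: bexI[of _ u])
    ultimately have "x \<in> frontier (wulff U h)" using closed_wulff[of U h] by (simp add: frontier_def)
    then show "x \<in> regular_frontier (wulff U h)"
      using outer_unit_normals_open_facet[OF U u] by (simp add: regular_frontier_def)
  qed
  show "regular_frontier (wulff U h) \<subseteq> (\<Union>u\<in>U. open_facet U h u)"
  proof
    fix x assume "x \<in> regular_frontier (wulff U h)"
    then have fr: "x \<in> frontier (wulff U h)" and un: "\<exists>!u. u \<in> outer_unit_normals (wulff U h) x"
      by (auto simp: regular_frontier_def)
    from fr have x: "x \<in> wulff U h" "x \<notin> interior (wulff U h)"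
      using closed_wulff[of U h] by (auto simp: frontier_def)
    then have "\<not> (\<forall>u\<in>U. x \<bullet> u < h u)" using interior_wulff[OF U(1) U0, of h] by simp
    then obtain u where u: "u \<in> U" "x \<bullet> u = h u"
      using x(1) by (force simp: wulff_def)
    have normal: "v \<in> outer_unit_normals (wulff U h) x" if "v \<in> U" "x \<bullet> v = h v" for v
      using that U by (auto simp: outer_unit_normals_def wulff_def)
    have "x \<bullet> v < h v" if v: "v \<in> U - {u}" for v
    proof -
      have "x \<bullet> v \<noteq> h v" using normal[of v] normal[of u] v u un by blast
      then show ?thesis using x(1) v by (simp add: wulff_def less_le)
    qed
    then have "x \<in> open_facet U h u" using u by (simp add: open_facet_def)
    then show "x \<in> (\<Union>u\<in>U. open_facet U h u)" using u by blast
  qed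
qed

lemma gauss_map_open_facet:
  assumes "finite U" "U \<subseteq> sphere 0 1" "u \<in> U" "x \<in> open_facet U h u"
  shows "gauss_map (wulff U h) x = u"
  unfolding gauss_map_def outer_unit_normals_open_facet[OF assms] by simp

lemma borel_open_facet [measurable]:
  assumes "finite U" shows "open_facet U h u \<in> sets borel"
proof -
  have "open_facet U h u = {x. u \<bullet> x = h u} \<inter> (\<Inter>v\<in>U - {u}. {x. v \<bullet> x < h v})"
    by (auto simp: open_facet_def inner_commute)
  moreover have "open (\<Inter>v\<in>U - {u}. {x. v \<bullet> x < h v})"
    using assms by (intro open_INT ballI open_halfspace_lt) auto
  ultimately show ?thesis using closed_hyperplane[of u "h u"] by auto
qed

lemma space_sphere_borel: "space sphere_borel = sphere 0 1"
  by (simp add: sphere_borel_def space_restrict_space)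

text \<open>The regular boundary splits into the disjoint open facets, and the integrand has the
  constant value \<open>h u powr (1 - p)\<close> on each. Vectors of \<open>U\<close> with a null
  facet are allowed and get weight 0.\<close>

lemma Lp_surface_area_measure_wulff_facets:
  fixes U :: "'a::euclidean_space set"
  assumes U: "finite U" "U \<subseteq> sphere 0 1"
    and fin: "\<And>u. u \<in> U \<Longrightarrow> emeasure (hausdorff_measure (DIM('a) - 1)) (open_facet U h u) = ennreal (a u)"
  shows "Lp_surface_area_measure p (wulff U h) = discrete_measure U (\<lambda>u. h u powr (1 - p) * a u)"
  unfolding Lp_surface_area_measure_def discrete_measure_def
proof (rule measure_of_eq)
  show "sets (sphere_borel :: 'a measure) \<subseteq> Pow (sphere 0 1)"
    using sets.space_closed[of "sphere_borel :: 'a measure"] by (simp add: space_sphere_borel)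
  fix \<omega> :: "'a set"
  let ?H = "hausdorff_measure (DIM('a) - 1) :: 'a measure"
  have "(\<integral>\<^sup>+x\<in>{x \<in> regular_frontier (wulff U h). gauss_map (wulff U h) x \<in> \<omega>}.
          ennreal ((x \<bullet> gauss_map (wulff U h) x) powr (1 - p)) \<partial>?H)
     = (\<integral>\<^sup>+x. (\<Sum>u\<in>U. (ennreal (h u powr (1 - p)) * indicator \<omega> u) * indicator (open_facet U h u) x) \<partial>?H)"
  proof (rule nn_integral_cong)
    fix x
    let ?l = "ennreal ((x \<bullet> gauss_map (wulff U h) x) powr (1 - p)) *
          indicator {x \<in> regular_frontier (wulff U h). gauss_map (wulff U h) x \<in> \<omega>} x"
    let ?r = "\<Sum>u\<in>U. (ennreal (h u powr (1 - p)) * indicator \<omega> u) * indicator (open_facet U h u) x"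
    show "?l = ?r"
    proof (cases "x \<in> regular_frontier (wulff U h)")
      case True
      then obtain u where u: "u \<in> U" "x \<in> open_facet U h u" using regular_frontier_wulff[OF U] by blast
      have "x \<notin> open_facet U h v" if "v \<in> U - {u}" for v
      proof -
        have "x \<bullet> v < h v" using u that by (simp add: open_facet_def)
        then show ?thesis by (simp add: open_facet_def)
      qed
      then have "?r = (ennreal (h u powr (1 - p)) * indicator \<omega> u) * indicator (open_facet U h u) x"
        using U(1) u(1) by (subst sum.remove[of _ u]) auto
      moreover have "x \<bullet> u = h u" using u by (simp add: open_facet_def)
      ultimately show ?thesis using True u by (simp add: gauss_map_open_facet[OF U u] indicator_def)
    next
      case False
      then have "x \<notin> open_facet U h u" if "u \<in> U" for u using that regular_frontier_wulff[OF U] by blast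
      then show ?thesis using False by simp
    qed
  qed
  also have "\<dots> = (\<Sum>u\<in>U. \<integral>\<^sup>+x. (ennreal (h u powr (1 - p)) * indicator \<omega> u) * indicator (open_facet U h u) x \<partial>?H)"
    using borel_open_facet[OF U(1)] by (intro nn_integral_sum) auto
  also have "\<dots> = (\<Sum>u\<in>U. ennreal (h u powr (1 - p) * a u) * indicator \<omega> u)"
  proof (rule sum.cong)
    fix u assume u: "u \<in> U"
    have "(\<integral>\<^sup>+x. (ennreal (h u powr (1 - p)) * indicator \<omega> u) * indicator (open_facet U h u) x \<partial>?H)
        = ennreal (h u powr (1 - p)) * indicator \<omega> u * ennreal (a u)"
      using borel_open_facet[OF U(1)] fin[OF u] by (subst nn_integral_cmult_indicator) auto
    moreover have "ennreal (h u powr (1 - p) * a u) = ennreal (h u powr (1 - p)) * ennreal (a u)"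
      by (rule ennreal_mult') simp
    ultimately show "(\<integral>\<^sup>+x. (ennreal (h u powr (1 - p)) * indicator \<omega> u) * indicator (open_facet U h u) x \<partial>?H)
        = ennreal (h u powr (1 - p) * a u) * indicator \<omega> u"
      by (simp only: mult_ac)
  qed simp
  finally show "(\<integral>\<^sup>+x\<in>{x \<in> regular_frontier (wulff U h). gauss_map (wulff U h) x \<in> \<omega>}.
          ennreal ((x \<bullet> gauss_map (wulff U h) x) powr (1 - p)) \<partial>?H)
     = (\<Sum>u\<in>U. ennreal (h u powr (1 - p) * a u) * indicator \<omega> u)" .
qed

text \<open>Equality would put \<open>y\<close> on a hyperplane, a null set, except for
  \<open>v = - u\<close>, where the left side is constantly \<open>- a\<close> and
  \<open>opp\<close> decides. This lets closed and relatively open facets be exchanged and gives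
  convergence almost everywhere in the volume derivative.\<close>

lemma AE_proj_perp_not_tight:
  fixes u v :: "'a::euclidean_space"
  assumes nu: "norm u = 1" "norm v = 1" and uv: "u \<noteq> v" and opp: "v = - u \<Longrightarrow> a + b \<noteq> 0"
  shows "AE y in lborel. (proj_perp u y + a *\<^sub>R u) \<bullet> v \<noteq> b"
proof -
  have eq: "(proj_perp u y + a *\<^sub>R u) \<bullet> v = proj_perp u v \<bullet> y + a * (u \<bullet> v)" for y
    by (simp add: proj_perp_def inner_left_distrib inner_diff_left inner_diff_right inner_commute algebra_simps)
  show ?thesis
  proof (cases "proj_perp u v = 0")
    case True
    then have v: "v = (v \<bullet> u) *\<^sub>R u" by (simp add: proj_perp_def)
    then have "\<bar>v \<bullet> u\<bar> = 1" using nu by (metis mult_cancel_left1 norm_scaleR mult.right_neutral)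
    then have "v = - u" using v uv by (auto simp: abs_if split: if_splits)
    then have "(proj_perp u y + a *\<^sub>R u) \<bullet> v = - a" for y
      using nu by (simp add: inner_left_distrib dot_square_norm)
    then show ?thesis using opp[OF \<open>v = - u\<close>] by auto
  next
    case False
    let ?N = "{y. proj_perp u v \<bullet> y = b - a * (u \<bullet> v)}"
    have "negligible ?N" using False by (intro negligible_hyperplane) auto
    then have "?N \<in> null_sets lborel"
      by (metis borel_closed closed_hyperplane negligible_iff_null_sets null_sets_completion_iff sets_lborel)
    then have "AE y in lborel. y \<notin> ?N" by (rule AE_not_in)
    then show ?thesis by eventually_elim (auto simp: eq)
  qed
qed

lemma borel_facet_cylinder [measurable]: "facet_cylinder U h u \<in> sets borel"
proof -
  have "closed {y. 0 \<le> u \<bullet> y} \<and> closed {y. u \<bullet> y \<le> 1}" using closed_halfspace_ge closed_halfspace_le by blast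
  moreover have "closed ((\<lambda>y. proj_perp u y + h u *\<^sub>R u) -` wulff U h)"
    by (intro closed_vimage closed_wulff continuous_intros)
  moreover have "facet_cylinder U h u
      = {y. 0 \<le> u \<bullet> y} \<inter> {y. u \<bullet> y \<le> 1} \<inter> ((\<lambda>y. proj_perp u y + h u *\<^sub>R u) -` wulff U h)"
    by (auto simp: facet_cylinder_def inner_commute)
  ultimately show ?thesis by auto
qed

lemma facet_cylinder_finite:
  assumes "norm u = 1" "bounded (wulff U h)"
  shows "emeasure lborel (facet_cylinder U h u) < \<infinity>"
proof -
  have "facet_cylinder U h u = cylinder u ((\<lambda>x. - (h u *\<^sub>R u) + x) ` wulff U h)"
    by (auto simp: facet_cylinder_def cylinder_def image_iff algebra_simps
        intro!: bexI[of _ "proj_perp u _ + h u *\<^sub>R u"])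
  then show ?thesis using assms emeasure_cylinder_finite bounded_translation by metis
qed

text \<open>\<open>c\<close> is obtained before \<open>U\<close> and \<open>h\<close>, as it must be
  known when the weights are prescribed. The strict point \<open>x0\<close> rules out opposite
  constraints that squeeze the body into a hyperplane.\<close>

lemma hausdorff_measure_open_facet:
  fixes u :: "real ^ 'n"
  assumes u: "norm u = 1"
  obtains c :: real where "0 < c"
    "\<And>U h x0. finite U \<Longrightarrow> U \<subseteq> sphere 0 1 \<Longrightarrow> u \<in> U \<Longrightarrow> bounded (wulff U h) \<Longrightarrow> \<forall>v\<in>U. x0 \<bullet> v < h v \<Longrightarrow>
       emeasure (hausdorff_measure (CARD('n) - 1)) (open_facet U h u)
         = ennreal (c * measure lebesgue (facet_cylinder U h u))"
proof -
  let ?H = "hausdorff_measure (CARD('n) - 1) :: (real ^ 'n) measure"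
  obtain c where c: "0 < c" "\<And>A a. A \<in> sets borel \<Longrightarrow> A \<subseteq> {x. x \<bullet> u = a} \<Longrightarrow>
       emeasure ?H A = ennreal c * emeasure lborel (cylinder u {y. y + a *\<^sub>R u \<in> A})"
    using hausdorff_measure_affine_hyperplane[OF u] by blast
  show ?thesis
  proof (rule that[OF c(1)])
    fix U :: "(real ^ 'n) set" and h x0
    assume U: "finite U" "U \<subseteq> sphere 0 1" "u \<in> U" and bd: "bounded (wulff U h)"
      and x0: "\<forall>v\<in>U. x0 \<bullet> v < h v"
    let ?F = "open_facet U h u"
    let ?A = "{y. y + h u *\<^sub>R u \<in> ?F}"
    have F: "?F \<in> sets borel" by (rule borel_open_facet[OF U(1)])
    have A: "?A \<in> sets borel" using F by measurable
    have "emeasure ?H ?F = ennreal c * emeasure lborel (cylinder u ?A)"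
      using F by (rule c(2)) (auto simp: open_facet_def)
    also have "emeasure lborel (cylinder u ?A) = emeasure lborel (facet_cylinder U h u)"
    proof (rule emeasure_eq_AE)
      have "AE y in lborel. \<forall>v\<in>U - {u}. (proj_perp u y + h u *\<^sub>R u) \<bullet> v \<noteq> h v"
      proof (rule AE_ball_countable')
        fix v assume v: "v \<in> U - {u}"
        have "h u + h v \<noteq> 0" if "v = - u" 
        proof -
          have "x0 \<bullet> u < h u" "x0 \<bullet> v < h v" using x0 U(3) v by auto
          then show ?thesis using that by simp
        qed
        then show "AE y in lborel. (proj_perp u y + h u *\<^sub>R u) \<bullet> v \<noteq> h v"
          using v U u by (intro AE_proj_perp_not_tight) auto
      qed (use U in \<open>auto intro: countable_finite\<close>)
      then show "AE y in lborel. (y \<in> cylinder u ?A) = (y \<in> facet_cylinder U h u)"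
      proof eventually_elim
        case (elim y)
        have "(proj_perp u y + h u *\<^sub>R u) \<bullet> u = h u"
          using u by (simp add: inner_left_distrib dot_square_norm)
        then show ?case using elim
          by (auto simp: cylinder_def facet_cylinder_def open_facet_def wulff_def less_le)
      qed
    qed (use A in \<open>auto intro: borel_cylinder borel_facet_cylinder\<close>)
    also have "\<dots> = ennreal (measure lebesgue (facet_cylinder U h u))"
      using facet_cylinder_finite[OF u bd] borel_facet_cylinder[of U h u]
      by (simp add: emeasure_eq_ennreal_measure less_top)
    finally show "emeasure ?H ?F = ennreal (c * measure lebesgue (facet_cylinder U h u))"
      using c(1) by (simp add: ennreal_mult)
  qed
qed

text \<open>The factors \<open>\<kappa> u\<close> need not be computed: they are absorbed into the prescribed weights. (In fact all
  of them are 1, by the isodiametric inequality.)\<close>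
lemma Lp_surface_area_measure_wulff:
  "\<exists>\<kappa> :: real ^ 'n \<Rightarrow> real. (\<forall>u\<in>sphere 0 1. 0 < \<kappa> u) \<and>
    (\<forall>p U h x0. finite U \<longrightarrow> U \<subseteq> sphere 0 1 \<longrightarrow> bounded (wulff U h) \<longrightarrow> (\<forall>v\<in>U. x0 \<bullet> v < h v) \<longrightarrow>
       Lp_surface_area_measure p (wulff U h)
         = discrete_measure U (\<lambda>u. h u powr (1 - p) * (\<kappa> u * measure lebesgue (facet_cylinder U h u))))"
proof -
  have "\<forall>u \<in> sphere (0 :: real ^ 'n) 1. \<exists>c. 0 < c \<and> (\<forall>U h x0. finite U \<longrightarrow> U \<subseteq> sphere 0 1 \<longrightarrow> u \<in> U \<longrightarrow>
       bounded (wulff U h) \<longrightarrow> (\<forall>v\<in>U. x0 \<bullet> v < h v) \<longrightarrow>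
       emeasure (hausdorff_measure (CARD('n) - 1)) (open_facet U h u)
         = ennreal (c * measure lebesgue (facet_cylinder U h u)))"
    using hausdorff_measure_open_facet by (metis mem_sphere_0)
  from bchoice[OF this] obtain \<kappa> where \<kappa>: "\<forall>u \<in> sphere (0 :: real ^ 'n) 1. 0 < \<kappa> u \<and>
      (\<forall>U h x0. finite U \<longrightarrow> U \<subseteq> sphere 0 1 \<longrightarrow> u \<in> U \<longrightarrow>
       bounded (wulff U h) \<longrightarrow> (\<forall>v\<in>U. x0 \<bullet> v < h v) \<longrightarrow>
       emeasure (hausdorff_measure (CARD('n) - 1)) (open_facet U h u)
         = ennreal (\<kappa> u * measure lebesgue (facet_cylinder U h u)))" by blast
  have "Lp_surface_area_measure p (wulff U h)
         = discrete_measure U (\<lambda>u. h u powr (1 - p) * (\<kappa> u * measure lebesgue (facet_cylinder U h u)))"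
    if *: "finite U" "U \<subseteq> sphere 0 1" "bounded (wulff U h)" "\<forall>v\<in>U. x0 \<bullet> v < h v"
    for p U h and x0 :: "real ^ 'n"
  proof (rule Lp_surface_area_measure_wulff_facets[OF *(1,2)])
    fix u assume u: "u \<in> U"
    then have "u \<in> sphere 0 1" using *(2) by blast
    then have "emeasure (hausdorff_measure (CARD('n) - 1)) (open_facet U h u)
        = ennreal (\<kappa> u * measure lebesgue (facet_cylinder U h u))"
      using \<kappa> * u by blast
    then show "emeasure (hausdorff_measure (DIM(real ^ 'n) - 1)) (open_facet U h u)
        = ennreal (\<kappa> u * measure lebesgue (facet_cylinder U h u))"
      by simp
  qed
  then show ?thesis using \<kappa> by blast
qed

section \<open>Volume under stretching, and its derivative when one facet hyperplane moves\<close>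

lemma emeasure_lborel_orthogonal_vimage:
  fixes f :: "'a::euclidean_space \<Rightarrow> 'a"
  assumes f: "orthogonal_transformation f" and A: "A \<in> sets borel"
  shows "emeasure lborel (f -` A) = emeasure lborel A"
proof -
  have lin: "linear f" by (rule orthogonal_transformation_linear[OF f])
  have meas: "f \<in> borel_measurable borel"
    using lin by (intro borel_measurable_continuous_onI linear_continuous_on linear_conv_bounded_linear[THEN iffD1])
  define M where "M = distr lborel borel f"
  have eM: "emeasure M C = emeasure lborel (f -` C)" if "C \<in> sets borel" for C
    using that meas unfolding M_def by (subst emeasure_distr) auto
  \<comment> \<open>Uniqueness again: since \<open>f\<close> is linear and onto, its push-forward
    \<open>M\<close> is translation invariant, and it agrees with Lebesgue measure on centred balls,
    which \<open>f\<close> preserves.\<close>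
  have "emeasure M A * emeasure lborel (cball (0 :: 'a) 1) = emeasure M (cball 0 1) * emeasure lborel A"
  proof (rule translation_invariant_measures_proportional[where W = UNIV])
    have ball: "f -` cball 0 r = cball 0 r" for r
      using f by (auto simp: orthogonal_transformation_norm)
    show "sigma_finite_measure M"
    proof (rule sigma_finite_measureI_balls)
      show "emeasure M (cball 0 (real k)) \<noteq> \<infinity>" for k
        using emeasure_lborel_cball_finite[of "0 :: 'a" "real k"] by (simp add: eM ball)
    qed (simp add: M_def)
    show "sigma_finite_measure (lborel :: 'a measure)" by (rule lborel.sigma_finite_measure_axioms)
    fix w :: 'a and C :: "'a set" assume C: "C \<in> sets borel"
    obtain z where z: "w = f z" using orthogonal_transformation_surj[OF f] by (metis surj_def)
    have shift: "{x. x + w \<in> C} \<in> sets borel" using C by measurable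
    have "f -` {x. x + w \<in> C} = {x. x + z \<in> f -` C}" by (auto simp: z linear_add[OF lin])
    then show "emeasure M {x. x + w \<in> C} = emeasure M C"
      using emeasure_lborel_translate[OF measurable_sets_borel[OF meas C], of z]
      by (simp only: eM[OF C] eM[OF shift])
    show "emeasure lborel {x. x + w \<in> C} = emeasure lborel C"
      using C by (rule emeasure_lborel_translate)
  qed (use A in \<open>auto simp: M_def\<close>)
  moreover have "f -` cball 0 1 = cball 0 1" using f by (auto simp: orthogonal_transformation_norm)
  ultimately have "emeasure lborel (f -` A) * emeasure lborel (cball (0 :: 'a) 1)
      = emeasure lborel A * emeasure lborel (cball (0 :: 'a) 1)"
    using A by (simp add: eM mult.commute)
  moreover have "emeasure lborel (cball (0 :: 'a) 1) \<noteq> 0" "emeasure lborel (cball (0 :: 'a) 1) \<noteq> top"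
    using emeasure_lborel_cball_finite[of "0 :: 'a" 1] content_cball_pos[of 1 "0 :: 'a"]
    by (auto simp: measure_def)
  ultimately show ?thesis by (metis mult_divide_eq_ennreal)
qed

text \<open>Change of variables for the map that scales by \<open>s\<close> along \<open>u\<close>
  and shifts by \<open>a\<close>; a rotation turns it into a coordinate scaling. Negative
  \<open>s\<close> occurs when a facet hyperplane moves inwards.\<close>

lemma emeasure_lborel_stretch:
  fixes u :: "real ^ 'n"
  assumes u: "norm u = 1" and s: "s \<noteq> 0" and A: "A \<in> sets borel"
  shows "emeasure lborel A = ennreal \<bar>s\<bar> * emeasure lborel {y. proj_perp u y + (a + s * (y \<bullet> u)) *\<^sub>R u \<in> A}"
proof -
  obtain e :: "real ^ 'n" where e: "e \<in> Basis" using nonempty_Basis by blast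
  obtain R where R: "orthogonal_transformation R" "R e = u"
    using orthogonal_transformation_exists[of e u] u e by auto
  have lin: "linear R" by (rule orthogonal_transformation_linear[OF R(1)])
  define Q where "Q = inv R"
  have Q: "orthogonal_transformation Q" unfolding Q_def by (rule orthogonal_transformation_inv[OF R(1)])
  have RQ: "R (Q y) = y" for y
    unfolding Q_def by (rule surj_f_inv_f[OF orthogonal_transformation_surj[OF R(1)]])
  define D where "D x = a *\<^sub>R e + (\<Sum>j\<in>Basis. ((if j = e then s else 1) * (x \<bullet> j)) *\<^sub>R j)" for x
  have D: "D x = a *\<^sub>R e + (x + ((s - 1) * (x \<bullet> e)) *\<^sub>R e)" for x
  proof -
    have "(\<Sum>j\<in>Basis. ((if j = e then s else 1) * (x \<bullet> j)) *\<^sub>R j)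
        = (\<Sum>j\<in>Basis. (x \<bullet> j) *\<^sub>R j + (if j = e then ((s - 1) * (x \<bullet> e)) *\<^sub>R e else 0))"
      by (intro sum.cong) (auto simp: algebra_simps)
    then show ?thesis using e by (simp add: D_def sum.distrib euclidean_representation)
  qed
  have dens: "lborel = density (distr lborel borel D) (\<lambda>_. \<Prod>j\<in>Basis. \<bar>if j = e then s else 1\<bar>)"
    unfolding D_def using s by (intro lborel_affine_euclidean) auto
  have "(\<Prod>j\<in>Basis. \<bar>if j = e then s else 1\<bar>) = \<bar>s\<bar>"
    using e by (simp add: prod.remove[of _ e])
  then have dens: "lborel = density (distr lborel borel D) (\<lambda>_. ennreal \<bar>s\<bar>)" using dens by simp
  have mD: "D \<in> borel_measurable borel" unfolding D by measurable
  have stretch: "emeasure lborel B = ennreal \<bar>s\<bar> * emeasure lborel (D -` B)" if "B \<in> sets borel" for B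
    using that mD by (subst dens) (simp add: emeasure_density_const emeasure_distr)
  have mR: "R \<in> borel_measurable borel"
    using lin by (intro borel_measurable_continuous_onI linear_continuous_on linear_conv_bounded_linear[THEN iffD1])
  have RA: "R -` A \<in> sets borel" using measurable_sets_borel[OF mR A] .
  have DRA: "D -` R -` A \<in> sets borel" using measurable_sets_borel[OF mD RA] .
  have "emeasure lborel A = emeasure lborel (R -` A)"
    using emeasure_lborel_orthogonal_vimage[OF R(1) A] by simp
  also have "\<dots> = ennreal \<bar>s\<bar> * emeasure lborel (D -` R -` A)" by (rule stretch[OF RA])
  also have "emeasure lborel (D -` R -` A) = emeasure lborel (Q -` D -` R -` A)"
    using emeasure_lborel_orthogonal_vimage[OF Q DRA] by simp
  also have "Q -` D -` R -` A = {y. proj_perp u y + (a + s * (y \<bullet> u)) *\<^sub>R u \<in> A}"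
  proof -
    have "R (D (Q y)) = proj_perp u y + (a + s * (y \<bullet> u)) *\<^sub>R u" for y
    proof -
      have "Q y \<bullet> e = y \<bullet> u" using R RQ by (metis orthogonal_transformation_def)
      then show ?thesis
        by (simp add: D linear_add[OF lin] linear_scale[OF lin] linear_diff[OF lin] RQ R(2) proj_perp_def algebra_simps)
    qed
    then show ?thesis by (simp add: vimage_def)
  qed
  finally show ?thesis .
qed

text \<open>Moving the hyperplane of \<open>u\<close> by \<open>r\<close> adds or removes a layer
  \<open>L r\<close>. Stretched to height 1 it becomes \<open>C r\<close>, so the difference
  quotient equals the volume of \<open>C r\<close> exactly, and dominated convergence leads to the
  prism \<open>C 0\<close> over the facet.\<close>

lemma wulff_volume_derivative:
  fixes U :: "(real ^ 'n) set" and h :: "real ^ 'n \<Rightarrow> real" and s :: "nat \<Rightarrow> real"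
  assumes U: "finite U" "U \<subseteq> sphere 0 1" "u \<in> U" and bd: "\<And>h. bounded (wulff U h)"
    and x0: "\<forall>v\<in>U. x0 \<bullet> v < h v"
    and s: "s \<longlonglongrightarrow> 0" "\<And>i. s i \<noteq> 0" "\<And>i. \<bar>s i\<bar> \<le> 1"
  shows "(\<lambda>i. (measure lebesgue (wulff U (h(u := h u + s i))) - measure lebesgue (wulff U h)) / s i)
    \<longlonglongrightarrow> measure lebesgue (facet_cylinder U h u)"
proof -
  have nu: "norm u = 1" using U by auto
  have uu: "u \<bullet> u = 1" using nu by (simp add: dot_square_norm)
  \<comment> \<open>\<open>T r\<close> maps the slab \<open>0 \<le> y \<bullet> u \<le> 1\<close> to
    the layer between the heights \<open>h u\<close> and \<open>h u + r\<close>; \<open>T 0\<close>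
    flattens it onto the facet hyperplane.\<close>
  define T where "T r y = proj_perp u y + (h u + r * (y \<bullet> u)) *\<^sub>R u" for r y
  have Tu: "T r y \<bullet> u = h u + r * (y \<bullet> u)" for r y
    using nu by (simp add: T_def inner_left_distrib uu)
  define C where "C r = {y. 0 \<le> y \<bullet> u \<and> y \<bullet> u \<le> 1 \<and> (\<forall>v\<in>U - {u}. T r y \<bullet> v \<le> h v)}" for r
  define L where "L r = {x. (if r < 0 then h u + r \<le> x \<bullet> u \<and> x \<bullet> u \<le> h u else h u \<le> x \<bullet> u \<and> x \<bullet> u \<le> h u + r)
       \<and> (\<forall>v\<in>U - {u}. x \<bullet> v \<le> h v)}" for r
  let ?h = "\<lambda>r. h(u := h u + r)"
  have lm: "wulff U g \<in> lmeasurable" for g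
    using bd closed_wulff by (intro lmeasurable_compact) (simp add: compact_eq_bounded_closed)
  have wh: "x \<in> wulff U (?h r) \<longleftrightarrow> x \<bullet> u \<le> h u + r \<and> (\<forall>v\<in>U - {u}. x \<bullet> v \<le> h v)" for x r
    using U(3) by (auto simp: wulff_def)
  have wh0: "x \<in> wulff U h \<longleftrightarrow> x \<bullet> u \<le> h u \<and> (\<forall>v\<in>U - {u}. x \<bullet> v \<le> h v)" for x
    using wh[of x 0] by simp
  have closedL: "closed (L r)" for r
  proof -
    have "L r = (if r < 0 then {x. u \<bullet> x \<ge> h u + r} \<inter> {x. u \<bullet> x \<le> h u} else {x. u \<bullet> x \<ge> h u} \<inter> {x. u \<bullet> x \<le> h u + r})
        \<inter> wulff (U - {u}) h"
      by (auto simp: L_def wulff_def inner_commute)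
    then show ?thesis by (auto intro!: closed_Int closed_wulff closed_halfspace_le closed_halfspace_ge)
  qed
  have Lsub: "L r \<subseteq> wulff U (?h \<bar>r\<bar>)" for r
  proof
    fix x assume "x \<in> L r"
    then show "x \<in> wulff U (?h \<bar>r\<bar>)" unfolding wh by (auto simp: L_def split: if_splits)
  qed
  have Lm: "L r \<in> lmeasurable" for r
    using closedL bounded_subset[OF bd Lsub] by (intro lmeasurable_compact) (simp add: compact_eq_bounded_closed)
  have TL: "C r = {y. T r y \<in> L r}" if "r \<noteq> 0" for r
  proof -
    have iff: "(if r < 0 then h u + r \<le> h u + r * t \<and> h u + r * t \<le> h u else h u \<le> h u + r * t \<and> h u + r * t \<le> h u + r)
       \<longleftrightarrow> 0 \<le> t \<and> t \<le> 1" for t :: real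
      using that by (auto simp: zero_le_mult_iff mult_le_0_iff mult_le_cancel_left1 mult_le_cancel_left2)
    have "y \<in> C r \<longleftrightarrow> T r y \<in> L r" for y
      unfolding C_def L_def mem_Collect_eq Tu iff[of "y \<bullet> u"] by simp
    then show ?thesis by auto
  qed
  have contT: "continuous_on UNIV (T r)" for r unfolding T_def by (intro continuous_intros)
  have closedC: "closed (C r)" for r
  proof -
    have "C r = {y. 0 \<le> u \<bullet> y} \<inter> {y. u \<bullet> y \<le> 1} \<inter> T r -` wulff (U - {u}) h"
      by (auto simp: C_def wulff_def inner_commute)
    then show ?thesis
      by (auto intro!: closed_Int closed_halfspace_le closed_halfspace_ge closed_vimage closed_wulff contT)
  qed
  have volL: "measure lebesgue (L r) = \<bar>r\<bar> * measure lborel (C r)" if "r \<noteq> 0" for r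
  proof -
    have "emeasure lborel (L r) = ennreal \<bar>r\<bar> * emeasure lborel (C r)"
      using emeasure_lborel_stretch[OF nu that borel_closed[OF closedL[of r]], of "h u"]
      by (simp add: TL[OF that] T_def)
    then show ?thesis using borel_closed[OF closedL[of r]]
      by (simp add: measure_def enn2real_mult)
  qed
  have hyp: "negligible {x. u \<bullet> x = c}" for c
    using nu by (intro negligible_hyperplane) auto
  have negl: "negligible (wulff U h \<inter> L r)" if "0 < r" for r
    by (rule negligible_subset[OF hyp[of "h u"]])
      (use that in \<open>auto simp: L_def wh0 inner_commute\<close>)
  have negl': "negligible (wulff U (?h r) \<inter> L r)" if "r < 0" for r
    by (rule negligible_subset[OF hyp[of "h u + r"]])
      (use that in \<open>auto simp: L_def wh inner_commute\<close>)
  have quot: "(measure lebesgue (wulff U (?h r)) - measure lebesgue (wulff U h)) / r = measure lborel (C r)"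
    if "r \<noteq> 0" for r
  proof (cases "0 < r")
    case True
    have "wulff U (?h r) = wulff U h \<union> L r" using True by (auto simp: L_def wh wh0)
    then have "measure lebesgue (wulff U (?h r)) = measure lebesgue (wulff U h) + measure lebesgue (L r)"
      using measure_Un3[OF lm Lm, of h r] negl[OF True] by (simp add: negligible_imp_measure0)
    then show ?thesis using True volL[OF that] by simp
  next
    case False
    then have "wulff U h = wulff U (?h r) \<union> L r" using that by (auto simp: L_def wh wh0)
    then have "measure lebesgue (wulff U h) = measure lebesgue (wulff U (?h r)) + measure lebesgue (L r)"
      using measure_Un3[OF lm Lm, of "?h r" r] negl'[of r] False that by (simp add: negligible_imp_measure0)
    then show ?thesis using False that volL[OF that] by (simp add: field_simps)
  qed
  obtain B where B: "\<And>x. x \<in> wulff U (?h 1) \<Longrightarrow> norm x \<le> B" using bd[of "?h 1"] by (auto simp: bounded_iff)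
  \<comment> \<open>Uniform domination: for \<open>\<bar>r\<bar> \<le> 1\<close> the point
    \<open>T r y\<close> lies in the body with \<open>h u + 1\<close>, and \<open>T r\<close> does
    not change the projection of \<open>y\<close>.\<close>
  have Cb: "C r \<subseteq> cball 0 (B + 1)" if "\<bar>r\<bar> \<le> 1" for r
  proof
    fix y assume y: "y \<in> C r"
    have "r * (y \<bullet> u) \<le> \<bar>r\<bar> * \<bar>y \<bullet> u\<bar>" by (metis abs_ge_self abs_mult)
    also have "\<dots> \<le> 1 * 1" using y that by (intro mult_mono) (auto simp: C_def)
    finally have "T r y \<in> wulff U (?h 1)" using y by (simp add: wh Tu C_def)
    then have "norm (T r y) \<le> B" by (rule B)
    moreover have "proj_perp u (T r y) = proj_perp u y"
      using nu by (simp add: T_def proj_perp_def inner_left_distrib inner_diff_left uu algebra_simps)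
    ultimately have "norm (proj_perp u y) \<le> B" using norm_proj_perp_le[OF nu, of "T r y"] by simp
    moreover have "norm ((y \<bullet> u) *\<^sub>R u) \<le> 1" using y nu by (simp add: C_def)
    ultimately have "norm (proj_perp u y + (y \<bullet> u) *\<^sub>R u) \<le> B + 1" by (rule norm_triangle_mono)
    then show "y \<in> cball 0 (B + 1)" by (simp add: proj_perp_def)
  qed
  have "(\<lambda>i. \<integral>y. indicator (C (s i)) y \<partial>lborel) \<longlonglongrightarrow> (\<integral>y. indicator (C 0) y \<partial>lborel :: real)"
  proof (rule integral_dominated_convergence[where w = "indicator (cball 0 (B + 1))"])
    show "integrable lborel (indicator (cball 0 (B + 1)) :: real ^ 'n \<Rightarrow> real)"
      using emeasure_lborel_cball_finite[of "0 :: real ^ 'n" "B + 1"]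
      by (intro integrable_real_indicator) auto
    show "AE y in lborel. norm (indicator (C (s i)) y :: real) \<le> indicator (cball 0 (B + 1)) y" for i
      using Cb[OF s(3)[of i]] by (intro AE_I2) (auto simp: indicator_def)
    \<comment> \<open>If no other constraint is tight at \<open>T 0 y\<close>, membership of
      \<open>y\<close> in \<open>C (s i)\<close> eventually coincides with membership in
      \<open>C 0\<close>.\<close>
    have "AE y in lborel. \<forall>v\<in>U - {u}. (proj_perp u y + h u *\<^sub>R u) \<bullet> v \<noteq> h v"
    proof (rule AE_ball_countable')
      fix v assume v: "v \<in> U - {u}"
      have "h u + h v \<noteq> 0" if "v = - u"
      proof -
        have "x0 \<bullet> u < h u" "x0 \<bullet> v < h v" using x0 U(3) v by auto
        then show ?thesis using that by simp
      qed
      then show "AE y in lborel. (proj_perp u y + h u *\<^sub>R u) \<bullet> v \<noteq> h v"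
        using v U nu by (intro AE_proj_perp_not_tight) auto
    qed (use U in \<open>auto intro: countable_finite\<close>)
    then show "AE y in lborel. (\<lambda>i. indicator (C (s i)) y :: real) \<longlonglongrightarrow> indicator (C 0) y"
    proof eventually_elim
      case (elim y)
      have lim: "(\<lambda>i. T (s i) y \<bullet> v) \<longlonglongrightarrow> T 0 y \<bullet> v" for v
        unfolding T_def by (intro tendsto_intros s(1))
      have ev: "\<forall>\<^sub>F i in sequentially. (T (s i) y \<bullet> v \<le> h v) = (T 0 y \<bullet> v \<le> h v)" if "v \<in> U - {u}" for v
      proof (cases "T 0 y \<bullet> v < h v")
        case True
        then show ?thesis using order_tendstoD(2)[OF lim True] by (auto elim: eventually_mono)
      next
        case False
        moreover have "T 0 y \<bullet> v \<noteq> h v" using elim that by (simp add: T_def)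
        ultimately have *: "h v < T 0 y \<bullet> v" by simp
        then show ?thesis using order_tendstoD(1)[OF lim *] by (auto elim: eventually_mono)
      qed
      have "\<forall>\<^sub>F i in sequentially. \<forall>v\<in>U - {u}. (T (s i) y \<bullet> v \<le> h v) = (T 0 y \<bullet> v \<le> h v)"
        using ev U(1) by (intro eventually_ball_finite) auto
      then have "\<forall>\<^sub>F i in sequentially. indicator (C (s i)) y = (indicator (C 0) y :: real)"
        by eventually_elim (auto simp: C_def indicator_def)
      then show ?case by (rule tendsto_eventually)
    qed
  qed (use closedC in \<open>auto intro!: borel_measurable_indicator borel_closed\<close>)
  then have "(\<lambda>i. measure lborel (C (s i))) \<longlonglongrightarrow> measure lborel (C 0)" by simp
  moreover have "C 0 = facet_cylinder U h u"
    using U(3) nu by (auto simp: C_def facet_cylinder_def wulff_def T_def inner_left_distrib uu)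
  ultimately show ?thesis using quot s(2) by simp
qed

section \<open>The variational problem\<close>

lemma powr_less_tangent:
  fixes a s p :: real
  assumes p: "0 < p" "p < 1" and a: "0 < a" and s: "0 \<le> s" "s \<noteq> a"
  shows "s powr p < a powr p + p * a powr (p - 1) * (s - a)"
proof -
  have le: "x powr p \<le> 1 + p * (x - 1)" if "0 \<le> x" for x :: real
  proof (cases "x = 0")
    case True then show ?thesis using p by simp
  next
    case False
    then have "x powr p * 1 powr (1 - p) \<le> p * x + (1 - p) * 1"
      using that p by (intro Youngs_inequality_0) auto
    then show ?thesis by (simp add: algebra_simps)
  qed
  have less: "x powr p < 1 + p * (x - 1)" if x: "0 \<le> x" "x \<noteq> 1" for x :: real
  proof -
    \<comment> \<open>The square root supplies strictness: squaring the weak inequality at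
      \<open>y\<close> leaves the remainder \<open>p * (1 - p) * (y - 1)\<^sup>2\<close>.\<close>
    define y where "y = sqrt x"
    have y: "0 \<le> y" "y \<noteq> 1" "x = y\<^sup>2" using x by (auto simp: y_def)
    have "x powr p = (y powr p)\<^sup>2"
      using y by (simp add: power2_eq_square powr_mult)
    also have "\<dots> \<le> (1 + p * (y - 1))\<^sup>2" using le[OF y(1)] by (intro power_mono) auto
    also have "\<dots> = 1 + p * (x - 1) - p * (1 - p) * (y - 1)\<^sup>2"
      unfolding y(3) by (simp add: power2_eq_square algebra_simps)
    also have "\<dots> < 1 + p * (x - 1)" using p y by simp
    finally show ?thesis .
  qed
  have "s powr p = a powr p * (s / a) powr p" using a s by (simp flip: powr_mult)
  also have "\<dots> < a powr p * (1 + p * (s / a - 1))" using less[of "s / a"] a s by simp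
  also have "\<dots> = a powr p + p * (a powr p / a) * (s - a)" using a by (simp add: field_simps)
  also have "a powr p / a = a powr (p - 1)" using a by (simp add: powr_diff)
  finally show ?thesis .
qed

lemma powr_le_tangent:
  fixes a s p :: real
  assumes "0 < p" "p < 1" "0 < a" "0 \<le> s"
  shows "s powr p \<le> a powr p + p * a powr (p - 1) * (s - a)"
  using powr_less_tangent[of p a s] assms by (cases "s = a") auto

text \<open>Adding the two tangent inequalities at the midpoint cancels the linear terms. The strict
  form yields uniqueness of the maximum point.\<close>

lemma powr_midpoint:
  fixes s t p :: real
  assumes p: "0 < p" "p < 1" and st: "0 \<le> s" "0 \<le> t"
  shows "(s powr p + t powr p) / 2 \<le> ((s + t) / 2) powr p"
    and "s \<noteq> t \<Longrightarrow> (s powr p + t powr p) / 2 < ((s + t) / 2) powr p"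
proof -
  show strict: "(s powr p + t powr p) / 2 < ((s + t) / 2) powr p" if "s \<noteq> t"
  proof -
    let ?m = "(s + t) / 2"
    have m: "0 < ?m" "s \<noteq> ?m" "t \<noteq> ?m" using st that by auto
    have "s powr p + t powr p < 2 * ?m powr p + p * ?m powr (p - 1) * ((s - ?m) + (t - ?m))"
      using powr_less_tangent[OF p m(1) st(1) m(2)] powr_less_tangent[OF p m(1) st(2) m(3)]
      by (simp only: distrib_left)
    also have "(s - ?m) + (t - ?m) = 0" by simp
    finally show ?thesis by simp
  qed
  show "(s powr p + t powr p) / 2 \<le> ((s + t) / 2) powr p"
    using strict by (cases "s = t") auto
qed

section \<open>Compactness and the hemisphere condition\<close>

lemma simultaneous_convergent_subsequence:
  fixes f :: "nat \<Rightarrow> 'i \<Rightarrow> real"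
  assumes "finite U" "\<And>u. u \<in> U \<Longrightarrow> bounded (range (\<lambda>i. f i u))"
  obtains r l where "strict_mono r" "\<And>u. u \<in> U \<Longrightarrow> (\<lambda>i. f (r i) u) \<longlonglongrightarrow> l u"
proof -
  have "\<exists>r l. strict_mono (r :: nat \<Rightarrow> nat) \<and> (\<forall>u\<in>U. (\<lambda>i. f (r i) u) \<longlonglongrightarrow> l u)"
    using assms
  proof (induction rule: finite_induct)
    case empty
    show ?case by (intro exI[of _ id]) (auto simp: strict_mono_def)
  next
    case (insert v V)
    then obtain r l where r: "strict_mono (r :: nat \<Rightarrow> nat)" "\<And>u. u \<in> V \<Longrightarrow> (\<lambda>i. f (r i) u) \<longlonglongrightarrow> l u"
      by blast
    have "bounded (range (\<lambda>i. f (r i) v))"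
      by (rule bounded_subset[OF insert.prems[of v]]) auto
    then obtain q and m :: real where q: "strict_mono (q :: nat \<Rightarrow> nat)" "((\<lambda>i. f (r i) v) \<circ> q) \<longlonglongrightarrow> m"
      using bounded_imp_convergent_subsequence by blast
    have "(\<lambda>i. f ((r \<circ> q) i) u) \<longlonglongrightarrow> (l(v := m)) u" if "u \<in> insert v V" for u
    proof (cases "u = v")
      case True then show ?thesis using q(2) by (simp add: o_def)
    next
      case False
      then have "((\<lambda>i. f (r i) u) \<circ> q) \<longlonglongrightarrow> l u" using r(2) that q(1) by (intro LIMSEQ_subseq_LIMSEQ) auto
      then show ?thesis using False by (simp add: o_def)
    qed
    moreover have "strict_mono (r \<circ> q)" using r(1) q(1) by (rule strict_mono_o)
    ultimately show ?case by blast
  qed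
  then show ?thesis using that by blast
qed

lemma positive_direction:
  assumes "U \<subseteq> sphere 0 1" "\<not> concentrated_on_closed_hemisphere U" "v \<noteq> 0"
  obtains u where "u \<in> U" "0 < v \<bullet> u"
proof -
  let ?w = "- (v /\<^sub>R norm v)"
  have "?w \<in> sphere 0 1" using assms(3) by simp
  then have "\<not> U \<subseteq> closed_hemisphere ?w" using assms(2) by (auto simp: concentrated_on_closed_hemisphere_def)
  then obtain u where u: "u \<in> U" "u \<notin> closed_hemisphere ?w" by blast
  then have "\<not> 0 \<le> u \<bullet> ?w" using assms(1) by (auto simp: closed_hemisphere_def)
  then have "0 < (v \<bullet> u) / norm v" by (simp add: inner_commute divide_inverse mult.commute)
  then have "0 < v \<bullet> u" using assms(3) by (simp add: zero_less_divide_iff)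
  then show ?thesis using u(1) that by blast
qed

text \<open>The sum of the positive parts of \<open>x \<bullet> u\<close> is homogeneous and, by the
  hemisphere condition, positive off 0, hence at least a constant times \<open>norm x\<close>; on
  the body it is at most the sum of the \<open>\<bar>h u\<bar>\<close>.\<close>

lemma bounded_wulff:
  fixes U :: "(real ^ 'n) set"
  assumes U: "finite U" "U \<subseteq> sphere 0 1" and nc: "\<not> concentrated_on_closed_hemisphere U"
  shows "bounded (wulff U h)"
proof -
  define f where "f v = (\<Sum>u\<in>U. max 0 (v \<bullet> u))" for v
  have pos: "0 < f v" if "v \<noteq> 0" for v
  proof -
    obtain u where "u \<in> U" "0 < v \<bullet> u" using positive_direction[OF U(2) nc \<open>v \<noteq> 0\<close>] by blast
    then show ?thesis unfolding f_def using U(1) by (intro sum_pos2[of U u]) auto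
  qed
  have "continuous_on (sphere 0 1) f" unfolding f_def by (intro continuous_intros)
  moreover have "sphere (0 :: real ^ 'n) 1 \<noteq> {}" by (simp add: sphere_eq_empty)
  ultimately obtain v0 where v0: "v0 \<in> sphere 0 1" "\<And>v. v \<in> sphere 0 1 \<Longrightarrow> f v0 \<le> f v"
    using continuous_attains_inf[OF compact_sphere] by metis
  have c: "0 < f v0" using v0(1) by (intro pos) auto
  have "norm x \<le> (\<Sum>u\<in>U. \<bar>h u\<bar>) / f v0" if x: "x \<in> wulff U h" for x
  proof (cases "x = 0")
    case True then show ?thesis using c by (simp add: sum_nonneg)
  next
    case False
    have "f v0 \<le> f (x /\<^sub>R norm x)" using False by (intro v0(2)) simp
    also have "\<dots> = f x / norm x"
      unfolding f_def sum_divide_distrib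
      by (intro sum.cong) (auto simp: max_def divide_inverse mult.commute zero_le_mult_iff)
    finally have "norm x * f v0 \<le> f x" using False by (simp add: field_simps)
    also have "f x \<le> (\<Sum>u\<in>U. \<bar>h u\<bar>)"
      unfolding f_def by (rule sum_mono) (use x in \<open>force simp: wulff_def\<close>)
    finally show ?thesis using c by (simp add: field_simps)
  qed
  then show ?thesis by (auto simp: bounded_iff)
qed

lemma wulff_translate: "wulff U (\<lambda>u. h u - x \<bullet> u) = (\<lambda>y. y - x) ` wulff U h"
proof -
  have "y \<in> (\<lambda>y. y - x) ` wulff U h" if "y \<in> wulff U (\<lambda>u. h u - x \<bullet> u)" for y
    by (rule image_eqI[of _ _ "y + x"])
      (use that in \<open>auto simp: wulff_def inner_left_distrib algebra_simps\<close>)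
  then show ?thesis by (auto simp: wulff_def inner_diff_left)
qed

lemma wulff_scale:
  assumes "0 < c" shows "wulff U (\<lambda>u. c * h u) = (\<lambda>y. c *\<^sub>R y) ` wulff U h"
proof -
  have "y \<in> (\<lambda>y. c *\<^sub>R y) ` wulff U h" if "y \<in> wulff U (\<lambda>u. c * h u)" for y
    by (rule image_eqI[of _ _ "y /\<^sub>R c"])
      (use that assms in \<open>auto simp: wulff_def field_simps\<close>)
  then show ?thesis using assms by (auto simp: wulff_def)
qed

text \<open>\<open>\<alpha>\<close> will stand for the prescribed weights divided by the factors
  between Hausdorff measure and prism volume.\<close>

locale minkowski_data =
  fixes U :: "(real ^ 'n) set" and \<alpha> :: "real ^ 'n \<Rightarrow> real" and p :: real
  assumes p: "0 < p" "p < 1"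
    and U: "finite U" "U \<subseteq> sphere 0 1"
    and \<alpha>: "\<And>u. u \<in> U \<Longrightarrow> 0 < \<alpha> u"
    and nc: "\<not> concentrated_on_closed_hemisphere U"
begin

definition energy :: "(real ^ 'n \<Rightarrow> real) \<Rightarrow> real ^ 'n \<Rightarrow> real" where
  "energy h x = (\<Sum>u\<in>U. \<alpha> u * (h u - x \<bullet> u) powr p)"

definition vol :: "(real ^ 'n \<Rightarrow> real) \<Rightarrow> real" where
  "vol h = measure lebesgue (wulff U h)"

text \<open>Restricting to the body keeps all slacks \<open>h u - x \<bullet> u\<close> nonnegative,
  the range where \<open>powr\<close> is concave.\<close>

definition maximiser :: "(real ^ 'n \<Rightarrow> real) \<Rightarrow> real ^ 'n \<Rightarrow> bool" where
  "maximiser h x \<longleftrightarrow> x \<in> wulff U h \<and> (\<forall>y\<in>wulff U h. energy h y \<le> energy h x)"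

section \<open>The inner maximum: existence, interior position, uniqueness\<close>

lemma U0: "0 \<notin> U" using U by auto

lemma U_nonempty: "U \<noteq> {}"
  using positive_direction[OF U(2) nc, of "axis undefined 1"] by (auto simp: axis_eq_0_iff)

lemma bounded: "bounded (wulff U h)" by (rule bounded_wulff[OF U nc])

lemma compact: "compact (wulff U h)" by (simp add: compact_eq_bounded_closed bounded closed_wulff)

lemma lmeasurable: "wulff U h \<in> lmeasurable" by (rule lmeasurable_compact[OF compact])

lemma energy_nonneg: "0 \<le> energy h x"
  unfolding energy_def using \<alpha> by (intro sum_nonneg mult_nonneg_nonneg) (auto intro: less_imp_le)

lemma energy_tendsto:
  assumes "\<And>u. u \<in> U \<Longrightarrow> ((\<lambda>i. h i u) \<longlongrightarrow> g u) F" "(x \<longlongrightarrow> y) F"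
    and "\<And>u. u \<in> U \<Longrightarrow> \<forall>\<^sub>F i in F. 0 \<le> h i u - x i \<bullet> u"
  shows "((\<lambda>i. energy (h i) (x i)) \<longlongrightarrow> energy g y) F"
  unfolding energy_def using assms p by (intro tendsto_intros tendsto_powr') auto

lemma continuous_on_energy: "continuous_on (wulff U h) (energy h)"
  unfolding energy_def using p
  by (intro continuous_intros continuous_on_powr') (auto simp: wulff_def)

lemma maximiser_exists:
  assumes "wulff U h \<noteq> {}" obtains x where "maximiser h x"
  using continuous_attains_sup[OF compact assms continuous_on_energy] unfolding maximiser_def by blast

lemma strict_point_exists:
  assumes "0 < vol h" obtains x where "\<forall>u\<in>U. x \<bullet> u < h u"
proof -
  have "\<not> negligible (wulff U h)" using assms by (auto simp: vol_def dest: negligible_imp_measure0)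
  then have "interior (wulff U h) \<noteq> {}" by (simp add: negligible_convex_interior convex_wulff)
  then show ?thesis using that by (auto simp: interior_wulff[OF U(1) U0])
qed

lemma vol_pos:
  assumes "\<forall>u\<in>U. x \<bullet> u < h u" shows "0 < vol h"
proof -
  have "interior (wulff U h) \<noteq> {}" using assms by (auto simp: interior_wulff[OF U(1) U0])
  then have "\<not> negligible (wulff U h)" by (simp add: negligible_convex_interior convex_wulff)
  then have "vol h \<noteq> 0"
    using lmeasurable unfolding vol_def by (metis completion.complete_sets_sandwich_fmeasurable negligible_iff_measure)
  then show ?thesis by (simp add: vol_def less_le)
qed

text \<open>Moving from the boundary towards a strict point at speed \<open>t\<close> gains a term of order \<open>t powr p\<close>
  and loses at most a term of order \<open>t\<close>.\<close>
lemma maximiser_strict: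
  assumes x: "maximiser h x" and x0: "\<forall>u\<in>U. x0 \<bullet> u < h u" and k: "k \<in> U"
  shows "x \<bullet> k < h k"
proof (rule ccontr)
  assume "\<not> x \<bullet> k < h k"
  moreover have xh: "x \<bullet> u \<le> h u" if "u \<in> U" for u using x that by (auto simp: maximiser_def wulff_def)
  ultimately have xk: "x \<bullet> k = h k" using k by force
  define E where "E = energy h x"
  \<comment> \<open>On the segment from \<open>x\<close> to \<open>x0\<close> the term of
    \<open>k\<close> is 0 at the start and \<open>t powr p * c\<close> after the fraction
    \<open>t\<close>.\<close>
  define c where "c = \<alpha> k * (h k - x0 \<bullet> k) powr p"
  have c: "0 < c" 
  proof -
    have "0 < h k - x0 \<bullet> k" using x0 k by simp
    then show ?thesis using \<alpha>[OF k] by (simp add: c_def)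
  qed
  \<comment> \<open>As \<open>p < 1\<close>, some \<open>t\<close> satisfies
    \<open>t powr (1 - p) * E < c\<close>, so that the gain \<open>t powr p * c\<close> beats the
    loss \<open>t * E\<close>.\<close>
  have "((\<lambda>t. t powr (1 - p) * E) \<longlongrightarrow> 0 powr (1 - p) * E) (at_right 0)"
    using p by (intro tendsto_intros tendsto_powr') (auto simp: eventually_at_filter)
  then have "\<forall>\<^sub>F t in at_right 0. t powr (1 - p) * E < c" using c p by (intro order_tendstoD(2)) auto
  moreover have "\<forall>\<^sub>F t in at_right (0 :: real). t \<in> {0<..<1}"
    by (rule eventually_at_right_real) simp
  ultimately have "\<forall>\<^sub>F t in at_right 0. t powr (1 - p) * E < c \<and> t \<in> {0<..<1}" by (rule eventually_conj)
  then obtain t where t: "t powr (1 - p) * E < c" "0 < t" "t < 1"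
    using eventually_happens[of _ "at_right (0 :: real)"] by (auto simp: trivial_limit_at_right_real)
  define y where "y = x + t *\<^sub>R (x0 - x)"
  have slack: "h u - y \<bullet> u = (1 - t) * (h u - x \<bullet> u) + t * (h u - x0 \<bullet> u)" for u
    by (simp add: y_def inner_left_distrib inner_diff_left algebra_simps)
  have nn: "0 \<le> (1 - t) * (h u - x \<bullet> u)" "0 \<le> t * (h u - x0 \<bullet> u)" if "u \<in> U" for u
    using that xh x0 t by (auto intro: less_imp_le)
  have y: "y \<in> wulff U h"
    unfolding wulff_def using nn slack by (smt (verit) mem_Collect_eq)
  have "(1 - t) * E + t powr p * c
      = (\<Sum>u\<in>U. (1 - t) * (\<alpha> u * (h u - x \<bullet> u) powr p) + (if u = k then t powr p * c else 0))"
    using U(1) k by (simp add: E_def energy_def sum.distrib sum_distrib_left)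
  also have "\<dots> \<le> energy h y"
    unfolding energy_def
  proof (rule sum_mono)
    fix u assume u: "u \<in> U"
    show "(1 - t) * (\<alpha> u * (h u - x \<bullet> u) powr p) + (if u = k then t powr p * c else 0)
        \<le> \<alpha> u * (h u - y \<bullet> u) powr p"
    proof (cases "u = k")
      case True
      then show ?thesis using xk t x0 k unfolding slack by (simp add: c_def powr_mult)
    next
      case False
      \<comment> \<open>\<open>(1 - t) powr p\<close> is at least \<open>1 - t\<close>, so every
        other term loses at most the fraction \<open>t\<close>.\<close>
      have "(1 - t) powr 1 \<le> (1 - t) powr p" using t p by (intro powr_mono') auto
      then have "(1 - t) * (h u - x \<bullet> u) powr p \<le> (1 - t) powr p * (h u - x \<bullet> u) powr p"
        using t by (intro mult_right_mono) auto
      also have "\<dots> = ((1 - t) * (h u - x \<bullet> u)) powr p" using t xh[OF u] by (simp add: powr_mult)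
      also have "\<dots> \<le> (h u - y \<bullet> u) powr p"
        unfolding slack using nn[OF u] p by (intro powr_mono2) auto
      finally show ?thesis using False \<alpha>[OF u] by (simp add: mult.left_commute)
    qed
  qed
  also have "\<dots> \<le> E" using x y by (simp add: maximiser_def E_def)
  finally have "t powr p * c \<le> t * E" by (simp add: algebra_simps)
  also have "t * E = t powr p * (t powr (1 - p) * E)" using t by (simp flip: powr_add mult.assoc)
  finally have "c \<le> t powr (1 - p) * E" using t by simp
  then show False using t by simp
qed

text \<open>Strict concavity: since the normals lie in no closed hemisphere, \<open>x - y\<close>
  has positive product with some \<open>k\<close>, so the slacks at \<open>k\<close> differ and the
  midpoint would do better.\<close>

lemma maximiser_unique:
  assumes "maximiser h x" "maximiser h y" shows "x = y"
proof (rule ccontr)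
  assume "x \<noteq> y"
  then obtain k where k: "k \<in> U" "0 < (x - y) \<bullet> k" using positive_direction[OF U(2) nc, of "x - y"] by auto
  let ?m = "(1 / 2) *\<^sub>R (x + y)"
  have xy: "x \<bullet> u \<le> h u" "y \<bullet> u \<le> h u" if "u \<in> U" for u
    using assms that by (auto simp: maximiser_def wulff_def)
  have slack: "h u - ?m \<bullet> u = ((h u - x \<bullet> u) + (h u - y \<bullet> u)) / 2" for u
    by (simp add: inner_left_distrib field_simps)
  have m: "?m \<in> wulff U h" using xy by (auto simp: wulff_def inner_left_distrib) (smt (verit))
  have eq: "energy h x = energy h y" using assms by (auto simp: maximiser_def intro: antisym)
  have "(energy h x + energy h y) / 2
      = (\<Sum>u\<in>U. \<alpha> u * (((h u - x \<bullet> u) powr p + (h u - y \<bullet> u) powr p) / 2))"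
    by (simp add: energy_def sum.distrib distrib_left add_divide_distrib flip: sum_divide_distrib)
  also have "\<dots> < energy h ?m"
    unfolding energy_def slack
  proof (rule sum_strict_mono_ex1[OF U(1)])
    show "\<forall>u\<in>U. \<alpha> u * (((h u - x \<bullet> u) powr p + (h u - y \<bullet> u) powr p) / 2)
        \<le> \<alpha> u * (((h u - x \<bullet> u) + (h u - y \<bullet> u)) / 2) powr p"
      using xy p \<alpha> by (intro ballI mult_left_mono powr_midpoint(1)) (auto intro: less_imp_le)
    have "\<alpha> k * (((h k - x \<bullet> k) powr p + (h k - y \<bullet> k) powr p) / 2)
        < \<alpha> k * (((h k - x \<bullet> k) + (h k - y \<bullet> k)) / 2) powr p"
      using xy[OF k(1)] p \<alpha>[OF k(1)] k(2)
      by (intro mult_strict_left_mono powr_midpoint(2)) (auto simp: inner_diff_left)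
    then show "\<exists>u\<in>U. \<alpha> u * (((h u - x \<bullet> u) powr p + (h u - y \<bullet> u) powr p) / 2)
        < \<alpha> u * (((h u - x \<bullet> u) + (h u - y \<bullet> u)) / 2) powr p" using k(1) by blast
  qed
  also have "\<dots> \<le> energy h x" using assms(1) m by (simp add: maximiser_def)
  finally show False using eq by simp
qed

section \<open>Homogeneity, normalisation and existence of a minimiser\<close>

lemma vol_translate: "vol (\<lambda>u. h u - x \<bullet> u) = vol h"
  by (simp add: vol_def wulff_translate measure_translation_subtract)

lemma vol_scale: "0 < c \<Longrightarrow> vol (\<lambda>u. c * h u) = c ^ CARD('n) * vol h"
  using measure_lebesgue_affine[of c 0 "wulff U h"] by (simp add: vol_def wulff_scale)

lemma energy_scale: "0 < c \<Longrightarrow> x \<in> wulff U h \<Longrightarrow> energy (\<lambda>u. c * h u) (c *\<^sub>R x) = c powr p * energy h x"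
  unfolding energy_def sum_distrib_left
  by (intro sum.cong) (auto simp: wulff_def powr_mult mult.left_commute simp flip: right_diff_distrib)

lemma energy_translate: "energy (\<lambda>u. h u - x \<bullet> u) 0 = energy h x"
  by (simp add: energy_def)

text \<open>Placing the maximum point at 0 selects one translate of each body.\<close>

definition admissible :: "(real ^ 'n \<Rightarrow> real) \<Rightarrow> bool" where
  "admissible h \<longleftrightarrow> 1 \<le> vol h \<and> maximiser h 0"

lemma admissible_translate:
  assumes "1 \<le> vol h" "maximiser h x" shows "admissible (\<lambda>u. h u - x \<bullet> u)"
proof -
  have e: "energy (\<lambda>u. h u - x \<bullet> u) (y - x) = energy h y" for y
    by (simp add: energy_def inner_diff_left)
  show ?thesis
    using assms by (auto simp: admissible_def vol_translate maximiser_def wulff_translate e energy_translate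
        intro!: image_eqI[of 0 _ x])
qed

lemma admissible_exists: "\<exists>h. admissible h"
proof -
  define v where "v = vol (\<lambda>_. 1)"
  have v: "0 < v" unfolding v_def by (rule vol_pos[of 0]) simp
  \<comment> \<open>As \<open>c \<ge> 1\<close>, its n-th power is at least \<open>c\<close>, hence
    at least \<open>1 / v\<close>, and the dilated body has volume at least 1.\<close>
  define c where "c = max 1 (1 / v)"
  have c: "1 \<le> c" "1 / v \<le> c" by (auto simp: c_def)
  have "c ^ 1 \<le> c ^ CARD('n)" using c(1) by (intro power_increasing) (auto simp: Suc_leI)
  then have "1 / v \<le> c ^ CARD('n)" using c by simp
  then have V: "1 \<le> vol (\<lambda>u. c * 1)" using c v by (subst vol_scale) (auto simp: v_def field_simps)
  then have "wulff U (\<lambda>u. c * 1) \<noteq> {}" by (auto simp: vol_def)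
  then obtain x where "maximiser (\<lambda>u. c * 1) x" using maximiser_exists by blast
  then show ?thesis using admissible_translate[OF V] by blast
qed

text \<open>For each \<open>j\<close> the bodies eventually lie in the Wulff shape of
  \<open>g + 1 / (j + 1)\<close>; these shapes decrease to that of \<open>g\<close>, and measure is
  continuous from above.\<close>

lemma vol_upper_semicontinuous:
  assumes h: "\<And>u. u \<in> U \<Longrightarrow> (\<lambda>i. h i u) \<longlonglongrightarrow> g u" and a: "\<And>i. a \<le> vol (h i)"
  shows "a \<le> vol g"
proof -
  let ?g = "\<lambda>j u. g u + 1 / real (Suc j)"
  have "a \<le> vol (?g j)" for j
  proof -
    have "\<forall>\<^sub>F i in sequentially. \<forall>u\<in>U. h i u < ?g j u"
      using U(1) h by (intro eventually_ball_finite ballI order_tendstoD(2)) auto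
    then obtain i where "\<forall>u\<in>U. h i u < ?g j u" by (auto simp: eventually_sequentially)
    then have "wulff U (h i) \<subseteq> wulff U (?g j)" by (force simp: wulff_def)
    then have "vol (h i) \<le> vol (?g j)"
      unfolding vol_def using lmeasurable by (intro measure_mono_fmeasurable) (auto simp: fmeasurableD)
    then show ?thesis using a[of i] by simp
  qed
  moreover have "(\<lambda>j. vol (?g j)) \<longlonglongrightarrow> measure lebesgue (\<Inter>j. wulff U (?g j))"
    unfolding vol_def
  proof (rule Lim_measure_decseq)
    show "range (\<lambda>j. wulff U (?g j)) \<subseteq> sets lebesgue" using lmeasurable by (auto simp: fmeasurableD)
    show "emeasure lebesgue (wulff U (?g j)) \<noteq> \<infinity>" for j
      using lmeasurable[of "?g j"] by (simp add: fmeasurable_def less_top)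
    show "decseq (\<lambda>j. wulff U (?g j))"
    proof (rule antimonoI)
      fix i j :: nat assume "i \<le> j"
      then have "1 / real (Suc j) \<le> 1 / real (Suc i)" by (simp add: frac_le)
      then show "wulff U (?g j) \<subseteq> wulff U (?g i)" by (force simp: wulff_def)
    qed
  qed
  moreover have "(\<Inter>j. wulff U (?g j)) = wulff U g"
  proof -
    have "x \<bullet> u \<le> g u" if "\<And>j. x \<bullet> u \<le> ?g j u" for x u
    proof (rule LIMSEQ_le_const)
      show "(\<lambda>j. ?g j u) \<longlonglongrightarrow> g u"
        using tendsto_add[OF tendsto_const[of "g u"] LIMSEQ_inverse_real_of_nat] by (simp add: inverse_eq_divide)
    qed (use that in auto)
    moreover have "x \<bullet> u \<le> ?g j u" if "x \<bullet> u \<le> g u" for x j u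
      using that by (rule add_increasing2[rotated]) simp
    ultimately show ?thesis by (auto simp: wulff_def)
  qed
  ultimately show ?thesis by (auto simp: vol_def[of g] intro!: LIMSEQ_le_const)
qed

text \<open>With the maximum at 0, each single term \<open>\<alpha> u * h u powr p\<close> is at
  most the energy, which bounds a minimising sequence. The point left to prove is that the limit has
  its own maximum at 0.\<close>

lemma minimiser_exists:
  obtains h where "admissible h" "\<And>g. admissible g \<Longrightarrow> energy h 0 \<le> energy g 0"
proof -
  define m where "m = Inf ((\<lambda>h. energy h 0) ` Collect admissible)"
  have ne: "(\<lambda>h. energy h 0) ` Collect admissible \<noteq> {}" using admissible_exists by auto
  have bdd: "bdd_below ((\<lambda>h. energy h 0) ` Collect admissible)" by (auto intro!: bdd_belowI[of _ 0] energy_nonneg)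
  have mle: "m \<le> energy g 0" if "admissible g" for g
    unfolding m_def using bdd that by (intro cInf_lower) auto
  have "\<exists>h. admissible h \<and> energy h 0 < m + 1 / real (Suc i)" for i
  proof -
    have "m < m + 1 / real (Suc i)" by simp
    from cInf_lessD[OF ne this[unfolded m_def]] show ?thesis by (auto simp: m_def)
  qed
  then obtain f where f: "\<And>i. admissible (f i)" "\<And>i. energy (f i) 0 < m + 1 / real (Suc i)" by metis
  have fnn: "0 \<le> f i u" if "u \<in> U" for i u
    using f(1)[of i] that by (auto simp: admissible_def maximiser_def wulff_def)
  have "bounded (range (\<lambda>i. f i u))" if u: "u \<in> U" for u
  proof -
    have "\<bar>f i u\<bar> \<le> ((m + 1) / \<alpha> u) powr (1 / p)" for i
    proof -
      have "0 \<le> \<alpha> v * (f i v - 0 \<bullet> v) powr p" if "v \<in> U" for v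
        using \<alpha>[OF that] by simp
      then have "\<alpha> u * f i u powr p \<le> energy (f i) 0"
        using member_le_sum[of u U "\<lambda>u. \<alpha> u * (f i u - 0 \<bullet> u) powr p"] U(1) u
        by (simp add: energy_def)
      also have "\<dots> \<le> m + 1"
      proof -
        have "1 / real (Suc i) \<le> 1" by simp
        then show ?thesis using f(2)[of i] by linarith
      qed
      finally have "f i u powr p \<le> (m + 1) / \<alpha> u" using \<alpha>[OF u] by (simp add: field_simps)
      then have "(f i u powr p) powr (1 / p) \<le> ((m + 1) / \<alpha> u) powr (1 / p)"
        using p by (intro powr_mono2) auto
      then show ?thesis using p fnn[OF u, of i] by (simp add: powr_powr)
    qed
    then show ?thesis by (auto simp: bounded_iff)
  qed
  then obtain r g where r: "strict_mono (r :: nat \<Rightarrow> nat)" and g: "\<And>u. u \<in> U \<Longrightarrow> (\<lambda>i. f (r i) u) \<longlonglongrightarrow> g u"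
    using simultaneous_convergent_subsequence[OF U(1), of f] by blast
  have gnn: "0 \<le> g u" if "u \<in> U" for u
    using g[OF that] fnn[OF that] by (intro LIMSEQ_le_const) auto
  then have g0: "0 \<in> wulff U g" by (simp add: wulff_def)
  have vg: "1 \<le> vol g"
    using g by (rule vol_upper_semicontinuous) (use f(1) in \<open>auto simp: admissible_def\<close>)
  have lim0: "(\<lambda>i. energy (f (r i)) 0) \<longlonglongrightarrow> energy g 0"
    using g fnn by (intro energy_tendsto) auto
  have gm: "energy g 0 \<le> m"
  proof (rule LIMSEQ_le[OF lim0])
    show "(\<lambda>i. m + 1 / real (Suc (r i))) \<longlonglongrightarrow> m"
      using tendsto_add[OF tendsto_const[of m] LIMSEQ_subseq_LIMSEQ[OF LIMSEQ_inverse_real_of_nat r]]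
      by (simp add: inverse_eq_divide o_def)
  qed (use f(2) in \<open>auto intro: less_imp_le\<close>)
  obtain x where x: "maximiser g x" using maximiser_exists g0 by blast
  obtain x0 where x0: "\<forall>u\<in>U. x0 \<bullet> u < g u" using strict_point_exists[of g] vg by auto
  \<comment> \<open>Being strict for \<open>g\<close>, the maximum point \<open>x\<close> eventually
    lies in the approximating bodies, where 0 is at least as good; the inequality passes to the
    limit.\<close>
  have xs: "x \<bullet> u < g u" if "u \<in> U" for u by (rule maximiser_strict[OF x x0 that])
  have ev: "\<forall>\<^sub>F i in sequentially. x \<bullet> u < f (r i) u" if "u \<in> U" for u
    using order_tendstoD(1)[OF g[OF that] xs[OF that]] .
  have "energy g x \<le> energy g 0"
  proof (rule LIMSEQ_le[OF _ lim0])
    show "(\<lambda>i. energy (f (r i)) x) \<longlonglongrightarrow> energy g x"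
    proof (rule energy_tendsto[OF g])
      show "\<forall>\<^sub>F i in sequentially. 0 \<le> f (r i) u - x \<bullet> u" if "u \<in> U" for u
        using ev[OF that] by eventually_elim simp
    qed auto
    have "\<forall>\<^sub>F i in sequentially. \<forall>u\<in>U. x \<bullet> u < f (r i) u"
      using U(1) ev by (intro eventually_ball_finite) auto
    then have "\<forall>\<^sub>F i in sequentially. energy (f (r i)) x \<le> energy (f (r i)) 0"
    proof eventually_elim
      case (elim i)
      then have "x \<in> wulff U (f (r i))" by (auto simp: wulff_def intro: less_imp_le)
      then show ?case using f(1)[of "r i"] by (simp add: admissible_def maximiser_def)
    qed
    then show "\<exists>N. \<forall>i\<ge>N. energy (f (r i)) x \<le> energy (f (r i)) 0" by (simp add: eventually_sequentially)
  qed
  then have "maximiser g 0" using x g0 unfolding maximiser_def by (meson order_trans)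
  then have "admissible g" using vg by (simp add: admissible_def)
  moreover have "energy g 0 \<le> energy h 0" if "admissible h" for h using gm mle[OF that] by simp
  ultimately show ?thesis using that by blast
qed

text \<open>Scale invariant form of minimality: any \<open>g\<close> of positive volume can be
  dilated to volume 1 and translated into an admissible competitor. This removes the volume
  constraint from the variation.\<close>

lemma energy_vol_bound:
  assumes h: "admissible h" "\<And>g. admissible g \<Longrightarrow> energy h 0 \<le> energy g 0"
    and g: "0 < vol g" "maximiser g x"
  shows "energy h 0 * vol g powr (p / CARD('n)) \<le> energy g x"
proof -
  let ?n = "real CARD('n)"
  define c where "c = vol g powr (- 1 / ?n)"
  have c: "0 < c" using g by (simp add: c_def)
  have "c ^ CARD('n) = vol g powr (- 1 / ?n * ?n)"
  proof -
    have "c ^ CARD('n) = c powr ?n" using c by (simp add: powr_realpow)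
    then show ?thesis by (simp add: c_def powr_powr)
  qed
  also have "\<dots> = 1 / vol g" using g(1) by (simp add: powr_minus_divide)
  finally have v: "1 \<le> vol (\<lambda>u. c * g u)" using vol_scale[OF c, of g] g(1) by simp
  have e: "energy (\<lambda>u. c * g u) (c *\<^sub>R y) = c powr p * energy g y" if "y \<in> wulff U g" for y
    using energy_scale[OF c that] .
  have "maximiser (\<lambda>u. c * g u) (c *\<^sub>R x)"
    using g(2) c by (auto simp: maximiser_def wulff_scale e)
  then have "energy h 0 \<le> energy (\<lambda>u. c * g u - (c *\<^sub>R x) \<bullet> u) 0"
    by (intro h(2) admissible_translate[OF v])
  also have "\<dots> = c powr p * energy g x"
    using energy_translate[of "\<lambda>u. c * g u" "c *\<^sub>R x"] e g(2) by (simp add: maximiser_def)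
  finally have "energy h 0 * vol g powr (p / ?n) \<le> c powr p * energy g x * vol g powr (p / ?n)"
    by (rule mult_right_mono) simp
  also have "\<dots> = energy g x * (vol g powr (- 1 / ?n * p) * vol g powr (p / ?n))"
    by (simp add: c_def powr_powr)
  also have "vol g powr (- 1 / ?n * p) * vol g powr (p / ?n) = 1"
    using g(1) by (simp flip: powr_add)
  finally show ?thesis by simp
qed

text \<open>Danskin's argument: the perturbed maximisers converge to the unperturbed one, so to first order
  only the explicit dependence of the energy on \<open>h k\<close> matters.\<close>
lemma one_sided_variation:
  assumes h: "admissible h" "\<And>g. admissible g \<Longrightarrow> energy h 0 \<le> energy g 0" and v1: "vol h = 1"
    and k: "k \<in> U" and \<sigma>: "\<bar>\<sigma>\<bar> = 1"
  shows "\<sigma> * (energy h 0 * (p / CARD('n)) * measure lebesgue (facet_cylinder U h k))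
    \<le> \<sigma> * (\<alpha> k * p * h k powr (p - 1))"
proof -
  let ?n = "real CARD('n)" and ?F = "measure lebesgue (facet_cylinder U h k)"
  define m where "m = energy h 0"
  have max0: "maximiser h 0" using h(1) by (simp add: admissible_def)
  obtain x0 where x0: "\<forall>u\<in>U. x0 \<bullet> u < h u" using strict_point_exists[of h] v1 by auto
  have hpos: "0 < h u" if "u \<in> U" for u using maximiser_strict[OF max0 x0 that] by simp
  \<comment> \<open>The bound \<open>h k / 2\<close> keeps the perturbed \<open>h k\<close>
    positive, so 0 stays inside; the bound 1 is required by the volume derivative.\<close>
  define c where "c = min 1 (h k / 2)"
  have c: "0 < c" "c \<le> 1" "c \<le> h k / 2" using hpos[OF k] by (auto simp: c_def)
  define s where "s i = \<sigma> * (c / real (Suc i))" for i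
  have s_abs: "\<bar>s i\<bar> = c / real (Suc i)" for i using \<sigma> c by (simp add: s_def abs_mult)
  have s_le: "\<bar>s i\<bar> \<le> c" for i unfolding s_abs using c by (simp add: divide_le_eq)
  have s0: "s i \<noteq> 0" for i using s_abs[of i] c by auto
  have "(\<lambda>i. \<sigma> * (c * (1 / real (Suc i)))) \<longlonglongrightarrow> \<sigma> * (c * 0)"
    using LIMSEQ_inverse_real_of_nat by (intro tendsto_intros) (simp add: inverse_eq_divide)
  then have s_lim: "s \<longlonglongrightarrow> 0" by (simp add: s_def[abs_def])
  define g where "g i = h(k := h k + s i)" for i
  have gpos: "0 < g i u" if "u \<in> U" for i u
    using hpos[OF that] s_le[of i] c by (auto simp: g_def abs_le_iff)
  have g_lim: "(\<lambda>i. g i u) \<longlonglongrightarrow> h u" for u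
    using tendsto_add[OF tendsto_const[of "h k"] s_lim] by (cases "u = k") (auto simp: g_def)
  have gvol: "0 < vol (g i)" for i using gpos by (intro vol_pos[of 0]) auto
  have "\<exists>x. maximiser (g i) x" for i
  proof -
    have "0 \<in> wulff U (g i)" using gpos by (auto simp: wulff_def intro: less_imp_le)
    then show ?thesis using maximiser_exists by blast
  qed
  then obtain x where x: "\<And>i. maximiser (g i) (x i)" by metis
  have xin: "x i \<in> wulff U (g i)" for i using x by (simp add: maximiser_def)
  have "wulff U (g i) \<subseteq> wulff U (h(k := h k + 1))" for i
    using s_le[of i] c by (auto simp: g_def wulff_def abs_le_iff split: if_splits)
  then have "range x \<subseteq> wulff U (h(k := h k + 1))" using xin by blast
  then obtain r y where r: "strict_mono (r :: nat \<Rightarrow> nat)" and y: "(x \<circ> r) \<longlonglongrightarrow> y"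
    using bounded_imp_convergent_subsequence[OF bounded_subset[OF bounded]] by blast
  have y: "(\<lambda>i. x (r i)) \<longlonglongrightarrow> y" using y by (simp add: o_def)
  have gr: "(\<lambda>i. g (r i) u) \<longlonglongrightarrow> h u" for u
    using LIMSEQ_subseq_LIMSEQ[OF g_lim r] by (simp add: o_def)
  have slack: "0 \<le> g i u - x i \<bullet> u" if "u \<in> U" for i u using xin[of i] that by (simp add: wulff_def)
  have "y \<in> wulff U h"
  proof -
    have lim: "(\<lambda>i. g (r i) u - x (r i) \<bullet> u) \<longlonglongrightarrow> h u - y \<bullet> u" for u
      by (intro tendsto_intros gr y)
    have "0 \<le> h u - y \<bullet> u" if "u \<in> U" for u
      by (rule LIMSEQ_le_const[OF lim]) (use slack[OF that] in auto)
    then show ?thesis by (simp add: wulff_def)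
  qed
  \<comment> \<open>The limit \<open>y\<close> of the perturbed maximum points maximises the energy
    of \<open>h\<close> itself, so it is 0 by uniqueness.\<close>
  moreover have "energy h 0 \<le> energy h y"
  proof (rule LIMSEQ_le)
    show "(\<lambda>i. energy (g (r i)) 0) \<longlonglongrightarrow> energy h 0"
    proof (intro energy_tendsto gr)
      show "\<forall>\<^sub>F i in sequentially. 0 \<le> g (r i) u - 0 \<bullet> u" if "u \<in> U" for u
        using gpos[OF that] by (intro always_eventually) (simp add: less_imp_le)
    qed auto
    show "(\<lambda>i. energy (g (r i)) (x (r i))) \<longlonglongrightarrow> energy h y"
      using slack by (intro energy_tendsto gr y) auto
    have "0 \<in> wulff U (g i)" for i using gpos by (auto simp: wulff_def intro: less_imp_le)
    then show "\<exists>N. \<forall>i\<ge>N. energy (g (r i)) 0 \<le> energy (g (r i)) (x (r i))"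
      using x by (auto simp: maximiser_def)
  qed
  ultimately have "maximiser h y" using max0 unfolding maximiser_def by (meson order_trans)
  then have "y = 0" using max0 by (rule maximiser_unique)
  then have x_lim: "(\<lambda>i. x (r i)) \<longlonglongrightarrow> 0" using y by simp
  define b where "b i = h k - x (r i) \<bullet> k" for i
  have b_lim: "b \<longlonglongrightarrow> h k"
  proof -
    have "(\<lambda>i. h k - x (r i) \<bullet> k) \<longlonglongrightarrow> h k - 0 \<bullet> k" by (intro tendsto_intros x_lim)
    then show ?thesis by (simp add: b_def[abs_def])
  qed
  define V where "V i = vol (g (r i))" for i
  have "\<forall>\<^sub>F i in sequentially. \<forall>u\<in>U. x (r i) \<bullet> u < h u"
  proof (rule eventually_ball_finite[OF U(1)], rule ballI, rule order_tendstoD(2))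
    fix u assume "u \<in> U"
    then show "0 \<bullet> u < h u" using hpos by simp
    show "(\<lambda>i. x (r i) \<bullet> u) \<longlonglongrightarrow> 0 \<bullet> u" by (intro tendsto_intros x_lim)
  qed
  \<comment> \<open>\<open>x (r i)\<close> lies in the unperturbed body, so its energy there is at
    most \<open>m\<close>; the perturbation changes only the term of \<open>k\<close>, which is
    estimated by the tangent at the slack \<open>b i\<close>.\<close>
  then have key: "\<forall>\<^sub>F i in sequentially. m * (V i powr (p / ?n) - 1) \<le> s (r i) * (\<alpha> k * p * b i powr (p - 1))"
  proof eventually_elim
    case (elim i)
    let ?x = "x (r i)"
    have bi: "0 < b i" using elim k by (simp add: b_def)
    have xh: "?x \<in> wulff U h" using elim by (auto simp: wulff_def intro: less_imp_le)
    have "m * V i powr (p / ?n) \<le> energy (g (r i)) ?x"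
      unfolding m_def V_def by (rule energy_vol_bound[OF h gvol x])
    also have "\<dots> = \<alpha> k * (b i + s (r i)) powr p + (\<Sum>u\<in>U - {k}. \<alpha> u * (h u - ?x \<bullet> u) powr p)"
    proof -
      have "energy (g (r i)) ?x = \<alpha> k * (g (r i) k - ?x \<bullet> k) powr p
          + (\<Sum>u\<in>U - {k}. \<alpha> u * (g (r i) u - ?x \<bullet> u) powr p)"
        unfolding energy_def by (rule sum.remove[OF U(1) k])
      also have "(\<Sum>u\<in>U - {k}. \<alpha> u * (g (r i) u - ?x \<bullet> u) powr p) = (\<Sum>u\<in>U - {k}. \<alpha> u * (h u - ?x \<bullet> u) powr p)"
        by (rule sum.cong) (auto simp: g_def)
      also have "g (r i) k - ?x \<bullet> k = b i + s (r i)" by (simp add: g_def b_def)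
      finally show ?thesis .
    qed
    also have "(b i + s (r i)) powr p \<le> b i powr p + p * b i powr (p - 1) * s (r i)"
      using powr_le_tangent[OF p bi, of "b i + s (r i)"] slack[OF k, of "r i"] by (simp add: g_def b_def)
    finally have "m * V i powr (p / ?n) \<le> \<alpha> k * (b i powr p + p * b i powr (p - 1) * s (r i))
        + (\<Sum>u\<in>U - {k}. \<alpha> u * (h u - ?x \<bullet> u) powr p)"
      using \<alpha>[OF k] by simp
    also have "\<dots> = energy h ?x + s (r i) * (\<alpha> k * p * b i powr (p - 1))"
      unfolding energy_def by (subst sum.remove[OF U(1) k]) (simp add: b_def algebra_simps)
    also have "energy h ?x \<le> m" using max0 xh by (simp add: maximiser_def m_def)
    finally show ?case by (simp add: algebra_simps)
  qed
  have Vq: "(\<lambda>i. (V i - 1) / s (r i)) \<longlonglongrightarrow> ?F"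
  proof -
    have "(\<lambda>i. (measure lebesgue (wulff U (h(k := h k + s i))) - measure lebesgue (wulff U h)) / s i) \<longlonglongrightarrow> ?F"
      using s_le c(2) by (intro wulff_volume_derivative[OF U k bounded x0 s_lim s0]) (meson order_trans)
    from LIMSEQ_subseq_LIMSEQ[OF this r] show ?thesis
      using v1 by (simp add: V_def vol_def g_def o_def)
  qed
  have sr: "(\<lambda>i. s (r i)) \<longlonglongrightarrow> 0" using LIMSEQ_subseq_LIMSEQ[OF s_lim r] by (simp add: o_def)
  have "(\<lambda>i. 1 + (V i - 1) / s (r i) * s (r i)) \<longlonglongrightarrow> 1 + ?F * 0" by (intro tendsto_intros Vq sr)
  then have V_lim: "V \<longlonglongrightarrow> 1" using s0 by simp
  have "((\<lambda>v. v powr (p / ?n)) has_real_derivative p / ?n * 1 powr (p / ?n - 1)) (at 1)"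
    by (rule has_real_derivative_powr) simp
  \<comment> \<open>Caratheodory's form of the derivative avoids dividing by \<open>V i - 1\<close>,
    which may be 0, for instance when the facet is empty.\<close>
  then obtain \<phi> where \<phi>: "\<And>v. v powr (p / ?n) - 1 powr (p / ?n) = \<phi> v * (v - 1)" "isCont \<phi> 1" "\<phi> 1 = p / ?n"
    unfolding CARAT_DERIV by auto
  have "(\<lambda>i. \<sigma> * (m * (\<phi> (V i) * ((V i - 1) / s (r i))))) \<longlonglongrightarrow> \<sigma> * (m * (p / ?n * ?F))"
    using isCont_tendsto_compose[OF \<phi>(2) V_lim] by (intro tendsto_intros Vq) (simp add: \<phi>(3))
  moreover have "(\<lambda>i. \<sigma> * (\<alpha> k * p * b i powr (p - 1))) \<longlonglongrightarrow> \<sigma> * (\<alpha> k * p * h k powr (p - 1))"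
    using hpos[OF k] by (intro tendsto_intros b_lim) auto
  moreover have "\<forall>\<^sub>F i in sequentially. \<sigma> * (m * (\<phi> (V i) * ((V i - 1) / s (r i)))) \<le> \<sigma> * (\<alpha> k * p * b i powr (p - 1))"
    using key
  proof eventually_elim
    case (elim i)
    \<comment> \<open>\<open>q\<close> is the size of the step. Dividing by it leaves only the sign
      \<sigma> on both sides, so \<sigma> = 1 and \<sigma> = -1 give opposite inequalities in the
      limit.\<close>
    define q where "q = c / real (Suc (r i))"
    have q: "0 < q" "s (r i) = \<sigma> * q" using c by (simp_all add: q_def s_def)
    have "\<sigma> \<noteq> 0" using \<sigma> by auto
    then have "\<sigma> * (m * (\<phi> (V i) * ((V i - 1) / s (r i)))) * q = m * (\<phi> (V i) * (V i - 1))"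
      using q by simp
    also have "\<dots> \<le> \<sigma> * (\<alpha> k * p * b i powr (p - 1)) * q"
      using elim \<phi>(1)[of "V i"] unfolding q by (simp add: mult_ac)
    finally show ?case using q by (simp only: mult_le_cancel_right_pos)
  qed
  ultimately have "\<sigma> * (m * (p / ?n * ?F)) \<le> \<sigma> * (\<alpha> k * p * h k powr (p - 1))"
    unfolding eventually_sequentially by (rule LIMSEQ_le)
  then show ?thesis by (simp add: m_def mult.assoc)
qed

text \<open>Read off from the volume derivative: the step \<open>c * t\<close> for the dilated body
  gives \<open>c ^ (n - 1)\<close> times the difference quotient of the original body with step
  \<open>t\<close>.\<close>

lemma facet_cylinder_scale:
  assumes h: "\<forall>v\<in>U. 0 < h v" and c: "0 < c" and u: "u \<in> U"
  shows "measure lebesgue (facet_cylinder U (\<lambda>v. c * h v) u)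
    = c ^ (CARD('n) - 1) * measure lebesgue (facet_cylinder U h u)"
proof -
  \<comment> \<open>The factor \<open>1 / (1 + c)\<close> makes both \<open>t i\<close> and
    \<open>c * t i\<close> at most 1, as the volume derivative requires.\<close>
  define t where "t i = (1 / (1 + c)) * (1 / real (Suc i))" for i
  have t0: "0 < t i" for i using c by (simp add: t_def)
  have t1: "t i \<le> 1 / (1 + c)" for i
    unfolding t_def using c by (intro mult_left_le) auto
  have "t i \<le> 1" "c * t i \<le> 1" for i
  proof -
    show "t i \<le> 1" using order_trans[OF t1[of i], of 1] c by simp
    have "c * t i \<le> c * (1 / (1 + c))" using t1[of i] c by (intro mult_left_mono) auto
    also have "\<dots> \<le> 1" using c by simp
    finally show "c * t i \<le> 1" .
  qed
  have "(\<lambda>i. (1 / (1 + c)) * (1 / real (Suc i))) \<longlonglongrightarrow> (1 / (1 + c)) * 0"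
    using LIMSEQ_inverse_real_of_nat by (intro tendsto_intros) (simp add: inverse_eq_divide)
  then have tl: "t \<longlonglongrightarrow> 0" by (simp add: t_def[abs_def])
  have ctl: "(\<lambda>i. c * t i) \<longlonglongrightarrow> 0" using tendsto_mult[OF tendsto_const[of c] tl] by simp
  have L1: "(\<lambda>i. (vol (h(u := h u + t i)) - vol h) / t i) \<longlonglongrightarrow> measure lebesgue (facet_cylinder U h u)"
    unfolding vol_def
  proof (rule wulff_volume_derivative[OF U u bounded _ tl])
    show "\<forall>v\<in>U. 0 \<bullet> v < h v" using h by simp
    show "t i \<noteq> 0" "\<bar>t i\<bar> \<le> 1" for i using t0[of i] \<open>t i \<le> 1\<close> by auto
  qed
  have L2: "(\<lambda>i. (vol ((\<lambda>v. c * h v)(u := c * h u + c * t i)) - vol (\<lambda>v. c * h v)) / (c * t i))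
      \<longlonglongrightarrow> measure lebesgue (facet_cylinder U (\<lambda>v. c * h v) u)"
    unfolding vol_def
  proof (rule wulff_volume_derivative[OF U u bounded _ ctl])
    show "\<forall>v\<in>U. 0 \<bullet> v < c * h v" using h c by simp
    show "c * t i \<noteq> 0" "\<bar>c * t i\<bar> \<le> 1" for i using t0[of i] c \<open>c * t i \<le> 1\<close> by (auto simp: abs_mult)
  qed
  have "(vol ((\<lambda>v. c * h v)(u := c * h u + c * t i)) - vol (\<lambda>v. c * h v)) / (c * t i)
      = c ^ (CARD('n) - 1) * ((vol (h(u := h u + t i)) - vol h) / t i)" for i
  proof -
    have "(\<lambda>v. c * h v)(u := c * h u + c * t i) = (\<lambda>v. c * (h(u := h u + t i)) v)"
      by (auto simp: distrib_left)
    then have "vol ((\<lambda>v. c * h v)(u := c * h u + c * t i)) = c ^ CARD('n) * vol (h(u := h u + t i))"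
      by (simp only: vol_scale[OF c])
    moreover have "c ^ CARD('n) = c * c ^ (CARD('n) - 1)" by (metis power_eq_if zero_less_card_finite less_irrefl)
    ultimately show ?thesis using vol_scale[OF c, of h] c t0[of i] by (simp add: field_simps)
  qed
  then have "(\<lambda>i. c ^ (CARD('n) - 1) * ((vol (h(u := h u + t i)) - vol h) / t i))
      \<longlonglongrightarrow> measure lebesgue (facet_cylinder U (\<lambda>v. c * h v) u)" using L2 by simp
  moreover have "(\<lambda>i. c ^ (CARD('n) - 1) * ((vol (h(u := h u + t i)) - vol h) / t i))
      \<longlonglongrightarrow> c ^ (CARD('n) - 1) * measure lebesgue (facet_cylinder U h u)"
    by (intro tendsto_intros L1)
  ultimately show ?thesis by (rule LIMSEQ_unique)
qed

theorem minkowski_solution_exists: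
  obtains h where "\<forall>u\<in>U. 0 < h u"
    "\<And>u. u \<in> U \<Longrightarrow> h u powr (1 - p) * measure lebesgue (facet_cylinder U h u) = \<alpha> u"
proof -
  let ?n = "real CARD('n)" and ?F = "\<lambda>h u. measure lebesgue (facet_cylinder U h u)"
  obtain h where h: "admissible h" "\<And>g. admissible g \<Longrightarrow> energy h 0 \<le> energy g 0"
    using minimiser_exists by blast
  define m where "m = energy h 0"
  have max0: "maximiser h 0" and vge: "1 \<le> vol h" using h(1) by (auto simp: admissible_def)
  obtain x0 where x0: "\<forall>u\<in>U. x0 \<bullet> u < h u" using strict_point_exists[of h] vge by auto
  have hpos: "0 < h u" if "u \<in> U" for u using maximiser_strict[OF max0 x0 that] by simp
  have m: "0 < m"
    unfolding m_def energy_def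
  proof (rule sum_pos[OF U(1) U_nonempty])
    show "0 < \<alpha> u * (h u - 0 \<bullet> u) powr p" if "u \<in> U" for u
      using \<alpha>[OF that] hpos[OF that] by simp
  qed
  \<comment> \<open>Comparing \<open>h\<close> with itself in the scale invariant bound forces the
    volume down to 1.\<close>
  have "m * vol h powr (p / ?n) \<le> m * 1"
    using energy_vol_bound[OF h _ max0] vge by (simp add: m_def)
  then have le1: "vol h powr (p / ?n) \<le> 1 powr (p / ?n)" using m by simp
  have v1: "vol h = 1"
  proof (rule ccontr)
    assume "vol h \<noteq> 1"
    then have "1 powr (p / ?n) < vol h powr (p / ?n)" using vge p by (intro powr_less_mono2) auto
    then show False using le1 by simp
  qed
  have crit: "m / ?n * ?F h u = \<alpha> u * h u powr (p - 1)" if "u \<in> U" for u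
  proof -
    have "m * (p / ?n) * ?F h u = \<alpha> u * p * h u powr (p - 1)"
      using one_sided_variation[OF h v1 that, of 1] one_sided_variation[OF h v1 that, of "-1"]
      by (simp add: m_def)
    then have "p * (m / ?n * ?F h u) = p * (\<alpha> u * h u powr (p - 1))" by (simp add: mult_ac)
    then show ?thesis using p(1) by (simp only: mult_cancel_left) auto
  qed
  \<comment> \<open>Dilation by \<open>c\<close> multiplies \<open>h u powr (1 - p)\<close> times
    the area by \<open>c powr (n - p)\<close>; this \<open>c\<close> absorbs the multiplier
    \<open>m / n\<close>, and \<open>p < 1 \<le> n\<close> keeps the exponent positive.\<close>
  define c where "c = (m / ?n) powr (1 / (?n - p))"
  have n1: "1 \<le> ?n" by (simp add: Suc_leI)
  then have np: "0 < ?n - p" using p by linarith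
  have c: "0 < c" using m by (simp add: c_def)
  show ?thesis
  proof (rule that[of "\<lambda>u. c * h u"])
    show "\<forall>u\<in>U. 0 < c * h u" using hpos c by simp
    fix u assume u: "u \<in> U"
    have "c powr (1 - p) * c ^ (CARD('n) - 1) = c powr (1 - p) * c powr (?n - 1)"
      using c n1 by (simp add: of_nat_diff flip: powr_realpow)
    also have "\<dots> = c powr (?n - p)" by (simp flip: powr_add)
    also have "\<dots> = m / ?n" using np m by (simp add: c_def powr_powr)
    finally have cc: "c powr (1 - p) * c ^ (CARD('n) - 1) = m / ?n" .
    have "(c * h u) powr (1 - p) * ?F (\<lambda>u. c * h u) u
        = (c powr (1 - p) * c ^ (CARD('n) - 1)) * h u powr (1 - p) * ?F h u"
      using facet_cylinder_scale[OF _ c u, of h] hpos c u by (simp add: powr_mult)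
    also have "\<dots> = h u powr (1 - p) * (m / ?n * ?F h u)" unfolding cc by (simp add: mult_ac)
    also have "\<dots> = \<alpha> u * (h u powr (1 - p) * h u powr (p - 1))" unfolding crit[OF u] by (simp add: mult_ac)
    also have "h u powr (1 - p) * h u powr (p - 1) = 1" using hpos[OF u] by (simp flip: powr_add)
    finally show "(c * h u) powr (1 - p) * ?F (\<lambda>u. c * h u) u = \<alpha> u" by simp
  qed
qed

end

section \<open>Necessity and the main theorem\<close>

lemma emeasure_discrete_measure:
  assumes "A \<in> sets sphere_borel"
  shows "emeasure (discrete_measure U \<alpha>) A = (\<Sum>u\<in>U. ennreal (\<alpha> u) * indicator A u)"
  unfolding discrete_measure_def
proof (rule emeasure_measure_of_sigma)
  show "sigma_algebra (sphere 0 1) (sets sphere_borel)"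
    using sets.sigma_algebra_axioms[of sphere_borel] by (simp add: space_sphere_borel)
  show "positive (sets sphere_borel) (\<lambda>A. \<Sum>u\<in>U. ennreal (\<alpha> u) * indicator A u)"
    by (simp add: positive_def)
  show "countably_additive (sets sphere_borel) (\<lambda>A. \<Sum>u\<in>U. ennreal (\<alpha> u) * indicator A u)"
  proof (rule countably_additiveI)
    fix A :: "nat \<Rightarrow> 'a set" assume "disjoint_family A"
    then have "(\<Sum>i. indicator (A i) u :: ennreal) = indicator (\<Union>i. A i) u" for u
      by (rule suminf_indicator)
    then show "(\<Sum>i. \<Sum>u\<in>U. ennreal (\<alpha> u) * indicator (A i) u)
        = (\<Sum>u\<in>U. ennreal (\<alpha> u) * indicator (\<Union>i. A i) u)"
      by (subst suminf_sum) auto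
  qed
qed (use assms in auto)

text \<open>Halfspaces may share a normal after normalisation, so \<open>h\<close> is the support
  function of \<open>P\<close> instead of their offsets; it is at most each offset and so cuts out
  the same set.\<close>

lemma polytope_as_wulff:
  fixes P :: "(real ^ 'n) set"
  assumes P: "polytope P" and int: "0 \<in> interior P"
  obtains V h where "finite V" "V \<subseteq> sphere 0 1" "\<forall>v\<in>V. 0 < h v" "P = wulff V h"
proof -
  have bd: "bounded P" and poly: "polyhedron P"
    using P by (auto simp: polytope_eq_bounded_polyhedron)
  have P0: "0 \<in> P" using int interior_subset by blast
  obtain F where F: "finite F" "P = \<Inter>F" "\<forall>H\<in>F. \<exists>a b. a \<noteq> 0 \<and> H = {x. a \<bullet> x \<le> b}"
    using poly unfolding polyhedron_def by blast
  then obtain a b where ab: "\<And>H. H \<in> F \<Longrightarrow> a H \<noteq> 0 \<and> H = {x. a H \<bullet> x \<le> b H}" by metis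
  define V where "V = (\<lambda>H. a H /\<^sub>R norm (a H)) ` F"
  define h where "h v = (SUP x\<in>P. x \<bullet> v)" for v
  obtain R where R: "\<And>x. x \<in> P \<Longrightarrow> norm x \<le> R" using bd by (auto simp: bounded_iff)
  have bddh: "bdd_above ((\<lambda>x. x \<bullet> v) ` P)" for v
  proof (rule bdd_aboveI2)
    fix x assume "x \<in> P"
    then show "x \<bullet> v \<le> R * norm v"
      using norm_cauchy_schwarz[of x v] R mult_right_mono[of "norm x" R "norm v"] by force
  qed
  have hle: "x \<bullet> v \<le> h v" if "x \<in> P" for x v
    unfolding h_def using bddh that by (rule cSUP_upper2) auto
  have VS: "V \<subseteq> sphere 0 1" using ab by (auto simp: V_def)
  have "P = wulff V h"
  proof (rule antisym)
    show "P \<subseteq> wulff V h" using hle by (auto simp: wulff_def)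
    show "wulff V h \<subseteq> P"
    proof
      fix x assume x: "x \<in> wulff V h"
      have "x \<in> H" if H: "H \<in> F" for H
      proof -
        let ?n = "norm (a H)"
        have n: "0 < ?n" using ab[OF H] by simp
        have "y \<bullet> (a H /\<^sub>R ?n) \<le> b H / ?n" if "y \<in> P" for y
        proof -
          have "a H \<bullet> y \<le> b H" using that F(2) H ab[OF H] by blast
          then show ?thesis using n by (simp add: inner_commute divide_inverse mult.commute)
        qed
        then have "h (a H /\<^sub>R ?n) \<le> b H / ?n"
          unfolding h_def using P0 by (intro cSUP_least) auto
        moreover have "x \<bullet> (a H /\<^sub>R ?n) \<le> h (a H /\<^sub>R ?n)" using x H by (auto simp: wulff_def V_def)
        ultimately have "x \<bullet> (a H /\<^sub>R ?n) \<le> b H / ?n" by linarith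
        then have "a H \<bullet> x \<le> b H" using n by (simp add: inner_commute divide_inverse mult.commute)
        then show "x \<in> H" using ab[OF H] by blast
      qed
      then show "x \<in> P" using F(2) by blast
    qed
  qed
  moreover have "finite V" using F(1) by (simp add: V_def)
  moreover have "\<forall>v\<in>V. 0 < h v"
    using int interior_wulff[of V h] VS \<open>finite V\<close> \<open>P = wulff V h\<close> by force
  ultimately show ?thesis using VS that by blast
qed

text \<open>If all facets seen from the direction \<open>- w\<close> were null, so would be their projection along \<open>w\<close>,
  which contains a ball of the hyperplane orthogonal to \<open>w\<close>.\<close>
lemma facet_facing_exists:
  fixes V :: "(real ^ 'n) set"
  assumes V: "finite V" "V \<subseteq> sphere 0 1" and bd: "bounded (wulff V h)" and h: "\<forall>v\<in>V. 0 < h v"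
    and w: "norm w = 1"
  obtains v where "v \<in> V" "v \<bullet> w < 0" "measure lebesgue (facet_cylinder V h v) \<noteq> 0"
proof (rule ccontr)
  assume "\<not> thesis"
  then have null: "measure lebesgue (facet_cylinder V h v) = 0" if "v \<in> V" "v \<bullet> w < 0" for v
    using that by (meson \<open>\<And>v. \<lbrakk>v \<in> V; v \<bullet> w < 0; measure lebesgue (facet_cylinder V h v) \<noteq> 0\<rbrakk> \<Longrightarrow> thesis\<close>)
  define N where "N = {v \<in> V. v \<bullet> w < 0}"
  have finN: "finite N" using V by (simp add: N_def)
  let ?H = "hausdorff_measure (CARD('n) - 1) :: (real ^ 'n) measure"
  \<comment> \<open>Closed facets, because a ray may leave the body through a lower-dimensional
    face.\<close>
  define F where "F v = wulff V h \<inter> {x. x \<bullet> v = h v}" for v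
  have borelF: "F v \<in> sets borel" for v unfolding F_def by (intro sets.Int borel_wulff borel_hyperplane)
  have nullF: "emeasure ?H (F v) = 0" if v: "v \<in> N" for v
  proof -
    have nv: "norm v = 1" using v V by (auto simp: N_def)
    obtain c where c: "\<And>A a. A \<in> sets borel \<Longrightarrow> A \<subseteq> {x. x \<bullet> v = a} \<Longrightarrow>
         emeasure ?H A = ennreal c * emeasure lborel (cylinder v {y. y + a *\<^sub>R v \<in> A})"
      using hausdorff_measure_affine_hyperplane[OF nv] by metis
    let ?A = "{y. y + h v *\<^sub>R v \<in> F v}"
    have "emeasure ?H (F v) = ennreal c * emeasure lborel (cylinder v ?A)"
      using borelF by (rule c) (auto simp: F_def)
    also have "cylinder v ?A = facet_cylinder V h v"
      using nv by (auto simp: cylinder_def facet_cylinder_def F_def inner_left_distrib dot_square_norm)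
    also have "emeasure lborel (facet_cylinder V h v) = ennreal (measure lebesgue (facet_cylinder V h v))"
      using facet_cylinder_finite[OF nv bd] borel_facet_cylinder[of V h v]
      by (simp add: emeasure_eq_ennreal_measure less_top)
    finally show ?thesis using null[of v] v by (simp add: N_def)
  qed
  have "0 \<in> interior (wulff V h)"
    using h V by (subst interior_wulff) auto
  then obtain r where r: "0 < r" "cball 0 r \<subseteq> wulff V h" by (auto simp: mem_interior_cball)
  \<comment> \<open>Otherwise the whole ray in direction \<open>- w\<close> would stay in the body,
    against boundedness.\<close>
  have "N \<noteq> {}"
  proof
    assume "N = {}"
    then have Vw: "0 \<le> v \<bullet> w" if "v \<in> V" for v using that by (auto simp: N_def not_less)
    obtain R where R: "\<And>x. x \<in> wulff V h \<Longrightarrow> norm x \<le> R" using bd by (auto simp: bounded_iff)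
    let ?x = "- (\<bar>R\<bar> + 1) *\<^sub>R w"
    have "?x \<bullet> v \<le> h v" if "v \<in> V" for v
    proof -
      have "?x \<bullet> v \<le> 0" using Vw[OF that] by (simp add: inner_commute mult_nonpos_nonneg)
      then show ?thesis using h that by force
    qed
    then have "norm ?x \<le> R" by (intro R) (auto simp: wulff_def)
    then show False using w by simp
  qed
  let ?S = "cball 0 r \<inter> {x. x \<bullet> w = 0}"
  have "?S \<subseteq> proj_perp w ` (\<Union>v\<in>N. F v)"
  proof
    fix b assume b: "b \<in> ?S"
    \<comment> \<open>\<open>f v\<close> is the time at which the ray
      \<open>b - t *\<^sub>R w\<close> meets the hyperplane of \<open>v\<close>; the least of these
      times is the exit time from the body.\<close>
    define f where "f v = (h v - b \<bullet> v) / - (v \<bullet> w)" for v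
    define t where "t = Min (f ` N)"
    have "t \<in> f ` N" unfolding t_def using finN \<open>N \<noteq> {}\<close> by (intro Min_in) auto
    then obtain v where v: "v \<in> N" "t = f v" by blast
    have bv: "b \<bullet> u \<le> h u" if "u \<in> V" for u using b r(2) that by (auto simp: wulff_def)
    have t0: "0 \<le> t" 
      using v(1) bv[of v] unfolding v(2) f_def by (intro divide_nonneg_pos) (auto simp: N_def)
    let ?x = "b - t *\<^sub>R w"
    have "?x \<bullet> u \<le> h u" if u: "u \<in> V" for u
    proof (cases "u \<in> N")
      case True
      then have "t \<le> f u" unfolding t_def using finN by (intro Min_le) auto
      moreover have "0 < - (u \<bullet> w)" using True by (simp add: N_def)
      ultimately have "t * - (u \<bullet> w) \<le> h u - b \<bullet> u" unfolding f_def by (simp only: pos_le_divide_eq)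
      then show ?thesis by (simp add: inner_diff_left inner_commute[of w])
    next
      case False
      then have "0 \<le> t * (u \<bullet> w)" using u t0 by (auto simp: N_def)
      then show ?thesis using bv[OF u] by (simp add: inner_diff_left inner_commute[of w])
    qed
    moreover have "?x \<bullet> v = h v"
    proof -
      have "t * (v \<bullet> w) = b \<bullet> v - h v" using v(1) unfolding v(2) f_def N_def by simp
      then show ?thesis by (simp add: inner_diff_left inner_commute[of w])
    qed
    ultimately have "?x \<in> F v" by (simp add: F_def wulff_def)
    moreover have "proj_perp w ?x = b"
      using b w by (simp add: proj_perp_def inner_diff_left dot_square_norm)
    ultimately show "b \<in> proj_perp w ` (\<Union>v\<in>N. F v)" using v(1) by (intro image_eqI[of _ _ ?x]) auto
  qed
  then have "hausdorff_outer_measure (CARD('n) - 1) ?S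
      \<le> hausdorff_outer_measure (CARD('n) - 1) (proj_perp w ` (\<Union>v\<in>N. F v))"
    by (rule hausdorff_outer_measure_mono)
  also have "\<dots> \<le> hausdorff_outer_measure (CARD('n) - 1) (\<Union>v\<in>N. F v)"
    using w by (intro hausdorff_outer_measure_lipschitz_image dist_proj_perp_le)
  also have "\<dots> = emeasure ?H (\<Union>v\<in>N. F v)"
    using finN borelF by (intro emeasure_hausdorff_measure[symmetric] sets.finite_UN) auto
  also have "\<dots> \<le> (\<Sum>v\<in>N. emeasure ?H (F v))"
    using finN borelF by (intro emeasure_subadditive_finite) auto
  also have "\<dots> = 0" using nullF by simp
  finally have "hausdorff_outer_measure (CARD('n) - 1) ?S = 0" by simp
  moreover have S: "?S \<in> sets borel" by (intro sets.Int borel_hyperplane) auto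
  ultimately have "emeasure ?H ?S = 0" by (simp add: emeasure_hausdorff_measure)
  moreover obtain c where c: "0 < c" "\<And>A. A \<in> sets borel \<Longrightarrow> A \<subseteq> {x. x \<bullet> w = 0} \<Longrightarrow>
         emeasure ?H A = ennreal c * emeasure lborel (cylinder w A)"
    using hausdorff_measure_hyperplane[OF w] by metis
  ultimately have "ennreal c * emeasure lborel (cylinder w ?S) = 0" using c(2)[OF S] by auto
  then show False using c(1) emeasure_cylinder_ball_pos[OF w r(1)] by simp
qed

theorem mainTheorem1:
  fixes p :: real
    and \<mu> :: "(real ^ 'n) measure"
    and U :: "(real ^ 'n) set"
    and \<alpha> :: "real ^ 'n \<Rightarrow> real"
  assumes "0 < p" and "p < 1"
    and "finite U" and "U \<subseteq> sphere 0 1"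
    and "\<And>u. u \<in> U \<Longrightarrow> 0 < \<alpha> u"
    and "\<mu> = discrete_measure U \<alpha>"
  shows "(\<exists>P :: (real ^ 'n) set.
            full_polytope P \<and> 0 \<in> interior P \<and> Lp_surface_area_measure p P = \<mu>)
         \<longleftrightarrow> \<not> concentrated_on_closed_hemisphere U"
proof -
  obtain \<kappa> :: "real ^ 'n \<Rightarrow> real" where \<kappa>: "\<forall>u\<in>sphere 0 1. 0 < \<kappa> u"
    and "\<forall>p U h x0. finite U \<longrightarrow> U \<subseteq> sphere 0 1 \<longrightarrow> bounded (wulff U h) \<longrightarrow> (\<forall>v\<in>U. x0 \<bullet> v < h v) \<longrightarrow>
       Lp_surface_area_measure p (wulff U h)
         = discrete_measure U (\<lambda>u. h u powr (1 - p) * (\<kappa> u * measure lebesgue (facet_cylinder U h u)))"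
    using Lp_surface_area_measure_wulff by blast
  note Lp = this(2)[rule_format]
  show ?thesis
  proof
    assume "\<exists>P :: (real ^ 'n) set. full_polytope P \<and> 0 \<in> interior P \<and> Lp_surface_area_measure p P = \<mu>"
    then obtain P :: "(real ^ 'n) set" where P: "polytope P" "0 \<in> interior P" "Lp_surface_area_measure p P = \<mu>"
      by (auto simp: full_polytope_def)
    obtain V h where V: "finite V" "V \<subseteq> sphere 0 1" "\<forall>v\<in>V. 0 < h v" "P = wulff V h"
      using polytope_as_wulff[OF P(1,2)] .
    have bd: "bounded (wulff V h)" using P(1) V(4) polytope_imp_bounded by blast
    define \<beta> where "\<beta> v = h v powr (1 - p) * (\<kappa> v * measure lebesgue (facet_cylinder V h v))" for v
    have "Lp_surface_area_measure p P = discrete_measure V \<beta>"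
      unfolding V(4) \<beta>_def using V(3) by (intro Lp[OF V(1,2) bd, of 0]) auto
    then have eq: "discrete_measure V \<beta> = discrete_measure U \<alpha>" using P(3) assms(6) by simp
    show "\<not> concentrated_on_closed_hemisphere U"
    proof
      assume "concentrated_on_closed_hemisphere U"
      then obtain w where w: "norm w = 1" "U \<subseteq> closed_hemisphere w"
        by (auto simp: concentrated_on_closed_hemisphere_def)
      obtain v where v: "v \<in> V" "v \<bullet> w < 0" "measure lebesgue (facet_cylinder V h v) \<noteq> 0"
        using facet_facing_exists[OF V(1,2) bd V(3) w(1)] .
      \<comment> \<open>The open hemisphere complementary to \<open>closed_hemisphere w\<close>: it
        has no mass under the measure supported in \<open>U\<close>, yet contains the facet normal
        \<open>v\<close> of positive weight.\<close>
      let ?A = "sphere 0 1 \<inter> {x. w \<bullet> x < 0}"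
      have A: "?A \<in> sets sphere_borel"
        unfolding sphere_borel_def by (auto simp: sets_restrict_space intro!: image_eqI[of _ _ "{x. w \<bullet> x < 0}"])
      have "(\<Sum>u\<in>V. ennreal (\<beta> u) * indicator ?A u) = (\<Sum>u\<in>U. ennreal (\<alpha> u) * indicator ?A u)"
        using emeasure_discrete_measure[OF A, of V \<beta>] emeasure_discrete_measure[OF A, of U \<alpha>] eq by simp
      also have "\<dots> = 0"
        using w(2) by (intro sum.neutral) (auto simp: closed_hemisphere_def indicator_def inner_commute not_less)
      finally have "\<forall>u\<in>V. ennreal (\<beta> u) * indicator ?A u = 0" using V(1) by (simp only: sum_eq_0_iff)
      then have "ennreal (\<beta> v) * indicator ?A v = 0" using v(1) by (rule bspec)
      moreover have "v \<in> ?A" using v V(2) by (auto simp: inner_commute)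
      moreover have "0 < \<beta> v"
      proof -
        have "0 < \<kappa> v" "0 < h v" using \<kappa> V(2,3) v(1) by blast+
        moreover have "0 < measure lebesgue (facet_cylinder V h v)" using v(3) by (simp add: less_le)
        ultimately show ?thesis by (simp add: \<beta>_def)
      qed
      ultimately show False by simp
    qed
  next
    assume nc: "\<not> concentrated_on_closed_hemisphere U"
    \<comment> \<open>The factors \<kappa> are divided out here, so that the surface area measure of
      the solution multiplies them back to \<alpha>.\<close>
    interpret minkowski_data U "\<lambda>u. \<alpha> u / \<kappa> u" p
      using assms nc \<kappa> by unfold_locales (auto simp: subset_iff)
    obtain h where h: "\<forall>u\<in>U. 0 < h u"
      "\<And>u. u \<in> U \<Longrightarrow> h u powr (1 - p) * measure lebesgue (facet_cylinder U h u) = \<alpha> u / \<kappa> u"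
      using minkowski_solution_exists by blast
    let ?P = "wulff U h"
    have "polytope ?P" using polyhedron_wulff[OF assms(3)] bounded by (simp add: polytope_eq_bounded_polyhedron)
    moreover have "0 < measure lebesgue ?P" using vol_pos[of 0 h] h(1) by (simp add: vol_def)
    moreover have "0 \<in> interior ?P" using h(1) by (simp add: interior_wulff[OF assms(3) U0])
    moreover have "Lp_surface_area_measure p ?P = \<mu>"
    proof -
      have "Lp_surface_area_measure p ?P
          = discrete_measure U (\<lambda>u. h u powr (1 - p) * (\<kappa> u * measure lebesgue (facet_cylinder U h u)))"
        using h(1) by (intro Lp[OF assms(3,4) bounded, of 0]) auto
      also have "\<dots> = discrete_measure U \<alpha>"
      proof -
        have "h u powr (1 - p) * (\<kappa> u * measure lebesgue (facet_cylinder U h u)) = \<alpha> u" if "u \<in> U" for u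
        proof -
          have "0 < \<kappa> u" using \<kappa> that assms(4) by blast
          then show ?thesis using h(2)[OF that] by (simp add: field_simps)
        qed
        then show ?thesis unfolding discrete_measure_def
          by (intro arg_cong[where f = "measure_of (sphere 0 1) (sets sphere_borel)"] ext sum.cong) auto
      qed
      finally show ?thesis using assms(6) by simp
    qed
    ultimately show "\<exists>P :: (real ^ 'n) set. full_polytope P \<and> 0 \<in> interior P \<and> Lp_surface_area_measure p P = \<mu>"
      unfolding full_polytope_def by blast
  qed
qed

end
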